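(* Let $T\colon \mathbb{R}^d\times \mathcal{X}\to \mathcal{X}$ be a continuous action of $\mathbb{R}^d$ on a compact metric space $(\mathcal{X}, \mathbf{d})$. Let $\lambda$ be a Borel probability measure on $\mathscr{M}^T(\mathcal{X})$ and define $\mu \in \mathscr{M}^T(\mathcal{X})$ by $\mu = \int_{\mathscr{M}^T(\mathcal{X})} \nu \, d\lambda(\nu)$. Then \[ \underline{\mathrm{rdim}}(\mathcal{X}, T, \mathbf{d}, \mu) \geq \int_{\mathscr{M}^T(\mathcal{X})} \underline{\mathrm{rdim}}(\mathcal{X}, T, \mathbf{d}, \nu) \, d\lambda(\nu). \]
   Context: Conventions: $d$ is a positive integer, $\log=\log_2$, and $\mathbf{m}$ is Lebesgue measure on $\mathbb{R}^d$. $\mathscr{M}^T(\mathcal{X})$ is the set of $T$-invariant Borel probability measures on $\mathcal{X}$ with the weak$^*$ topology and its Borel $\sigma$-algebra; $\mu=\int\nu\,d\lambda(\nu)$ means $\mu(A)=\int \nu(A)\,d\lambda(\nu)$ for all Borel $A\subset\mathcal{X}$. Mutual information: for random variables $X,Y$ with values in finite sets, $I(X;Y)=H(X)+H(Y)-H(X,Y)$ where $H$ is Shannon entropy (base 2). For $X,Y$ with values in measurable spaces, $I(X;Y)$ is the supremum of $I(\alpha\circ X;\beta\circ Y)$ over all finite measurable partitions $\alpha,\beta$ of the two target spaces, where $\alpha\circ X$ is the index of the element of $\alpha$ containing $X$ (similarly $\beta\circ Y$). Rate distortion function: for $L>0$, $L^1([0,L)^d,\mathcal{X})$ is the space of measurable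 maps $[0,L)^d\to\mathcal{X}$ modulo $\mathbf{m}$-a.e. equality, with metric $D(f,g)=\int_{[0,L)^d}\mathbf{d}(f(u),g(u))\,d\mathbf{m}(u)$ and its Borel $\sigma$-algebra. For $\mu\in\mathscr{M}^T(\mathcal{X})$ and $\varepsilon>0$, $R_L(\mathbf{d},\mu,\varepsilon)$ is the infimum of $I(X;Y)$ over pairs of random variables $X,Y$ defined on a common probability space such that $X$ takes values in $\mathcal{X}$ with law $\mu$, and $Y=(Y_u)_{u\in[0,L)^d}$ takes values in $L^1([0,L)^d,\mathcal{X})$ with $\mathbb{E}\big(\frac{1}{L^d}\int_{[0,L)^d}\mathbf{d}(T^uX,Y_u)\,d\mathbf{m}(u)\big)<\varepsilon$. Set $R(\mathbf{d},\mu,\varepsilon)=\lim_{L\to\infty}R_L(\mathbf{d},\mu,\varepsilon)/L^d$; this limit exists, is finite, and equals $\inf_{L>0}R_L(\mathbf{d},\mu,\varepsilon)/L^d$. Lower rate distortion dimension: $\underline{\mathrm{rdim}}(\mathcal{X},T,\mathbf{d},\mu)=\liminf_{\varepsilon\to0}\frac{R(\mathbf{d},\mu,\varepsilon)}{\log(1/\varepsilon)}\in[0,\infty]$. *)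

theory Defs
  imports "HOL-Probability.Probability"
begin

class compact_metric_space = metric_space +
  assumes compact_UNIV: "compact UNIV"

text \<open>Compact metric spaces are complete and separable, so the Polish-space library applies.\<close>

instance compact_metric_space \<subseteq> polish_space
proof
  fix X :: "nat \<Rightarrow> 'a" assume X: "Cauchy X"
  obtain l where "X \<longlonglongrightarrow> l"
    using completeE[OF compact_imp_complete[OF compact_UNIV], of X] X by auto
  then show "convergent X"
    by (rule convergentI)
next
  have "\<exists>k::'a set. finite k \<and> UNIV \<subseteq> (\<Union>x\<in>k. ball x (1 / real (Suc n)))" for n
    using compact_UNIV[where 'a='a] unfolding compact_eq_totally_bounded
    by (metis of_nat_0_less_iff zero_less_Suc zero_less_divide_1_iff)
  then obtain k :: "nat \<Rightarrow> 'a set" where fin: "\<And>n. finite (k n)"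
    and cov: "\<And>n. UNIV \<subseteq> (\<Union>x\<in>k n. ball x (1 / real (Suc n)))"
    by metis
  define B where "B = (\<Union>n. (\<lambda>x. ball x (1 / real (Suc n))) ` k n)"
  have "countable B"
    unfolding B_def using fin by (intro countable_UN) (auto intro: countable_finite)
  moreover have "topological_basis B"
  proof (rule topological_basisI)
    show "open U" if "U \<in> B" for U using that by (auto simp: B_def)
    fix O' :: "'a set" and x assume O: "open O'" "x \<in> O'"
    then obtain e where e: "e > 0" "ball x e \<subseteq> O'" using open_contains_ball by blast
    then obtain n where n: "1 / real (Suc n) < e / 2"
      by (metis half_gt_zero nat_approx_posE)
    obtain y where y: "y \<in> k n" "x \<in> ball y (1 / real (Suc n))" using cov[of n] by blast
    have "ball y (1 / real (Suc n)) \<subseteq> ball x e"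
    proof
      fix z assume z: "z \<in> ball y (1 / real (Suc n))"
      have "dist x z \<le> dist y x + dist y z" by (metis dist_commute dist_triangle)
      with z y n show "z \<in> ball x e" by simp
    qed
    with y e show "\<exists>B'\<in>B. x \<in> B' \<and> B' \<subseteq> O'"
      by (auto simp: B_def)
  qed
  ultimately show "\<exists>B::'a set set. countable B \<and> open = generate_topology B"
    using topological_basis_imp_subbasis by blast
qed

definition continuous_action :: "(real ^ 'n \<Rightarrow> 'a::compact_metric_space \<Rightarrow> 'a) \<Rightarrow> bool" where
  "continuous_action T \<longleftrightarrow>
     continuous_on UNIV (\<lambda>(u, x). T u x) \<and>
     (\<forall>x. T 0 x = x) \<and> (\<forall>u v x. T (u + v) x = T u (T v x))"

definition invariant_measures ::
    "(real ^ 'n \<Rightarrow> 'a::compact_metric_space \<Rightarrow> 'a) \<Rightarrow> 'a measure set" where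
  "invariant_measures T =
     {\<nu>. prob_space \<nu> \<and> sets \<nu> = sets borel \<and> (\<forall>u. distr \<nu> borel (T u) = \<nu>)}"

definition weak_star_topology ::
    "(real ^ 'n \<Rightarrow> 'a::compact_metric_space \<Rightarrow> 'a) \<Rightarrow> 'a measure topology" where
  "weak_star_topology T = topology_generated_by
     {{\<nu> \<in> invariant_measures T. (\<integral>x. f x \<partial>\<nu>) \<in> U} | (f :: 'a \<Rightarrow> real) U.
        continuous_on UNIV f \<and> open U}"

definition invariant_measures_borel ::
    "(real ^ 'n \<Rightarrow> 'a::compact_metric_space \<Rightarrow> 'a) \<Rightarrow> 'a measure measure" where
  "invariant_measures_borel T =
     sigma (invariant_measures T) {U. openin (weak_star_topology T) U}"

definition finite_measurable_partition :: "'b measure \<Rightarrow> 'b set set \<Rightarrow> bool" where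
  "finite_measurable_partition S \<alpha> \<longleftrightarrow> finite \<alpha> \<and> \<alpha> \<subseteq> sets S \<and> partition_on (space S) \<alpha>"

text \<open>A partition is indexed by itself: the index of the element containing a point is
  that element.\<close>

definition cell :: "'b set set \<Rightarrow> 'b \<Rightarrow> 'b set" where
  "cell \<alpha> x = (THE A. A \<in> \<alpha> \<and> x \<in> A)"

text \<open>For a random variable with finitely many values, the library's differential entropy relative
  to the counting measure on its range is the Shannon entropy
  (see \<open>information_space.entropy_simple_distributed\<close>).\<close>

definition shannon_entropy :: "'w measure \<Rightarrow> ('w \<Rightarrow> 'b) \<Rightarrow> real" where
  "shannon_entropy P X = prob_space.entropy P 2 (count_space (X ` space P)) X"

definition finite_mutual_information :: "'w measure \<Rightarrow> ('w \<Rightarrow> 'b) \<Rightarrow> ('w \<Rightarrow> 'c) \<Rightarrow> real" where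
  "finite_mutual_information P X Y =
     shannon_entropy P X + shannon_entropy P Y - shannon_entropy P (\<lambda>\<omega>. (X \<omega>, Y \<omega>))"

definition mutual_info ::
    "'w measure \<Rightarrow> 'b measure \<Rightarrow> 'c measure \<Rightarrow> ('w \<Rightarrow> 'b) \<Rightarrow> ('w \<Rightarrow> 'c) \<Rightarrow> ennreal" where
  "mutual_info P S S' X Y =
     Sup {ennreal (finite_mutual_information P (cell \<alpha> \<circ> X) (cell \<beta> \<circ> Y)) | \<alpha> \<beta>.
            finite_measurable_partition S \<alpha> \<and> finite_measurable_partition S' \<beta>}"

definition cube :: "real \<Rightarrow> (real ^ 'n) set" where
  "cube L = {u. \<forall>i. 0 \<le> u $ i \<and> u $ i < L}"

text \<open>Maps on the cube are represented by maps on the whole of Euclidean space; their values outside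
  the cube are ignored by the equivalence relation, so the equivalence classes are exactly the
  classes of measurable maps on the cube modulo almost everywhere equality. Borel and Lebesgue
  measurable maps give the same classes, as the target is second countable.\<close>

definition cube_measure :: "real \<Rightarrow> (real ^ 'n) measure" where
  "cube_measure L = restrict_space lborel (cube L)"

definition L1_rel ::
    "real \<Rightarrow> ((real ^ 'n \<Rightarrow> 'a::compact_metric_space) \<times> (real ^ 'n \<Rightarrow> 'a)) set" where
  "L1_rel L = {(f, g). f \<in> cube_measure L \<rightarrow>\<^sub>M borel \<and> g \<in> cube_measure L \<rightarrow>\<^sub>M borel \<and>
                       (AE u in cube_measure L. f u = g u)}"

definition L1_space :: "real \<Rightarrow> (real ^ 'n \<Rightarrow> 'a::compact_metric_space) set set" where
  "L1_space L = (cube_measure L \<rightarrow>\<^sub>M borel) // L1_rel L"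

definition L1_rep :: "(real ^ 'n \<Rightarrow> 'a::compact_metric_space) set \<Rightarrow> real ^ 'n \<Rightarrow> 'a" where
  "L1_rep F = (SOME f. f \<in> F)"

definition L1_dist ::
    "real \<Rightarrow> (real ^ 'n \<Rightarrow> 'a::compact_metric_space) set \<Rightarrow> (real ^ 'n \<Rightarrow> 'a) set \<Rightarrow> real" where
  "L1_dist L F G = (\<integral>u. dist (L1_rep F u) (L1_rep G u) \<partial>cube_measure L)"

definition L1_borel :: "real \<Rightarrow> (real ^ 'n \<Rightarrow> 'a::compact_metric_space) set measure" where
  "L1_borel L =
     sigma (L1_space L) {U. openin (Metric_space.mtopology (L1_space L) (L1_dist L)) U}"

definition distortion ::
    "(real ^ 'n \<Rightarrow> 'a::compact_metric_space \<Rightarrow> 'a) \<Rightarrow> real \<Rightarrow> 'w measure \<Rightarrow> ('w \<Rightarrow> 'a)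
       \<Rightarrow> ('w \<Rightarrow> (real ^ 'n \<Rightarrow> 'a) set) \<Rightarrow> ennreal" where
  "distortion T L P X Y =
     (\<integral>\<^sup>+\<omega>. (\<integral>\<^sup>+u. ennreal (dist (T u (X \<omega>)) (L1_rep (Y \<omega>) u)) \<partial>cube_measure L)
            / ennreal (L ^ CARD('n)) \<partial>P)"

text \<open>The infimum runs over probability spaces \<open>P\<close> whose underlying type is the product of the
  target types of \<open>X\<close> and \<open>Y\<close>. This is no restriction: the distortion and the mutual information
  depend only on the joint law of \<open>(X, Y)\<close>, and every joint law is realised on this product.\<close>

definition rate_distortion_on ::
    "(real ^ 'n \<Rightarrow> 'a::compact_metric_space \<Rightarrow> 'a) \<Rightarrow> real \<Rightarrow> 'a measure \<Rightarrow> real \<Rightarrow> ennreal" where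
  "rate_distortion_on T L \<mu> \<epsilon> =
     Inf {mutual_info P borel (L1_borel L) X Y |
            (P :: ('a \<times> (real ^ 'n \<Rightarrow> 'a) set) measure) X Y.
            prob_space P \<and> X \<in> P \<rightarrow>\<^sub>M borel \<and> distr P borel X = \<mu> \<and>
            Y \<in> P \<rightarrow>\<^sub>M L1_borel L \<and> distortion T L P X Y < ennreal \<epsilon>}"

definition rate_distortion ::
    "(real ^ 'n \<Rightarrow> 'a::compact_metric_space \<Rightarrow> 'a) \<Rightarrow> 'a measure \<Rightarrow> real \<Rightarrow> ennreal" where
  "rate_distortion T \<mu> \<epsilon> =
     Lim at_top (\<lambda>L. rate_distortion_on T L \<mu> \<epsilon> / ennreal (L ^ CARD('n)))"

definition lower_rdim ::
    "(real ^ 'n \<Rightarrow> 'a::compact_metric_space \<Rightarrow> 'a) \<Rightarrow> 'a measure \<Rightarrow> ennreal" where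
  "lower_rdim T \<mu> =
     Liminf (at_right 0) (\<lambda>\<epsilon>. rate_distortion T \<mu> \<epsilon> / ennreal (log 2 (1 / \<epsilon>)))"

end

theory Submission
  imports Defs "HOL-Real_Asymp.Real_Asymp"
begin

text \<open>
  A coupling of \<open>X\<close> with a random map \<open>Y\<close> can be replaced by a channel with finitely many outputs: the
  functions \<open>x \<mapsto>\<close> (average distortion between the orbit of \<open>x\<close> and \<open>y\<close>), for \<open>y\<close> in the space of maps,
  are bounded and equicontinuous, so that finitely many \<open>y\<close> suffice up to a small error. For a fixed
  finite channel \<open>p\<close> the mutual information is
  \<open>H(\<integral> p d\<mu>) - \<integral> H(p(x)) d\<mu>(x)\<close>, which is concave in the input law \<open>\<mu>\<close>, whereas the distortion is affine.
  Let a channel have distortion below \<open>\<epsilon>\<close> and almost optimal information for \<open>\<mu> = \<integral> \<nu> d\<lambda>(\<nu>)\<close>. By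
  concavity its mean information over \<open>\<nu>\<close> is at most that of \<open>\<mu>\<close>, and by Markov's inequality its
  distortion for \<open>\<nu>\<close> is below \<open>2^n \<epsilon>\<close> outside a \<open>\<lambda>\<close>-set of measure \<open>2^-n\<close>. Choosing \<open>\<epsilon> = \<epsilon>_n\<close> so small
  that \<open>log (1 / (2^n \<epsilon>_n))\<close> and \<open>log (1 / \<epsilon>_n)\<close> are comparable, the claim follows from the Borel-Cantelli
  lemma and Fatou's lemma. The limit defining the rate distortion function exists and equals the
  infimum, because the product of channels over the tiles of a large cube adds up their informations.
\<close>

section \<open>Entropy and the log-sum inequality\<close>

text \<open>The proof transfers one coding scheme from \<mu> to all components at once. A coupling
  is tied to its marginal \<mu>, whereas its conditional law, normalised at every point, makes sense
  for every input law; this is why channels replace couplings. A channel still lives on a cube of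
  one size \<open>L\<close>. Because the rate is an infimum over \<open>L\<close> and not only a
  limit, this one \<open>L\<close> bounds the rate of every component, and no uniformity of the
  limit in \<nu> is needed.

  Measurability shapes the rest. Neither the rate nor the lower dimension is known to be measurable
  in \<nu>. The integral of such an integrand is a supremum over simple functions below it: it can
  be compared with a measurable majorant, but Fatou's lemma does not apply to it. The channel
  supplies the majorant, since its information is an explicit measurable function of \<nu>.

  A fixed factor in Markov's inequality would leave an exceptional set of fixed size; a growing one
  is affordable because it enters only through its logarithm.\<close>

definition ent :: "real \<Rightarrow> real" where
  "ent t = - t * log 2 t"

lemma ent_0 [simp]: "ent 0 = 0" and ent_1 [simp]: "ent 1 = 0"
  by (simp_all add: ent_def)

lemma borel_measurable_ent [measurable]: "ent \<in> borel_measurable borel"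
  unfolding ent_def by measurable

lemma continuous_on_ent: "continuous_on {0..1} ent"
proof (rule continuous_on_eq_continuous_within[THEN iffD2], safe)
  fix t :: real assume t: "t \<in> {0..1}"
  show "continuous (at t within {0..1}) ent"
  proof (cases "t = 0")
    case True
    have "(ent \<longlongrightarrow> 0) (at_right 0)"
      unfolding ent_def by real_asymp
    then have "(ent \<longlongrightarrow> 0) (at 0 within {0..1})"
      by (simp add: at_within_Icc_at_right)
    then show ?thesis by (simp add: True continuous_within)
  next
    case False
    then have "isCont (\<lambda>t. - t * log 2 t) t"
      using t by (intro continuous_intros) auto
    then show ?thesis
      unfolding ent_def by (rule continuous_at_imp_continuous_at_within)
  qed
qed

lemma ent_bounded: "\<exists>B. \<forall>t\<in>{0..1}. \<bar>ent t\<bar> \<le> B"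
proof -
  have "bounded (ent ` {0..1})"
    by (intro compact_imp_bounded compact_continuous_image continuous_on_ent compact_Icc)
  then show ?thesis by (auto simp: bounded_iff)
qed

lemma (in finite_measure) integrable_ent:
  assumes [measurable]: "f \<in> borel_measurable M" and "\<And>x. 0 \<le> f x" "\<And>x. f x \<le> 1"
  shows "integrable M (\<lambda>x. ent (f x))"
proof -
  obtain B where "\<forall>t\<in>{0..1}. \<bar>ent t\<bar> \<le> B" using ent_bounded by blast
  then show ?thesis
    using assms by (intro integrable_const_bound[where B=B]) auto
qed

lemma (in finite_measure) integrable_unit:
  assumes [measurable]: "f \<in> borel_measurable M" and "\<And>x. 0 \<le> f x" "\<And>x. f x \<le> (1::real)"
  shows "integrable M f"
  using assms by (intro integrable_const_bound[where B=1]) auto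

text \<open>With \<open>a / 0 = 0\<close> and \<open>log 2 0 = 0\<close> the integrand of a relative
  entropy vanishes where \<open>q = 0\<close>. Elsewhere it is a combination of \<open>ent a\<close>
  and \<open>a\<close>, so for values in [0, 1] its integrability reduces to that of two bounded
  functions.\<close>

lemma mult_log_divide:
  assumes "0 \<le> a" "0 \<le> q"
  shows "a * log 2 (a / q) = (if q = 0 then 0 else - ent a - a * log 2 q)"
  using assms by (cases "a = 0") (auto simp: ent_def log_divide algebra_simps)

text \<open>The right-hand side is \<open>t ln t\<close> at \<open>t = a / q\<close>, scaled; the left-hand side is its tangent at \<open>t = c\<close>.\<close>

lemma log_tangent:
  assumes "0 \<le> a" "0 < q" "0 < c"
  shows "a * log 2 c + (a - c * q) / ln 2 \<le> a * log 2 (a / q)"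
proof (cases "a = 0")
  case True
  then show ?thesis using assms by (simp add: divide_nonneg_pos)
next
  case False
  then have a: "0 < a" using assms by simp
  have "ln (c * q / a) \<le> c * q / a - 1"
    using assms a by (intro ln_le_minus_one) simp
  then have "a * ln (c * q / a) \<le> c * q - a"
    using a by (simp add: field_simps)
  moreover have "ln (c * q / a) = ln c - ln (a / q)"
    using assms a by (simp add: ln_mult ln_div)
  ultimately have "a * ln c + (a - c * q) \<le> a * ln (a / q)"
    by (simp add: algebra_simps)
  then have "(a * ln c + (a - c * q)) / ln 2 \<le> a * ln (a / q) / ln 2"
    by (intro divide_right_mono) auto
  then show ?thesis by (simp add: log_def add_divide_distrib)
qed

text \<open>Convexity of t log t, aggregated over an integral and a finite sum at once. This is the
  shape of a block formed by a set of inputs and a group of outputs, as needed for data processing.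
  A single index with \<open>q = 1\<close> gives Jensen's inequality.\<close>

lemma (in finite_measure) log_sum_inequality:
  assumes fin: "finite S"
    and f [measurable]: "\<And>i. i \<in> S \<Longrightarrow> f i \<in> borel_measurable M"
    and f0: "\<And>i x. i \<in> S \<Longrightarrow> 0 \<le> f i x" and f1: "\<And>i x. i \<in> S \<Longrightarrow> f i x \<le> 1"
    and q: "\<And>i. i \<in> S \<Longrightarrow> 0 \<le> q i"
    and ac: "\<And>i. i \<in> S \<Longrightarrow> q i = 0 \<Longrightarrow> (\<integral>x. f i x \<partial>M) = 0"
  defines "m \<equiv> (\<Sum>i\<in>S. \<integral>x. f i x \<partial>M)"
  shows "m * log 2 (m / (measure M (space M) * (\<Sum>i\<in>S. q i)))
           \<le> (\<Sum>i\<in>S. \<integral>x. f i x * log 2 (f i x / q i) \<partial>M)"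
proof -
  define S' where "S' = {i\<in>S. 0 < q i}"
  have S': "finite S'" "S' \<subseteq> S" using fin by (auto simp: S'_def)
  have intf: "integrable M (f i)" if "i \<in> S" for i
    using f f0 f1 that by (intro integrable_unit) auto
  have inte: "integrable M (\<lambda>x. ent (f i x))" if "i \<in> S" for i
    using f f0 f1 that by (intro integrable_ent) auto
  have m: "m = (\<Sum>i\<in>S'. \<integral>x. f i x \<partial>M)"
    unfolding m_def using fin q ac by (intro sum.mono_neutral_right) (force simp: S'_def)+
  have Q: "(\<Sum>i\<in>S. q i) = (\<Sum>i\<in>S'. q i)"
    using fin q by (intro sum.mono_neutral_right) (force simp: S'_def)+
  have zero: "f i x * log 2 (f i x / q i) = 0" if "i \<in> S - S'" for i x
    using that q[of i] by (auto simp: S'_def log_def)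
  have R: "(\<Sum>i\<in>S. \<integral>x. f i x * log 2 (f i x / q i) \<partial>M)
      = (\<Sum>i\<in>S'. \<integral>x. f i x * log 2 (f i x / q i) \<partial>M)"
    using fin S'(2) by (intro sum.mono_neutral_right) (simp_all add: zero)
  have int_r: "integrable M (\<lambda>x. f i x * log 2 (f i x / q i))" if "i \<in> S" for i
    using that f0 q intf inte by (cases "q i = 0") (simp_all add: mult_log_divide)
  have m0: "0 \<le> m"
    unfolding m_def by (intro sum_nonneg integral_nonneg_AE AE_I2 f0)
  show ?thesis
  proof (cases "m = 0")
    case True
    have "(\<integral>x. f i x * log 2 (f i x / q i) \<partial>M) = 0" if i: "i \<in> S'" for i
    proof -
      have "(\<integral>x. f i x \<partial>M) = 0"
        using True i f0 S' by (subst (asm) m, subst (asm) sum_nonneg_eq_0_iff)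
          (auto intro!: integral_nonneg_AE)
      then have "AE x in M. f i x = 0"
        using i S' f0 intf by (subst (asm) integral_nonneg_eq_0_iff_AE) auto
      then have "AE x in M. f i x * log 2 (f i x / q i) = 0" by auto
      then show ?thesis by (rule integral_eq_zero_AE)
    qed
    then show ?thesis using True by (simp add: R)
  next
    case False
    then have mpos: "0 < m" using m0 by simp
    define V where "V = measure M (space M)"
    have "S' \<noteq> {}" using False m by auto
    then have Qpos: "0 < (\<Sum>i\<in>S'. q i)"
      using S' by (intro sum_pos) (auto simp: S'_def)
    have "V \<noteq> 0"
    proof
      assume "V = 0"
      then have "AE x in M. False"
        by (intro AE_I[where N="space M"]) (auto simp: V_def emeasure_eq_measure)
      then have "(\<integral>x. f i x \<partial>M) = 0" for i by (intro integral_eq_zero_AE) auto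
      then show False using False by (simp add: m_def)
    qed
    then have V: "0 < V" by (simp add: V_def zero_less_measure_iff)
    \<comment> \<open>The aggregated ratio. Tangency at this point makes the linear corrections
      cancel, since \<open>V * c\<close> times the sum of the \<open>q i\<close> is
      \<open>m\<close>. The tangent inequality needs \<open>c\<close> positive, so
      \<open>m = 0\<close> is treated apart.\<close>
    define c where "c = m / (V * (\<Sum>i\<in>S'. q i))"
    have c: "0 < c" using mpos Qpos V by (simp add: c_def)
    have "(\<Sum>i\<in>S'. \<integral>x. f i x * log 2 c + (f i x - c * q i) / ln 2 \<partial>M)
        \<le> (\<Sum>i\<in>S'. \<integral>x. f i x * log 2 (f i x / q i) \<partial>M)"
      using S' c f0 intf int_r
      by (intro sum_mono integral_mono log_tangent) (auto simp: S'_def)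
    also have "(\<Sum>i\<in>S'. \<integral>x. f i x * log 2 c + (f i x - c * q i) / ln 2 \<partial>M)
        = (\<Sum>i\<in>S'. (\<integral>x. f i x \<partial>M) * log 2 c + ((\<integral>x. f i x \<partial>M) - V * (c * q i)) / ln 2)"
      using S' intf by (intro sum.cong refl) (auto simp: V_def Bochner_Integration.integral_add)
    also have "\<dots> = m * log 2 c + (m - V * c * (\<Sum>i\<in>S'. q i)) / ln 2"
      by (simp add: m sum.distrib sum_subtractf sum_divide_distrib[symmetric] sum_distrib_left
          sum_distrib_right mult.assoc)
    also have "V * c * (\<Sum>i\<in>S'. q i) = m" using V Qpos by (simp add: c_def)
    finally show ?thesis by (simp add: R Q c_def V_def)
  qed
qed

lemma (in prob_space) jensen_ent:
  assumes [measurable]: "f \<in> borel_measurable M" and f: "\<And>x. 0 \<le> f x" "\<And>x. f x \<le> 1"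
  shows "(\<integral>x. ent (f x) \<partial>M) \<le> ent (\<integral>x. f x \<partial>M)"
  using log_sum_inequality[of "{()}" "\<lambda>_. f" "\<lambda>_. 1"] f
  by (simp add: prob_space ent_def)

text \<open>Nonnegativity of relative entropy: the tangent inequality at \<open>c = 1\<close>, whose
  linear terms cancel because both families have total one.\<close>

lemma gibbs_inequality:
  assumes fin: "finite S" and a: "\<And>i. i \<in> S \<Longrightarrow> 0 \<le> a i" and r: "\<And>i. i \<in> S \<Longrightarrow> 0 \<le> r i"
    and ac: "\<And>i. i \<in> S \<Longrightarrow> r i = 0 \<Longrightarrow> a i = 0" and sa: "sum a S = 1" and sr: "sum r S = 1"
  shows "(\<Sum>i\<in>S. ent (a i)) \<le> (\<Sum>i\<in>S. - a i * log 2 (r i))"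
proof -
  have "(\<Sum>i\<in>S. (a i - r i) / ln 2) \<le> (\<Sum>i\<in>S. a i * log 2 (r i) * -1 - ent (a i))"
  proof (rule sum_mono)
    fix i assume i: "i \<in> S"
    show "(a i - r i) / ln 2 \<le> a i * log 2 (r i) * -1 - ent (a i)"
    proof (cases "r i = 0")
      case True then show ?thesis using ac[OF i] by simp
    next
      case False
      then show ?thesis
        using log_tangent[of "a i" "r i" 1] mult_log_divide[of "a i" "r i"] a[OF i] r[OF i] by simp
    qed
  qed
  also have "(\<Sum>i\<in>S. (a i - r i) / ln 2) = 0"
    by (simp add: sum_divide_distrib[symmetric] sum_subtractf sa sr)
  finally show ?thesis by (simp add: sum_subtractf sum_negf)
qed

section \<open>Finite mutual information\<close>

lemma cell_eq:
  assumes "partition_on S \<alpha>" "A \<in> \<alpha>" "x \<in> A"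
  shows "cell \<alpha> x = A"
  unfolding cell_def
proof (rule the_equality)
  fix A' assume "A' \<in> \<alpha> \<and> x \<in> A'"
  then show "A' = A"
    using disjointD[OF partition_onD2[OF assms(1)] assms(2), of A'] assms(3) by blast
qed (use assms in simp)

lemma cell_in:
  assumes "partition_on S \<alpha>" "x \<in> S"
  shows "cell \<alpha> x \<in> \<alpha>" "x \<in> cell \<alpha> x"
proof -
  obtain A where "A \<in> \<alpha>" "x \<in> A" using assms partition_onD1[OF assms(1)] by blast
  then show "cell \<alpha> x \<in> \<alpha>" "x \<in> cell \<alpha> x" using cell_eq[OF assms(1)] by auto
qed

text \<open>\<open>shannon_entropy\<close> sums over the attained values only. Since
  \<open>ent 0 = 0\<close>, other values may be added, so that the sum can run over all cells of a
  partition.\<close>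

lemma (in prob_space) shannon_entropy_finite_range:
  assumes Z: "Z \<in> measurable M (count_space R)" and R: "finite R"
  shows "shannon_entropy M Z = (\<Sum>r\<in>R. ent (measure M (Z -` {r} \<inter> space M)))"
proof -
  interpret information_space M 2 by unfold_locales simp
  have ZR: "Z ` space M \<subseteq> R" using measurable_space[OF Z] by force
  have sZ: "simple_function M Z"
    unfolding simple_function_def using ZR finite_subset[OF ZR R]
    by (auto intro!: measurable_sets[OF Z])
  have "shannon_entropy M Z = (\<Sum>r\<in>Z ` space M. ent (measure M (Z -` {r} \<inter> space M)))"
    unfolding shannon_entropy_def
    by (subst entropy_simple_distributed[OF simple_distributedI[OF sZ measure_nonneg refl]])
      (simp add: ent_def sum_negf)
  also have "\<dots> = (\<Sum>r\<in>R. ent (measure M (Z -` {r} \<inter> space M)))"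
  proof (rule sum.mono_neutral_left[OF R ZR], safe)
    fix r assume "r \<notin> Z ` space M"
    then have "Z -` {r} \<inter> space M = {}" by auto
    then show "ent (measure M (Z -` {r} \<inter> space M)) = 0" by simp
  qed
  finally show ?thesis .
qed

lemma cell_vimage:
  assumes "finite_measurable_partition S \<alpha>" "X \<in> measurable M S" "A \<in> \<alpha>"
  shows "(cell \<alpha> \<circ> X) -` {A} \<inter> space M = X -` A \<inter> space M"
proof -
  have p: "partition_on (space S) \<alpha>"
    using assms by (simp add: finite_measurable_partition_def)
  have "cell \<alpha> (X \<omega>) = A \<longleftrightarrow> X \<omega> \<in> A" if "\<omega> \<in> space M" for \<omega>
    using cell_eq[OF p assms(3)] cell_in(2)[OF p measurable_space[OF assms(2) that]] by metis
  then show ?thesis by (intro set_eqI) (simp add: conj_commute cong: conj_cong)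
qed

lemma cell_measurable:
  assumes "finite_measurable_partition S \<alpha>" "X \<in> measurable M S"
  shows "cell \<alpha> \<circ> X \<in> measurable M (count_space \<alpha>)"
proof -
  have p: "partition_on (space S) \<alpha>" "finite \<alpha>" "\<alpha> \<subseteq> sets S"
    using assms by (simp_all add: finite_measurable_partition_def)
  have "cell \<alpha> \<circ> X \<in> space M \<rightarrow> \<alpha>"
    using cell_in(1)[OF p(1)] measurable_space[OF assms(2)] by simp
  moreover have "(cell \<alpha> \<circ> X) -` {A} \<inter> space M \<in> sets M" if "A \<in> \<alpha>" for A
    unfolding cell_vimage[OF assms that]
    using p that by (intro measurable_sets[OF assms(2)]) blast
  ultimately show ?thesis
    unfolding measurable_count_space_eq2[OF p(2)] by blast
qed

lemma (in prob_space) finite_mutual_information_cells: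
  assumes \<alpha>: "finite_measurable_partition S \<alpha>" and X: "X \<in> measurable M S"
    and \<beta>: "finite_measurable_partition S' \<beta>" and Y: "Y \<in> measurable M S'"
  shows "finite_mutual_information M (cell \<alpha> \<circ> X) (cell \<beta> \<circ> Y) =
    (\<Sum>A\<in>\<alpha>. ent (measure M (X -` A \<inter> space M))) + (\<Sum>B\<in>\<beta>. ent (measure M (Y -` B \<inter> space M)))
     - (\<Sum>A\<in>\<alpha>. \<Sum>B\<in>\<beta>. ent (measure M ((X -` A \<inter> space M) \<inter> (Y -` B \<inter> space M))))"
proof -
  have fin: "finite \<alpha>" "finite \<beta>" using \<alpha> \<beta> by (auto simp: finite_measurable_partition_def)
  have XY: "(\<lambda>\<omega>. ((cell \<alpha> \<circ> X) \<omega>, (cell \<beta> \<circ> Y) \<omega>)) \<in> measurable M (count_space (\<alpha> \<times> \<beta>))"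
    using measurable_Pair[OF cell_measurable[OF \<alpha> X] cell_measurable[OF \<beta> Y]]
    by (simp add: pair_measure_count_space fin)
  have vi: "(\<lambda>\<omega>. ((cell \<alpha> \<circ> X) \<omega>, (cell \<beta> \<circ> Y) \<omega>)) -` {(A, B)} \<inter> space M
      = (X -` A \<inter> space M) \<inter> (Y -` B \<inter> space M)" if "A \<in> \<alpha>" "B \<in> \<beta>" for A B
    unfolding cell_vimage[OF \<alpha> X that(1), symmetric] cell_vimage[OF \<beta> Y that(2), symmetric] by blast
  have "shannon_entropy M (\<lambda>\<omega>. ((cell \<alpha> \<circ> X) \<omega>, (cell \<beta> \<circ> Y) \<omega>))
      = (\<Sum>(A, B)\<in>\<alpha> \<times> \<beta>. ent (measure M ((X -` A \<inter> space M) \<inter> (Y -` B \<inter> space M))))"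
    unfolding shannon_entropy_finite_range[OF XY finite_cartesian_product[OF fin]]
  proof (rule sum.cong[OF refl])
    fix z assume "z \<in> \<alpha> \<times> \<beta>"
    then obtain A B where "z = (A, B)" "A \<in> \<alpha>" "B \<in> \<beta>" by blast
    then show "ent (prob ((\<lambda>\<omega>. ((cell \<alpha> \<circ> X) \<omega>, (cell \<beta> \<circ> Y) \<omega>)) -` {z} \<inter> space M)) =
        (case z of (A, B) \<Rightarrow> ent (prob ((X -` A \<inter> space M) \<inter> (Y -` B \<inter> space M))))"
      by (simp only: vi prod.case)
  qed
  moreover have "shannon_entropy M (cell \<alpha> \<circ> X) = (\<Sum>A\<in>\<alpha>. ent (measure M (X -` A \<inter> space M)))"
    unfolding shannon_entropy_finite_range[OF cell_measurable[OF \<alpha> X] fin(1)]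
    by (rule sum.cong[OF refl]) (simp only: cell_vimage[OF \<alpha> X])
  moreover have "shannon_entropy M (cell \<beta> \<circ> Y) = (\<Sum>B\<in>\<beta>. ent (measure M (Y -` B \<inter> space M)))"
    unfolding shannon_entropy_finite_range[OF cell_measurable[OF \<beta> Y] fin(2)]
    by (rule sum.cong[OF refl]) (simp only: cell_vimage[OF \<beta> Y])
  ultimately show ?thesis
    unfolding finite_mutual_information_def by (simp add: sum.cartesian_product)
qed

lemma (in finite_measure) sum_measure_partition:
  assumes \<beta>: "finite_measurable_partition S' \<beta>" and Y: "Y \<in> measurable M S'" and E: "E \<in> sets M"
  shows "(\<Sum>B\<in>\<beta>. measure M (E \<inter> (Y -` B \<inter> space M))) = measure M E"
proof -
  have p: "partition_on (space S') \<beta>" "finite \<beta>" "\<beta> \<subseteq> sets S'"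
    using \<beta> by (auto simp: finite_measurable_partition_def)
  have "(\<Sum>B\<in>\<beta>. measure M (E \<inter> (Y -` B \<inter> space M))) = measure M (\<Union>B\<in>\<beta>. E \<inter> (Y -` B \<inter> space M))"
  proof (rule finite_measure_finite_Union[symmetric])
    show "(\<lambda>B. E \<inter> (Y -` B \<inter> space M)) ` \<beta> \<subseteq> sets M"
      using E p by (auto intro!: sets.Int measurable_sets[OF Y])
    show "disjoint_family_on (\<lambda>B. E \<inter> (Y -` B \<inter> space M)) \<beta>"
      using disjointD[OF partition_onD2[OF p(1)]] by (fastforce simp: disjoint_family_on_def)
  qed (rule p)
  also have "(\<Union>B\<in>\<beta>. E \<inter> (Y -` B \<inter> space M)) = E"
  proof -
    have "\<omega> \<in> space M \<and> Y \<omega> \<in> \<Union>\<beta>" if "\<omega> \<in> E" for \<omega>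
      using that sets.sets_into_space[OF E] measurable_space[OF Y] partition_onD1[OF p(1)] by auto
    then show ?thesis by auto
  qed
  finally show ?thesis .
qed

section \<open>The space of maps on a cube\<close>

lemma ex_diameter_bound: "\<exists>D>0. \<forall>x y::'a::compact_metric_space. dist x y \<le> D"
proof -
  obtain e x where e: "\<And>y::'a. dist x y \<le> e"
    using compact_imp_bounded[OF compact_UNIV[where 'a='a]] by (auto simp: bounded_def)
  have "dist y z \<le> 2 * e + 1" for y z :: 'a
    using e[of y] e[of z] dist_triangle[of y z x] by (simp add: dist_commute)
  moreover have "0 < 2 * e + 1" using e[of x] by simp
  ultimately show ?thesis by blast
qed

lemma cube_sandwich: "box 0 (\<chi> i. L) \<subseteq> cube L" "cube L \<subseteq> cbox 0 (\<chi> i. L)"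
  by (auto simp: cube_def mem_box_cart less_imp_le)

lemma sets_cube [measurable]: "cube L \<in> sets borel"
proof -
  have "cube L = (\<Inter>i. {u. 0 \<le> u $ i} \<inter> {u. u $ i < L})" by (auto simp: cube_def)
  also have "\<dots> \<in> sets borel"
    by (intro sets.countable_INT'' sets.Int borel_closed borel_open
        closed_halfspace_component_ge_cart open_halfspace_component_lt_cart) simp_all
  finally show ?thesis .
qed

text \<open>The half-open cube lies between an open and a closed box of equal volume.\<close>

lemma emeasure_cube:
  assumes "0 \<le> L"
  shows "emeasure lborel (cube L :: (real ^ 'n) set) = ennreal (L ^ CARD('n))"
proof -
  have prod: "(\<Prod>b\<in>Basis. ((\<chi> i. L) - 0 :: real ^ 'n) \<bullet> b) = L ^ CARD('n)"
    by (auto simp: Basis_vec_def inner_axis' prod.UNION_disjoint axis_eq_axis card_image inj_on_def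
        cart_eq_inner_axis[symmetric] image_Union[symmetric] simp del: UN_simps intro!: prod.cong)
  have le: "\<And>b. b \<in> Basis \<Longrightarrow> (0 :: real ^ 'n) \<bullet> b \<le> (\<chi> i. L) \<bullet> b"
    using assms by (auto simp: Basis_vec_def inner_axis)
  have "emeasure lborel (box 0 (\<chi> i. L) :: (real ^ 'n) set) \<le> emeasure lborel (cube L :: (real ^ 'n) set)"
    by (intro emeasure_mono cube_sandwich) simp
  moreover have "emeasure lborel (cube L :: (real ^ 'n) set) \<le> emeasure lborel (cbox 0 (\<chi> i. L) :: (real ^ 'n) set)"
    by (intro emeasure_mono cube_sandwich) simp
  ultimately show ?thesis
    using le by (intro antisym) (simp_all add: emeasure_lborel_box emeasure_lborel_cbox prod[simplified])
qed

lemma space_cube_measure [simp]: "space (cube_measure L) = cube L"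
  by (simp add: cube_measure_def space_restrict_space)

lemma emeasure_cube_measure:
  assumes "0 \<le> L"
  shows "emeasure (cube_measure L :: (real ^ 'n) measure) (cube L) = ennreal (L ^ CARD('n))"
  by (simp add: cube_measure_def emeasure_restrict_space emeasure_cube assms)

lemma finite_measure_cube: "finite_measure (cube_measure L)"
proof
  have "emeasure lborel (cube L :: (real ^ 'a) set) \<le> emeasure lborel (cbox 0 (\<chi> i. L) :: (real ^ 'a) set)"
    by (intro emeasure_mono cube_sandwich) simp
  also have "\<dots> < \<infinity>" by (simp add: emeasure_lborel_cbox_eq)
  finally show "emeasure (cube_measure L :: (real ^ 'a) measure) (space (cube_measure L)) \<noteq> \<infinity>"
    by (simp add: cube_measure_def space_restrict_space emeasure_restrict_space)
qed

lemma measurable_cube_measureI: "f \<in> borel_measurable borel \<Longrightarrow> f \<in> cube_measure L \<rightarrow>\<^sub>M borel"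
  by (simp add: cube_measure_def measurable_restrict_space1)

section \<open>The quotient space of maps and its metric\<close>

definition L1_class :: "real \<Rightarrow> (real ^ 'n \<Rightarrow> 'a::compact_metric_space) \<Rightarrow> (real ^ 'n \<Rightarrow> 'a) set" where
  "L1_class L f = L1_rel L `` {f}"

lemma equiv_L1_rel:
  "equiv (cube_measure L \<rightarrow>\<^sub>M borel) (L1_rel L :: ((real ^ 'n \<Rightarrow> 'a::compact_metric_space) \<times> _) set)"
  (is "equiv _ ?r")
proof (rule equivI)
  show "?r \<subseteq> (cube_measure L \<rightarrow>\<^sub>M borel) \<times> (cube_measure L \<rightarrow>\<^sub>M borel)"
    by (auto simp: L1_rel_def)
  show "refl_on (cube_measure L \<rightarrow>\<^sub>M borel) ?r" by (auto simp: refl_on_def L1_rel_def)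
  show "sym ?r" by (auto simp: sym_def L1_rel_def elim: AE_mp)
  show "trans ?r"
  proof (rule transI)
    fix f g h :: "real ^ 'n \<Rightarrow> 'a"
    assume "(f, g) \<in> L1_rel L" "(g, h) \<in> L1_rel L"
    then have fh: "f \<in> cube_measure L \<rightarrow>\<^sub>M borel" "h \<in> cube_measure L \<rightarrow>\<^sub>M borel"
      and "AE u in cube_measure L. f u = g u" "AE u in cube_measure L. g u = h u"
      by (auto simp: L1_rel_def)
    from this(3,4) have "AE u in cube_measure L. f u = h u" by eventually_elim simp
    with fh show "(f, h) \<in> L1_rel L" by (auto simp: L1_rel_def)
  qed
qed

lemma L1_class_in_space: "f \<in> cube_measure L \<rightarrow>\<^sub>M borel \<Longrightarrow> L1_class L f \<in> L1_space L"
  unfolding L1_class_def L1_space_def by (rule quotientI)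

lemma L1_rep_in: "y \<in> L1_space L \<Longrightarrow> L1_rep y \<in> y"
  unfolding L1_rep_def L1_space_def using in_quotient_imp_non_empty[OF equiv_L1_rel]
  by (metis someI_ex ex_in_conv)

lemma L1_rep_measurable: "y \<in> L1_space L \<Longrightarrow> L1_rep y \<in> cube_measure L \<rightarrow>\<^sub>M borel"
  using L1_rep_in in_quotient_imp_subset[OF equiv_L1_rel] unfolding L1_space_def by blast

lemma L1_rep_class:
  assumes "f \<in> cube_measure L \<rightarrow>\<^sub>M borel"
  shows "AE u in cube_measure L. L1_rep (L1_class L f) u = f u"
proof -
  have "(f, L1_rep (L1_class L f)) \<in> L1_rel L"
    using L1_rep_in[OF L1_class_in_space[OF assms]] by (simp add: L1_class_def)
  then show ?thesis by (auto simp: L1_rel_def elim: AE_mp)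
qed

lemma L1_space_eqI:
  assumes "y \<in> L1_space L" "z \<in> L1_space L" "AE u in cube_measure L. L1_rep y u = L1_rep z u"
  shows "y = z"
  using quotient_eqI[OF equiv_L1_rel] L1_rep_in[OF assms(1)] L1_rep_in[OF assms(2)] assms
    L1_rep_measurable[OF assms(1)] L1_rep_measurable[OF assms(2)]
  unfolding L1_space_def L1_rel_def by blast

lemma integrable_dist_cube:
  fixes f g :: "real ^ 'n \<Rightarrow> 'a::compact_metric_space"
  assumes "f \<in> cube_measure L \<rightarrow>\<^sub>M borel" "g \<in> cube_measure L \<rightarrow>\<^sub>M borel"
  shows "integrable (cube_measure L) (\<lambda>u. dist (f u) (g u))"
proof -
  obtain D where "\<forall>x y::'a. dist x y \<le> D" using ex_diameter_bound by blast
  then show ?thesis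
    using assms by (intro finite_measure.integrable_const_bound[OF finite_measure_cube, of _ D])
      (auto intro!: borel_measurable_dist)
qed

lemma Metric_space_L1:
  "Metric_space (L1_space L) (L1_dist L :: (real ^ 'n \<Rightarrow> 'a::compact_metric_space) set \<Rightarrow> _)"
proof
  fix x y z :: "(real ^ 'n \<Rightarrow> 'a) set"
  show "0 \<le> L1_dist L x y" by (simp add: L1_dist_def)
  show "L1_dist L x y = L1_dist L y x" by (simp add: L1_dist_def dist_commute)
  assume x: "x \<in> L1_space L" and y: "y \<in> L1_space L"
  show "L1_dist L x y = 0 \<longleftrightarrow> x = y"
  proof
    assume "L1_dist L x y = 0"
    then have "AE u in cube_measure L. dist (L1_rep x u) (L1_rep y u) = 0"
      unfolding L1_dist_def
      using x y by (subst (asm) integral_nonneg_eq_0_iff_AE) (auto intro!: integrable_dist_cube L1_rep_measurable)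
    then show "x = y" using x y by (intro L1_space_eqI) auto
  qed (simp add: L1_dist_def)
  assume z: "z \<in> L1_space L"
  have "L1_dist L x z \<le> (\<integral>u. dist (L1_rep x u) (L1_rep y u) + dist (L1_rep y u) (L1_rep z u) \<partial>cube_measure L)"
    unfolding L1_dist_def
    using x y z by (intro integral_mono Bochner_Integration.integrable_add integrable_dist_cube L1_rep_measurable)
      (auto intro: dist_triangle)
  also have "\<dots> = L1_dist L x y + L1_dist L y z"
    unfolding L1_dist_def
    using x y z by (intro Bochner_Integration.integral_add integrable_dist_cube L1_rep_measurable)
  finally show "L1_dist L x z \<le> L1_dist L x y + L1_dist L y z" .
qed

lemma
  shows space_L1_borel: "space (L1_borel L) = L1_space L"
    and sets_L1_borel_openin:
      "openin (Metric_space.mtopology (L1_space L) (L1_dist L)) U \<Longrightarrow> U \<in> sets (L1_borel L)"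
proof -
  interpret Metric_space "L1_space L" "L1_dist L" by (rule Metric_space_L1)
  have sub: "{U. openin mtopology U} \<subseteq> Pow (L1_space L)"
    using openin_subset by fastforce
  show "space (L1_borel L) = L1_space L"
    unfolding L1_borel_def by (rule space_measure_of[OF sub])
  show "openin mtopology U \<Longrightarrow> U \<in> sets (L1_borel L)"
    unfolding L1_borel_def by (simp add: sets_measure_of[OF sub] sigma_sets.Basic)
qed

lemma L1_dist_measurable:
  assumes "z \<in> L1_space L"
  shows "(\<lambda>y. L1_dist L z y) \<in> borel_measurable (L1_borel L)"
proof (rule borel_measurableI_less)
  interpret Metric_space "L1_space L" "L1_dist L" by (rule Metric_space_L1)
  fix r
  have "{y \<in> space (L1_borel L). L1_dist L z y < r} = mball z r"
    using assms by (auto simp: space_L1_borel)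
  then show "{y \<in> space (L1_borel L). L1_dist L z y < r} \<in> sets (L1_borel L)"
    by (simp add: sets_L1_borel_openin)
qed

section \<open>Averaged distance between an orbit and a map\<close>

lemma continuous_action_continuous:
  assumes "continuous_action T"
  shows "continuous_on UNIV (\<lambda>u. T u x)" "continuous_on UNIV (T u)"
proof -
  have c: "continuous_on UNIV (\<lambda>(u, x). T u x)" using assms by (simp add: continuous_action_def)
  have "continuous_on UNIV (\<lambda>u. (\<lambda>(u, x). T u x) (u, x))"
    by (rule continuous_on_compose2[OF c]) (auto intro!: continuous_intros)
  then show "continuous_on UNIV (\<lambda>u. T u x)" by simp
  have "continuous_on UNIV (\<lambda>x. (\<lambda>(u, x). T u x) (u, x))"
    by (rule continuous_on_compose2[OF c]) (auto intro!: continuous_intros)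
  then show "continuous_on UNIV (T u)" by simp
qed

lemma orbit_measurable: "continuous_action T \<Longrightarrow> (\<lambda>u. T u x) \<in> cube_measure L \<rightarrow>\<^sub>M borel"
  by (intro measurable_cube_measureI borel_measurable_continuous_onI continuous_action_continuous)

lemma action_measurable: "continuous_action T \<Longrightarrow> T u \<in> borel \<rightarrow>\<^sub>M borel"
  by (intro borel_measurable_continuous_onI continuous_action_continuous)

text \<open>Uniform continuity on the closed cube times the state space; the half-open
  \<open>cube L\<close> need not be compact, hence the passage to \<open>cbox\<close>.\<close>

lemma action_equicontinuous:
  fixes T :: "real ^ 'n \<Rightarrow> 'a::compact_metric_space \<Rightarrow> 'a"
  assumes "continuous_action T" "0 < \<delta>"
  obtains \<eta> where "0 < \<eta>" "\<And>x x' u. dist x x' < \<eta> \<Longrightarrow> u \<in> cube L \<Longrightarrow> dist (T u x) (T u x') \<le> \<delta>"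
proof -
  let ?K = "cbox 0 (\<chi> i. L) \<times> UNIV :: ((real ^ 'n) \<times> 'a) set"
  have "continuous_on ?K (\<lambda>(u, x). T u x)"
    using assms(1) by (auto simp: continuous_action_def intro: continuous_on_subset)
  moreover have "compact ?K" by (intro compact_Times compact_cbox compact_UNIV)
  ultimately have "uniformly_continuous_on ?K (\<lambda>(u, x). T u x)"
    by (rule compact_uniformly_continuous)
  then obtain \<eta> where \<eta>: "0 < \<eta>"
    and *: "\<And>p q. p \<in> ?K \<Longrightarrow> q \<in> ?K \<Longrightarrow> dist q p < \<eta> \<Longrightarrow>
       dist ((\<lambda>(u, x). T u x) q) ((\<lambda>(u, x). T u x) p) < \<delta>"
    using assms(2) unfolding uniformly_continuous_on_def by metis
  have "dist (T u x) (T u x') \<le> \<delta>" if "dist x x' < \<eta>" "u \<in> cube L" for x x' u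
    using *[of "(u, x')" "(u, x)"] that cube_sandwich(2)[of L]
    by (auto simp: dist_Pair_Pair intro: less_imp_le)
  then show thesis using \<eta> that by blast
qed

text \<open>The inner integral of \<open>distortion\<close> as a real number, for one point and one
  class of maps; see \<open>nn_integral_avg_dist\<close>.\<close>

definition avg_dist ::
    "(real ^ 'n \<Rightarrow> 'a::compact_metric_space \<Rightarrow> 'a) \<Rightarrow> real \<Rightarrow> 'a \<Rightarrow> (real ^ 'n \<Rightarrow> 'a) set \<Rightarrow> real" where
  "avg_dist T L x y = (\<integral>u. dist (T u x) (L1_rep y u) \<partial>cube_measure L) / L ^ CARD('n)"

lemma avg_dist_nonneg: "0 < L \<Longrightarrow> 0 \<le> avg_dist T L x y"
  by (simp add: avg_dist_def)

lemma nn_integral_avg_dist: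
  fixes T :: "real ^ 'n \<Rightarrow> 'a::compact_metric_space \<Rightarrow> 'a"
  assumes "continuous_action T" "0 < L" "y \<in> L1_space L"
  shows "(\<integral>\<^sup>+u. ennreal (dist (T u x) (L1_rep y u)) \<partial>cube_measure L) / ennreal (L ^ CARD('n))
    = ennreal (avg_dist T L x y)"
  using assms unfolding avg_dist_def
  by (subst nn_integral_eq_integral)
    (auto intro!: integrable_dist_cube orbit_measurable L1_rep_measurable simp: divide_ennreal)

lemma avg_dist_class:
  fixes T :: "real ^ 'n \<Rightarrow> 'a::compact_metric_space \<Rightarrow> 'a"
  assumes "continuous_action T" "f \<in> cube_measure L \<rightarrow>\<^sub>M borel"
  shows "avg_dist T L x (L1_class L f) = (\<integral>u. dist (T u x) (f u) \<partial>cube_measure L) / L ^ CARD('n)"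
proof -
  have "AE u in cube_measure L. dist (T u x) (L1_rep (L1_class L f) u) = dist (T u x) (f u)"
    using L1_rep_class[OF assms(2)] by eventually_elim simp
  then show ?thesis
    unfolding avg_dist_def using assms
    by (intro arg_cong2[where f="(/)"] integral_cong_AE refl)
      (auto intro!: borel_measurable_dist orbit_measurable L1_rep_measurable L1_class_in_space)
qed

text \<open>Up to a constant factor the averaged distance is the metric distance of \<open>y\<close>
  from a fixed point of the space of maps, the class of the orbit of \<open>x\<close>. This makes it
  Borel in \<open>y\<close>.\<close>

lemma avg_dist_eq_L1_dist:
  fixes T :: "real ^ 'n \<Rightarrow> 'a::compact_metric_space \<Rightarrow> 'a"
  assumes "continuous_action T" "y \<in> L1_space L"
  shows "avg_dist T L x y = L1_dist L (L1_class L (\<lambda>u. T u x)) y / L ^ CARD('n)"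
proof -
  have "AE u in cube_measure L. dist (T u x) (L1_rep y u) = dist (L1_rep (L1_class L (\<lambda>u. T u x)) u) (L1_rep y u)"
    using L1_rep_class[OF orbit_measurable[OF assms(1)], of L x] by eventually_elim simp
  then show ?thesis
    unfolding avg_dist_def L1_dist_def using assms
    by (intro arg_cong2[where f="(/)"] integral_cong_AE refl)
      (auto intro!: borel_measurable_dist orbit_measurable L1_rep_measurable L1_class_in_space)
qed

lemma avg_dist_measurable:
  fixes T :: "real ^ 'n \<Rightarrow> 'a::compact_metric_space \<Rightarrow> 'a"
  assumes "continuous_action T"
  shows "(\<lambda>y. avg_dist T L x y) \<in> borel_measurable (L1_borel L)"
proof -
  have "(\<lambda>y. L1_dist L (L1_class L (\<lambda>u. T u x)) y / L ^ CARD('n)) \<in> borel_measurable (L1_borel L)"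
    using assms by (intro borel_measurable_divide L1_dist_measurable L1_class_in_space orbit_measurable) auto
  then show ?thesis
    by (subst measurable_cong) (auto simp: space_L1_borel avg_dist_eq_L1_dist assms)
qed

lemma integral_le_cube:
  fixes f :: "real ^ 'n \<Rightarrow> real"
  assumes "integrable (cube_measure L) f" "\<And>u. u \<in> cube L \<Longrightarrow> f u \<le> D" "0 < L"
  shows "(\<integral>u. f u \<partial>cube_measure L) \<le> D * L ^ CARD('n)"
proof -
  interpret finite_measure "cube_measure L :: (real ^ 'n) measure" by (rule finite_measure_cube)
  have "(\<integral>u. f u \<partial>cube_measure L) \<le> (\<integral>u. D \<partial>(cube_measure L :: (real ^ 'n) measure))"
    using assms by (intro integral_mono) auto
  also have "\<dots> = D * L ^ CARD('n)"
    using assms(3) emeasure_cube_measure[of L, where 'n='n]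
    by (simp add: measure_def)
  finally show ?thesis .
qed

lemma avg_dist_le:
  fixes T :: "real ^ 'n \<Rightarrow> 'a::compact_metric_space \<Rightarrow> 'a"
  assumes "continuous_action T" "y \<in> L1_space L" "0 < L" "\<And>x y::'a. dist x y \<le> D"
  shows "avg_dist T L x y \<le> D"
  unfolding avg_dist_def
  using integral_le_cube[OF integrable_dist_cube[OF orbit_measurable[OF assms(1), of x] L1_rep_measurable[OF assms(2)]], of D] assms
  by (simp add: field_simps)

text \<open>The modulus \<eta> does not depend on \<open>y\<close>, since the change is at most the
  distance between the two orbits. This uniformity is what allows finitely many outputs.\<close>

lemma avg_dist_equicontinuous:
  fixes T :: "real ^ 'n \<Rightarrow> 'a::compact_metric_space \<Rightarrow> 'a"
  assumes "continuous_action T" "0 < \<delta>" "0 < L"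
  obtains \<eta> where "0 < \<eta>"
    "\<And>x x' y. dist x x' < \<eta> \<Longrightarrow> y \<in> L1_space L \<Longrightarrow> avg_dist T L x y \<le> avg_dist T L x' y + \<delta>"
proof -
  obtain \<eta> where \<eta>: "0 < \<eta>" "\<And>x x' u. dist x x' < \<eta> \<Longrightarrow> u \<in> cube L \<Longrightarrow> dist (T u x) (T u x') \<le> \<delta>"
    using action_equicontinuous[OF assms(1,2)] by metis
  have "avg_dist T L x y \<le> avg_dist T L x' y + \<delta>" if d: "dist x x' < \<eta>" and y: "y \<in> L1_space L" for x x' y
  proof -
    note I = integrable_dist_cube[OF orbit_measurable[OF assms(1)] L1_rep_measurable[OF y]]
    have "(\<integral>u. dist (T u x) (L1_rep y u) - dist (T u x') (L1_rep y u) \<partial>cube_measure L) \<le> \<delta> * L ^ CARD('n)"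
    proof (rule integral_le_cube)
      fix u :: "real ^ 'n" assume "u \<in> cube L"
      then show "dist (T u x) (L1_rep y u) - dist (T u x') (L1_rep y u) \<le> \<delta>"
        using \<eta>(2)[OF d, of u] dist_triangle[of "T u x" "L1_rep y u" "T u x'"] by simp
    qed (use I assms in auto)
    then have "(\<integral>u. dist (T u x) (L1_rep y u) \<partial>cube_measure L)
        \<le> (\<integral>u. dist (T u x') (L1_rep y u) \<partial>cube_measure L) + \<delta> * L ^ CARD('n)"
      using I by simp
    then show ?thesis
      using assms(3) by (simp add: avg_dist_def field_simps)
  qed
  then show thesis using \<eta> that by blast
qed

lemma avg_dist_continuous:
  fixes T :: "real ^ 'n \<Rightarrow> 'a::compact_metric_space \<Rightarrow> 'a"
  assumes "continuous_action T" "0 < L" "y \<in> L1_space L"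
  shows "continuous_on UNIV (\<lambda>x. avg_dist T L x y)"
proof (rule continuous_on_iff[THEN iffD2], intro ballI allI impI)
  fix x e assume "(0::real) < e"
  then obtain \<eta> where \<eta>: "0 < \<eta>"
    "\<And>x x' y. dist x x' < \<eta> \<Longrightarrow> y \<in> L1_space L \<Longrightarrow> avg_dist T L x y \<le> avg_dist T L x' y + e / 2"
    using avg_dist_equicontinuous[OF assms(1) _ assms(2), of "e / 2"] by (metis half_gt_zero)
  have "dist (avg_dist T L x' y) (avg_dist T L x y) < e" if "dist x' x < \<eta>" for x'
    using \<eta>(2)[of x x' y] \<eta>(2)[of x' x y] that assms(3) \<open>0 < e\<close>
    by (simp add: dist_real_def dist_commute abs_if)
  then show "\<exists>d>0. \<forall>x'\<in>UNIV. dist x' x < d \<longrightarrow> dist (avg_dist T L x' y) (avg_dist T L x y) < e"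
    using \<eta>(1) by blast
qed

lemma avg_dist_measurable_point:
  assumes "continuous_action T" "0 < L" "y \<in> L1_space L"
  shows "(\<lambda>x. avg_dist T L x y) \<in> borel_measurable borel"
  by (intro borel_measurable_continuous_onI avg_dist_continuous assms)

section \<open>Finite channels\<close>

text \<open>\<open>p i x\<close> is the probability of output \<open>i\<close> given input
  \<open>x\<close>. Normalisation is required at every point rather than almost everywhere, so that
  one channel can be used with any input law.\<close>

definition channel :: "'i set \<Rightarrow> ('i \<Rightarrow> 'a::topological_space \<Rightarrow> real) \<Rightarrow> bool" where
  "channel I p \<longleftrightarrow> finite I \<and> (\<forall>i\<in>I. p i \<in> borel_measurable borel \<and> (\<forall>x. 0 \<le> p i x)) \<and>
     (\<forall>x. (\<Sum>i\<in>I. p i x) = 1)"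

text \<open>The mutual information of input and output: the entropy of the output minus its
  conditional entropy given the input. In this form no density with respect to \<nu>
  appears.\<close>

definition channel_info :: "'a measure \<Rightarrow> 'i set \<Rightarrow> ('i \<Rightarrow> 'a \<Rightarrow> real) \<Rightarrow> real" where
  "channel_info \<nu> I p = (\<Sum>i\<in>I. ent (\<integral>x. p i x \<partial>\<nu>) - (\<integral>x. ent (p i x) \<partial>\<nu>))"

text \<open>The mean distortion given the input \<open>x\<close>, when output \<open>i\<close> is
  decoded as \<open>\<phi> i\<close>. Labels are kept apart from maps because several labels may be
  decoded alike.\<close>

definition channel_distortion ::
    "(real ^ 'n \<Rightarrow> 'a::compact_metric_space \<Rightarrow> 'a) \<Rightarrow> real \<Rightarrow> 'i set \<Rightarrow> ('i \<Rightarrow> (real ^ 'n \<Rightarrow> 'a) set)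
       \<Rightarrow> ('i \<Rightarrow> 'a \<Rightarrow> real) \<Rightarrow> 'a \<Rightarrow> real" where
  "channel_distortion T L I \<phi> p x = (\<Sum>i\<in>I. p i x * avg_dist T L x (\<phi> i))"

lemma
  assumes "channel I p"
  shows channel_finite: "finite I"
    and channel_measurable: "i \<in> I \<Longrightarrow> p i \<in> borel_measurable borel"
    and channel_nonneg: "i \<in> I \<Longrightarrow> 0 \<le> p i x"
    and channel_sum: "(\<Sum>i\<in>I. p i x) = 1"
    and channel_le_1: "i \<in> I \<Longrightarrow> p i x \<le> 1"
proof -
  show *: "finite I" "i \<in> I \<Longrightarrow> p i \<in> borel_measurable borel" "i \<in> I \<Longrightarrow> 0 \<le> p i x" "(\<Sum>i\<in>I. p i x) = 1"
    for i x using assms by (auto simp: channel_def)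
  show "p i x \<le> 1" if "i \<in> I"
    using member_le_sum[of i I "\<lambda>i. p i x"] * that by simp
qed

text \<open>The right-hand side is the relative entropy of a joint law with respect to the product
  of its marginals. Where an entry is nonzero, both marginals are positive and the logarithm splits;
  zero entries contribute nothing to either side.\<close>

lemma mutual_information_matrix:
  assumes fin: "finite \<alpha>" "finite \<beta>" and w: "\<And>A B. A \<in> \<alpha> \<Longrightarrow> B \<in> \<beta> \<Longrightarrow> 0 \<le> w A B"
    and a: "\<And>A. A \<in> \<alpha> \<Longrightarrow> a A = (\<Sum>B\<in>\<beta>. w A B)" and b: "\<And>B. B \<in> \<beta> \<Longrightarrow> b B = (\<Sum>A\<in>\<alpha>. w A B)"
  shows "(\<Sum>A\<in>\<alpha>. ent (a A)) + (\<Sum>B\<in>\<beta>. ent (b B)) - (\<Sum>A\<in>\<alpha>. \<Sum>B\<in>\<beta>. ent (w A B))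
    = (\<Sum>A\<in>\<alpha>. \<Sum>B\<in>\<beta>. w A B * log 2 (w A B / (a A * b B)))"
proof -
  have "w A B * log 2 (w A B / (a A * b B)) = - ent (w A B) - w A B * log 2 (a A) - w A B * log 2 (b B)"
    if "A \<in> \<alpha>" "B \<in> \<beta>" for A B
  proof (cases "w A B = 0")
    case False
    then have "0 < w A B" using w[OF that] by simp
    moreover have "w A B \<le> a A" "w A B \<le> b B"
      using that w fin by (auto simp: a b intro!: member_le_sum)
    ultimately show ?thesis
      by (simp add: ent_def log_divide log_mult algebra_simps)
  qed simp
  then have "(\<Sum>A\<in>\<alpha>. \<Sum>B\<in>\<beta>. w A B * log 2 (w A B / (a A * b B)))
    = (\<Sum>A\<in>\<alpha>. \<Sum>B\<in>\<beta>. - ent (w A B) - w A B * log 2 (a A) - w A B * log 2 (b B))"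
    by (intro sum.cong refl) simp
  also have "\<dots> = - (\<Sum>A\<in>\<alpha>. \<Sum>B\<in>\<beta>. ent (w A B)) - (\<Sum>A\<in>\<alpha>. a A * log 2 (a A))
      - (\<Sum>B\<in>\<beta>. \<Sum>A\<in>\<alpha>. w A B * log 2 (b B))"
    by (subst sum.swap[of _ \<alpha> \<beta>]) (simp add: sum_subtractf sum_negf a sum_distrib_right)
  also have "(\<Sum>B\<in>\<beta>. \<Sum>A\<in>\<alpha>. w A B * log 2 (b B)) = (\<Sum>B\<in>\<beta>. b B * log 2 (b B))"
    by (intro sum.cong refl) (simp add: b sum_distrib_right)
  finally show ?thesis by (simp add: ent_def sum_negf)
qed

locale borel_prob_space = prob_space \<nu> for \<nu> :: "'a::topological_space measure" +
  assumes sets_eq [measurable_cong, simp]: "sets \<nu> = sets borel"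
begin

lemma space_eq [simp]: "space \<nu> = UNIV"
  using sets_eq_imp_space_eq[OF sets_eq] by simp

lemma borel_measurable_eq: "f \<in> borel_measurable borel \<Longrightarrow> f \<in> borel_measurable \<nu>"
  by (simp add: measurable_def space_borel)

lemma
  assumes "channel I p" "i \<in> I"
  shows integrable_channel: "integrable \<nu> (p i)"
    and integrable_ent_channel: "integrable \<nu> (\<lambda>x. ent (p i x))"
    and integral_channel_nonneg: "0 \<le> (\<integral>x. p i x \<partial>\<nu>)"
    and integral_channel_le_1: "(\<integral>x. p i x \<partial>\<nu>) \<le> 1"
proof -
  note c = borel_measurable_eq[OF channel_measurable[OF assms]] channel_nonneg[OF assms] channel_le_1[OF assms]
  show int: "integrable \<nu> (p i)" "integrable \<nu> (\<lambda>x. ent (p i x))"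
    using c by (auto intro: integrable_unit integrable_ent)
  show "0 \<le> (\<integral>x. p i x \<partial>\<nu>)" using c by (simp add: integral_nonneg_AE)
  show "(\<integral>x. p i x \<partial>\<nu>) \<le> 1" using integral_le_const[OF int(1)] c by simp
qed

lemma sum_integral_channel: "channel I p \<Longrightarrow> (\<Sum>i\<in>I. \<integral>x. p i x \<partial>\<nu>) = 1"
  using Bochner_Integration.integral_sum[of I \<nu> p]
  prob_space
  by (simp add: integrable_channel channel_sum)

lemma channel_info_nonneg: "channel I p \<Longrightarrow> 0 \<le> channel_info \<nu> I p"
  unfolding channel_info_def
  by (intro sum_nonneg)
    (simp add: jensen_ent borel_measurable_eq channel_measurable channel_nonneg channel_le_1)

lemma channel_kl_ac:
  assumes "channel I p" "i \<in> I" "(\<integral>x. p i x \<partial>\<nu>) = 0"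
  shows "AE x in \<nu>. p i x = 0"
  using assms(3) integral_nonneg_eq_0_iff_AE[OF integrable_channel[OF assms(1,2)]]
    channel_nonneg[OF assms(1,2)] by simp

text \<open>If the mean of \<open>p i\<close> is zero, then \<open>p i\<close> vanishes almost
  everywhere and both sides are zero; otherwise the logarithm splits and each term is
  integrated.\<close>

lemma
  assumes "channel I p" "i \<in> I"
  shows integrable_channel_kl: "integrable \<nu> (\<lambda>x. p i x * log 2 (p i x / (\<integral>x. p i x \<partial>\<nu>)))"
    and integral_channel_kl: "(\<integral>x. p i x * log 2 (p i x / (\<integral>x. p i x \<partial>\<nu>)) \<partial>\<nu>)
      = ent (\<integral>x. p i x \<partial>\<nu>) - (\<integral>x. ent (p i x) \<partial>\<nu>)"
proof -
  let ?q = "\<integral>x. p i x \<partial>\<nu>"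
  have eq: "p i x * log 2 (p i x / ?q) = (if ?q = 0 then 0 else - ent (p i x) - p i x * log 2 ?q)" for x
    using channel_nonneg[OF assms] integral_channel_nonneg[OF assms] by (rule mult_log_divide)
  show "integrable \<nu> (\<lambda>x. p i x * log 2 (p i x / ?q))"
    unfolding eq using integrable_channel[OF assms] integrable_ent_channel[OF assms] by (cases "?q = 0") auto
  show "(\<integral>x. p i x * log 2 (p i x / ?q) \<partial>\<nu>) = ent ?q - (\<integral>x. ent (p i x) \<partial>\<nu>)"
  proof (cases "?q = 0")
    case True
    then have "AE x in \<nu>. ent (p i x) = 0"
      using channel_kl_ac[OF assms] by (auto elim: eventually_mono)
    then have "(\<integral>x. ent (p i x) \<partial>\<nu>) = 0" by (rule integral_eq_zero_AE)
    then show ?thesis using True by simp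
  next
    case False
    then show ?thesis
      unfolding eq using integrable_channel[OF assms] integrable_ent_channel[OF assms]
      by (simp add: ent_def)
  qed
qed

lemma channel_info_kl:
  assumes "channel I p"
  shows "channel_info \<nu> I p = (\<Sum>i\<in>I. \<integral>x. p i x * log 2 (p i x / (\<integral>x. p i x \<partial>\<nu>)) \<partial>\<nu>)"
  unfolding channel_info_def by (intro sum.cong refl) (simp add: integral_channel_kl[OF assms])

lemma integral_partition:
  fixes k :: "'a \<Rightarrow> real"
  assumes \<alpha>: "finite_measurable_partition borel \<alpha>" and k: "integrable \<nu> k"
  shows "(\<Sum>A\<in>\<alpha>. \<integral>x. indicator A x * k x \<partial>\<nu>) = (\<integral>x. k x \<partial>\<nu>)"
proof -
  have \<alpha>': "finite \<alpha>" "\<alpha> \<subseteq> sets borel" "partition_on UNIV \<alpha>"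
    using \<alpha> by (auto simp: finite_measurable_partition_def)
  have "(\<Sum>A\<in>\<alpha>. \<integral>x. indicator A x * k x \<partial>\<nu>) = (\<integral>x. (\<Sum>A\<in>\<alpha>. indicator A x * k x) \<partial>\<nu>)"
    using \<alpha>' k
    by (intro Bochner_Integration.integral_sum[symmetric] integrable_mult_indicator[where 'b=real, simplified]) auto
  also have "\<dots> = (\<integral>x. k x \<partial>\<nu>)"
  proof (intro Bochner_Integration.integral_cong refl)
    fix x
    have "(\<Sum>A\<in>\<alpha>. indicator A x) = (indicator (\<Union>\<alpha>) x :: real)"
      using \<alpha>'(1) partition_onD2[OF \<alpha>'(3)]
      by (subst indicator_UN_disjoint[symmetric, of \<alpha> id, simplified]) (auto simp: disjoint_family_on_def disjoint_def)
    then show "(\<Sum>A\<in>\<alpha>. indicator A x * k x) = k x"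
      using partition_onD1[OF \<alpha>'(3)] by (simp add: sum_distrib_right[symmetric])
  qed
  finally show ?thesis .
qed

text \<open>Data processing: coarsening inputs to cells of \<alpha> and decoded outputs to cells of
  \<beta> cannot increase the information. \<open>w A B\<close> is the joint probability of a block.
  The log-sum inequality bounds each block by the sum of its own integrals, and the blocks exhaust
  all inputs and outputs.\<close>

lemma partition_info_le:
  assumes c: "channel I p" and \<alpha>: "finite_measurable_partition borel \<alpha>"
    and \<beta>: "finite \<beta>" "disjoint \<beta>" and \<phi>: "\<And>i. i \<in> I \<Longrightarrow> \<phi> i \<in> \<Union>\<beta>"
  defines "w \<equiv> \<lambda>A B. \<Sum>i\<in>{i\<in>I. \<phi> i \<in> B}. \<integral>x. indicator A x * p i x \<partial>\<nu>"
  shows "(\<Sum>A\<in>\<alpha>. \<Sum>B\<in>\<beta>. w A B * log 2 (w A B / (measure \<nu> A * (\<Sum>i\<in>{i\<in>I. \<phi> i \<in> B}. \<integral>x. p i x \<partial>\<nu>))))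
    \<le> channel_info \<nu> I p"
proof -
  define q where "q i = (\<integral>x. p i x \<partial>\<nu>)" for i
  define k where "k i x = p i x * log 2 (p i x / q i)" for i x
  have fI: "finite I" using c by (rule channel_finite)
  have \<alpha>': "finite \<alpha>" "\<alpha> \<subseteq> sets borel" "partition_on UNIV \<alpha>"
    using \<alpha> by (auto simp: finite_measurable_partition_def)
  have intk: "integrable \<nu> (k i)" if "i \<in> I" for i
    unfolding k_def q_def using c that by (rule integrable_channel_kl)
  have 1: "w A B * log 2 (w A B / (measure \<nu> A * (\<Sum>i\<in>{i\<in>I. \<phi> i \<in> B}. q i)))
      \<le> (\<Sum>i\<in>{i\<in>I. \<phi> i \<in> B}. \<integral>x. indicator A x * k i x \<partial>\<nu>)" if A: "A \<in> \<alpha>" for A B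
  proof -
    have sA: "A \<in> sets \<nu>" using A \<alpha>' by auto
    have fm: "finite_measure (restrict_space \<nu> A)"
      using sA by (intro finite_measure_restrict_space) (auto simp: finite_measure_axioms)
    have ir: "(\<integral>x. f x \<partial>restrict_space \<nu> A) = (\<integral>x. indicator A x * f x \<partial>\<nu>)" for f :: "'a \<Rightarrow> real"
      using sA by (subst integral_restrict_space) auto
    have ac: "(\<integral>x. indicator A x * p i x \<partial>\<nu>) = 0" if "i \<in> I" "q i = 0" for i
      using channel_kl_ac[OF c that(1)] that(2) by (intro integral_eq_zero_AE) (auto simp: q_def)
    have "(\<Sum>i\<in>{i\<in>I. \<phi> i \<in> B}. \<integral>x. p i x \<partial>restrict_space \<nu> A)
        * log 2 ((\<Sum>i\<in>{i\<in>I. \<phi> i \<in> B}. \<integral>x. p i x \<partial>restrict_space \<nu> A)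
          / (measure (restrict_space \<nu> A) (space (restrict_space \<nu> A)) * (\<Sum>i\<in>{i\<in>I. \<phi> i \<in> B}. q i)))
      \<le> (\<Sum>i\<in>{i\<in>I. \<phi> i \<in> B}. \<integral>x. p i x * log 2 (p i x / q i) \<partial>restrict_space \<nu> A)"
      using c fI ac
      by (intro finite_measure.log_sum_inequality[OF fm])
        (auto simp: q_def ir channel_nonneg channel_le_1 integral_channel_nonneg
          intro!: measurable_restrict_space1 borel_measurable_eq channel_measurable)
    then show ?thesis
      using sA by (simp add: ir w_def k_def measure_restrict_space space_restrict_space)
  qed
  have "(\<Sum>A\<in>\<alpha>. \<Sum>B\<in>\<beta>. w A B * log 2 (w A B / (measure \<nu> A * (\<Sum>i\<in>{i\<in>I. \<phi> i \<in> B}. q i))))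
    \<le> (\<Sum>A\<in>\<alpha>. \<Sum>B\<in>\<beta>. \<Sum>i\<in>{i\<in>I. \<phi> i \<in> B}. \<integral>x. indicator A x * k i x \<partial>\<nu>)"
    by (intro sum_mono 1)
  also have "\<dots> = (\<Sum>A\<in>\<alpha>. \<Sum>i\<in>I. \<integral>x. indicator A x * k i x \<partial>\<nu>)"
  proof (rule sum.cong[OF refl])
    fix A
    have "(\<Union>B\<in>\<beta>. {i\<in>I. \<phi> i \<in> B}) = I" using \<phi> by auto
    then show "(\<Sum>B\<in>\<beta>. \<Sum>i\<in>{i\<in>I. \<phi> i \<in> B}. \<integral>x. indicator A x * k i x \<partial>\<nu>)
      = (\<Sum>i\<in>I. \<integral>x. indicator A x * k i x \<partial>\<nu>)"
      using fI \<beta> by (subst sum.UNION_disjoint[symmetric]) (auto dest: disjointD)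
  qed
  also have "\<dots> = (\<Sum>i\<in>I. \<Sum>A\<in>\<alpha>. \<integral>x. indicator A x * k i x \<partial>\<nu>)" by (rule sum.swap)
  also have "\<dots> = (\<Sum>i\<in>I. \<integral>x. k i x \<partial>\<nu>)"
  proof (rule sum.cong[OF refl])
    fix i assume i: "i \<in> I"
    show "(\<Sum>A\<in>\<alpha>. \<integral>x. indicator A x * k i x \<partial>\<nu>) = (\<integral>x. k i x \<partial>\<nu>)"
      using \<alpha> intk[OF i] by (rule integral_partition)
  qed
  also have "\<dots> = channel_info \<nu> I p" by (simp add: channel_info_kl[OF c] k_def q_def)
  finally show ?thesis by (simp add: q_def)
qed

end

lemma invariant_measuresD:
  assumes "\<nu> \<in> invariant_measures T"
  shows "borel_prob_space \<nu>" "distr \<nu> borel (T u) = \<nu>"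
  using assms by (auto simp: invariant_measures_def borel_prob_space_def borel_prob_space_axioms_def)

lemma channel_distortion_measurable:
  assumes "continuous_action T" "0 < L" "channel I p" "\<And>i. i \<in> I \<Longrightarrow> \<phi> i \<in> L1_space L"
  shows "channel_distortion T L I \<phi> p \<in> borel_measurable borel"
  unfolding channel_distortion_def[abs_def]
  using assms by (intro borel_measurable_sum borel_measurable_times channel_measurable[OF assms(3)]
      avg_dist_measurable_point)

lemma channel_distortion_bounds:
  fixes T :: "real ^ 'n \<Rightarrow> 'a::compact_metric_space \<Rightarrow> 'a"
  assumes "continuous_action T" "0 < L" "channel I p" "\<And>i. i \<in> I \<Longrightarrow> \<phi> i \<in> L1_space L"
  shows "0 \<le> channel_distortion T L I \<phi> p x"
    and "(\<And>x y::'a. dist x y \<le> D) \<Longrightarrow> channel_distortion T L I \<phi> p x \<le> D"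
proof -
  show "0 \<le> channel_distortion T L I \<phi> p x"
    unfolding channel_distortion_def
    using assms by (intro sum_nonneg mult_nonneg_nonneg avg_dist_nonneg channel_nonneg[OF assms(3)])
  assume D: "\<And>x y::'a. dist x y \<le> D"
  have "channel_distortion T L I \<phi> p x \<le> (\<Sum>i\<in>I. p i x * D)"
    unfolding channel_distortion_def
    using assms D by (intro sum_mono mult_left_mono avg_dist_le channel_nonneg[OF assms(3)])
  then show "channel_distortion T L I \<phi> p x \<le> D"
    by (simp add: sum_distrib_right[symmetric] channel_sum[OF assms(3)])
qed

text \<open>The channel is realised as a coupling: an input of law \<nu>, then an output drawn with
  the probabilities \<open>p i x\<close> and decoded by \<phi>. Decoding and passing to partitions
  can only lose information, by \<open>partition_info_le\<close>.\<close>

lemma rate_distortion_on_le: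
  fixes T :: "real ^ 'n \<Rightarrow> 'a::compact_metric_space \<Rightarrow> 'a"
  assumes \<nu>: "borel_prob_space \<nu>" and T: "continuous_action T" and L: "0 < L"
    and c: "channel I p" and \<phi>: "\<And>i. i \<in> I \<Longrightarrow> \<phi> i \<in> L1_space L"
    and d: "(\<integral>x. channel_distortion T L I \<phi> p x \<partial>\<nu>) < \<epsilon>"
  shows "rate_distortion_on T L \<nu> \<epsilon> \<le> ennreal (channel_info \<nu> I p)"
proof -
  interpret \<nu>: borel_prob_space \<nu> by (rule \<nu>)
  have fI: "finite I" using c by (rule channel_finite)
  have p: "p i \<in> borel_measurable \<nu>" if "i \<in> I" for i
    using c that by (intro \<nu>.borel_measurable_eq channel_measurable)
  \<comment> \<open>The second factor carries the discrete sigma-algebra on the finite set of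
    decoded maps. Joint measurability then only has to be checked for each output separately, and
    the second projection is still measurable into \<open>L1_borel L\<close>.\<close>
  let ?N = "count_space I \<Otimes>\<^sub>M \<nu>" and ?F = "count_space (\<phi> ` I)"
  define P where "P = distr (density ?N (\<lambda>(i, x). ennreal (p i x))) (borel \<Otimes>\<^sub>M ?F) (\<lambda>(i, x). (x, \<phi> i))"
  have mp: "(\<lambda>(i, x). ennreal (p i x)) \<in> borel_measurable ?N"
    using fI p by (intro measurable_pair_measure_countable1) (auto intro: countable_finite)
  have mm: "(\<lambda>(i, x). (x, \<phi> i)) \<in> ?N \<rightarrow>\<^sub>M borel \<Otimes>\<^sub>M ?F"
    using fI by (intro measurable_pair_measure_countable1) (auto intro!: countable_finite measurable_Pair)
  have nnP: "(\<integral>\<^sup>+z. g z \<partial>P) = (\<Sum>i\<in>I. \<integral>\<^sup>+x. ennreal (p i x) * g (x, \<phi> i) \<partial>\<nu>)"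
    if g: "g \<in> borel_measurable (borel \<Otimes>\<^sub>M ?F)" for g
  proof -
    have "(\<integral>\<^sup>+z. g z \<partial>P) = (\<integral>\<^sup>+z. (case z of (i, x) \<Rightarrow> ennreal (p i x)) * g (case z of (i, x) \<Rightarrow> (x, \<phi> i)) \<partial>?N)"
      unfolding P_def using mp mm g
      by (subst nn_integral_distr) (auto intro!: nn_integral_density measurable_compose[OF mm g])
    also have "\<dots> = (\<integral>\<^sup>+i. \<integral>\<^sup>+x. ennreal (p i x) * g (x, \<phi> i) \<partial>\<nu> \<partial>count_space I)"
      using mp measurable_compose[OF mm g]
      by (subst \<nu>.nn_integral_fst[symmetric]) (auto intro!: borel_measurable_times_ennreal)
    finally show ?thesis using fI by (simp add: nn_integral_count_space_finite)
  qed
  have spP: "space P = UNIV \<times> \<phi> ` I" by (simp add: P_def space_pair_measure)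
  have X: "fst \<in> P \<rightarrow>\<^sub>M borel" by (simp add: P_def)
  have Y: "snd \<in> P \<rightarrow>\<^sub>M ?F" by (simp add: P_def)
  have Y': "snd \<in> P \<rightarrow>\<^sub>M L1_borel L"
    using \<phi> by (intro measurable_compose[OF Y, of "\<lambda>x. x", simplified]) (auto simp: space_L1_borel)
  define w where "w A B = (\<Sum>i\<in>{i\<in>I. \<phi> i \<in> B}. \<integral>x. indicator A x * p i x \<partial>\<nu>)" for A B
  have w0: "0 \<le> w A B" for A B
    unfolding w_def using c by (intro sum_nonneg integral_nonneg_AE) (auto simp: channel_nonneg)
  have emP: "emeasure P ((fst -` A \<inter> space P) \<inter> (snd -` B \<inter> space P)) = ennreal (w A B)"
    if A: "A \<in> sets borel" for A B
  proof -
    let ?E = "A \<times> (B \<inter> \<phi> ` I)"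
    have sE: "?E \<in> sets (borel \<Otimes>\<^sub>M ?F)" using A by (intro pair_measureI) auto
    have E: "(fst -` A \<inter> space P) \<inter> (snd -` B \<inter> space P) = ?E" by (auto simp: spP)
    have "emeasure P ?E = (\<integral>\<^sup>+z. indicator ?E z \<partial>P)"
      using sE by (simp add: P_def)
    also have "\<dots> = (\<Sum>i\<in>I. \<integral>\<^sup>+x. ennreal (p i x) * indicator ?E (x, \<phi> i) \<partial>\<nu>)"
      using sE by (intro nnP) auto
    also have "\<dots> = (\<Sum>i\<in>I. ennreal (if \<phi> i \<in> B then \<integral>x. indicator A x * p i x \<partial>\<nu> else 0))"
    proof (rule sum.cong[OF refl])
      fix i assume i: "i \<in> I"
      have "(\<integral>\<^sup>+x. ennreal (p i x) * indicator ?E (x, \<phi> i) \<partial>\<nu>)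
        = (\<integral>\<^sup>+x. ennreal (if \<phi> i \<in> B then indicator A x * p i x else 0) \<partial>\<nu>)"
        using i by (intro nn_integral_cong) (auto simp: indicator_def)
      also have "\<dots> = ennreal (if \<phi> i \<in> B then \<integral>x. indicator A x * p i x \<partial>\<nu> else 0)"
        using c i A \<nu>.integrable_channel[OF c i]
        by (auto simp: channel_nonneg intro!: nn_integral_eq_integral integrable_mult_indicator[where 'b=real, simplified])
      finally show "(\<integral>\<^sup>+x. ennreal (p i x) * indicator ?E (x, \<phi> i) \<partial>\<nu>)
        = ennreal (if \<phi> i \<in> B then \<integral>x. indicator A x * p i x \<partial>\<nu> else 0)" .
    qed
    also have "\<dots> = ennreal (\<Sum>i\<in>I. if \<phi> i \<in> B then \<integral>x. indicator A x * p i x \<partial>\<nu> else 0)"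
      using c by (intro sum_ennreal) (auto simp: channel_nonneg intro!: integral_nonneg_AE)
    also have "(\<Sum>i\<in>I. if \<phi> i \<in> B then \<integral>x. indicator A x * p i x \<partial>\<nu> else 0) = w A B"
      using fI by (simp add: w_def sum.If_cases Int_def)
    finally show ?thesis by (simp add: E)
  qed
  have wU: "w A (\<phi> ` I) = measure \<nu> A" if A: "A \<in> sets borel" for A
  proof -
    have "w A (\<phi> ` I) = (\<integral>x. (\<Sum>i\<in>I. indicator A x * p i x) \<partial>\<nu>)"
      unfolding w_def using A \<nu>.integrable_channel[OF c]
      by (subst Bochner_Integration.integral_sum)
        (auto intro!: sum.cong integrable_mult_indicator[where 'b=real, simplified])
    then show ?thesis
      using A by (simp add: sum_distrib_left[symmetric] channel_sum[OF c])
  qed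
  have emX: "emeasure P (fst -` A \<inter> space P) = ennreal (measure \<nu> A)" if A: "A \<in> sets borel" for A
  proof -
    have "fst -` A \<inter> space P = (fst -` A \<inter> space P) \<inter> (snd -` (\<phi> ` I) \<inter> space P)" by (auto simp: spP)
    then show ?thesis using emP[OF A, of "\<phi> ` I"] wU[OF A] by simp
  qed
  have P: "prob_space P"
    using emX[of UNIV] \<nu>.prob_space by (intro prob_spaceI) simp
  interpret P: prob_space P by (rule P)
  have "distr P borel fst = \<nu>"
    using X by (intro measure_eqI) (auto simp: emeasure_distr emX \<nu>.emeasure_eq_measure)
  moreover have "distortion T L P fst snd < ennreal \<epsilon>"
  proof -
    let ?h = "\<lambda>z. ennreal (avg_dist T L (fst z) (snd z))"
    have mh: "?h \<in> borel_measurable (borel \<Otimes>\<^sub>M ?F)"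
    proof -
      have "(\<lambda>z. ?h (snd z, fst z)) \<in> borel_measurable (?F \<Otimes>\<^sub>M borel)"
        using T L \<phi> fI by (intro measurable_pair_measure_countable1)
          (auto intro!: countable_finite measurable_compose[OF avg_dist_measurable_point measurable_ennreal])
      from measurable_compose[OF measurable_pair_swap' this] show ?thesis
        by (simp add: split_beta')
    qed
    have "distortion T L P fst snd = (\<integral>\<^sup>+z. ?h z \<partial>P)"
      unfolding distortion_def using T L \<phi>
      by (intro nn_integral_cong) (auto simp: spP nn_integral_avg_dist)
    also have "\<dots> = (\<Sum>i\<in>I. \<integral>\<^sup>+x. ennreal (p i x) * ennreal (avg_dist T L x (\<phi> i)) \<partial>\<nu>)"
      using nnP[OF mh] by simp
    also have "\<dots> = (\<integral>\<^sup>+x. (\<Sum>i\<in>I. ennreal (p i x) * ennreal (avg_dist T L x (\<phi> i))) \<partial>\<nu>)"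
      using p T L \<phi> by (intro nn_integral_sum[symmetric] borel_measurable_times_ennreal
          measurable_compose[OF _ measurable_ennreal] \<nu>.borel_measurable_eq[OF avg_dist_measurable_point]) auto
    also have "\<dots> = (\<integral>\<^sup>+x. ennreal (channel_distortion T L I \<phi> p x) \<partial>\<nu>)"
      unfolding channel_distortion_def using c L
      by (intro nn_integral_cong) (simp add: ennreal_mult[symmetric] avg_dist_nonneg channel_nonneg[OF c] cong: sum.cong_simp)
    also have "\<dots> = ennreal (\<integral>x. channel_distortion T L I \<phi> p x \<partial>\<nu>)"
    proof -
      obtain D where D: "\<And>x y::'a. dist x y \<le> D" using ex_diameter_bound by blast
      note b = channel_distortion_bounds(1)[OF T L c \<phi>] channel_distortion_bounds(2)[OF T L c \<phi> D]
      have "integrable \<nu> (channel_distortion T L I \<phi> p)"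
        using b \<nu>.borel_measurable_eq[OF channel_distortion_measurable[OF T L c \<phi>]]
        by (intro \<nu>.integrable_const_bound[where B=D]) auto
      then show ?thesis using b(1) by (intro nn_integral_eq_integral) auto
    qed
    also have "\<dots> < ennreal \<epsilon>"
    proof (rule ennreal_lessI)
      have "0 \<le> (\<integral>x. channel_distortion T L I \<phi> p x \<partial>\<nu>)"
        by (intro integral_nonneg_AE AE_I2 channel_distortion_bounds(1)[OF T L c \<phi>])
      then show "0 < \<epsilon>" using d by simp
    qed (rule d)
    finally show ?thesis .
  qed
  moreover have "mutual_info P borel (L1_borel L) fst snd \<le> ennreal (channel_info \<nu> I p)"
    unfolding mutual_info_def
  proof (rule Sup_least, safe)
    fix \<alpha> :: "'a set set" and \<beta> :: "(real ^ 'n \<Rightarrow> 'a) set set set"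
    assume \<alpha>: "finite_measurable_partition borel \<alpha>" and \<beta>: "finite_measurable_partition (L1_borel L) \<beta>"
    have \<alpha>': "finite \<alpha>" "\<alpha> \<subseteq> sets borel" "partition_on UNIV \<alpha>"
      using \<alpha> by (auto simp: finite_measurable_partition_def)
    have \<beta>': "finite \<beta>" "\<beta> \<subseteq> sets (L1_borel L)" "partition_on (L1_space L) \<beta>"
      using \<beta> by (auto simp: finite_measurable_partition_def space_L1_borel)
    have m: "measure P ((fst -` A \<inter> space P) \<inter> (snd -` B \<inter> space P)) = w A B" if "A \<in> \<alpha>" for A B
      using that \<alpha>' emP[of A B] w0 by (auto simp: measure_def)
    have mX: "measure P (fst -` A \<inter> space P) = measure \<nu> A" if "A \<in> \<alpha>" for A
      using that \<alpha>' emX[of A] by (auto simp: measure_def)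
    have "w UNIV B = (\<Sum>i\<in>{i\<in>I. \<phi> i \<in> B}. \<integral>x. p i x \<partial>\<nu>)" for B
      by (simp add: w_def)
    moreover have "measure P (snd -` B \<inter> space P) = w UNIV B" for B
      using emP[of UNIV B] w0[of UNIV B] by (auto simp: measure_def Int_absorb1)
    ultimately have mY: "measure P (snd -` B \<inter> space P) = (\<Sum>i\<in>{i\<in>I. \<phi> i \<in> B}. \<integral>x. p i x \<partial>\<nu>)" for B
      by simp
    have a: "measure \<nu> A = (\<Sum>B\<in>\<beta>. w A B)" if "A \<in> \<alpha>" for A
      using P.sum_measure_partition[OF \<beta> Y', of "fst -` A \<inter> space P"] measurable_sets[OF X, of A] that \<alpha>'(2)
      by (simp add: m mX subset_eq)
    have b: "(\<Sum>i\<in>{i\<in>I. \<phi> i \<in> B}. \<integral>x. p i x \<partial>\<nu>) = (\<Sum>A\<in>\<alpha>. w A B)" if "B \<in> \<beta>" for B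
      using P.sum_measure_partition[OF \<alpha> X, of "snd -` B \<inter> space P"] measurable_sets[OF Y', of B] that \<beta>'(2)
      by (simp add: m mY subset_eq Int_commute[of "snd -` _ \<inter> _"])
    have "finite_mutual_information P (cell \<alpha> \<circ> fst) (cell \<beta> \<circ> snd)
      = (\<Sum>A\<in>\<alpha>. \<Sum>B\<in>\<beta>. w A B * log 2 (w A B /
          (measure \<nu> A * (\<Sum>i\<in>{i\<in>I. \<phi> i \<in> B}. \<integral>x. p i x \<partial>\<nu>))))"
      unfolding P.finite_mutual_information_cells[OF \<alpha> X \<beta> Y'] mY
      using mutual_information_matrix[where w=w and a="measure \<nu>", OF \<alpha>'(1) \<beta>'(1) w0 a b]
      by (simp add: m mX)
    also have "\<dots> \<le> channel_info \<nu> I p"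
      unfolding w_def using c \<alpha> \<beta>' \<phi>
      by (intro \<nu>.partition_info_le) (auto dest: partition_onD1 partition_onD2)
    finally show "ennreal (finite_mutual_information P (cell \<alpha> \<circ> fst) (cell \<beta> \<circ> snd))
      \<le> ennreal (channel_info \<nu> I p)" by (rule ennreal_leI)
  qed
  ultimately show ?thesis
    unfolding rate_distortion_on_def using P X Y'
    by (intro Inf_lower2[of "mutual_info P borel (L1_borel L) fst snd"] CollectI exI[of _ P] exI[of _ fst]
        exI[of _ snd] conjI refl)
qed

section \<open>Reduction of couplings to finite channels\<close>

text \<open>The conditional probability of \<open>Z = b\<close> given \<open>X\<close> is a
  Radon-Nikodym derivative: that of the law of \<open>X\<close> on the event \<open>Z = b\<close>
  with respect to the whole law of \<open>X\<close>.\<close>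

lemma exists_conditional_law:
  assumes P: "prob_space P" and X: "X \<in> P \<rightarrow>\<^sub>M borel" and F: "finite F" and Z: "Z \<in> P \<rightarrow>\<^sub>M count_space F"
  obtains p where "channel F p"
    "\<And>b. b \<in> F \<Longrightarrow> distr (density P (indicator (Z -` {b} \<inter> space P))) borel X
        = density (distr P borel X) (\<lambda>x. ennreal (p b x))"
proof -
  interpret P: prob_space P by (rule P)
  define \<mu> where "\<mu> = distr P borel X"
  interpret \<mu>: prob_space \<mu> unfolding \<mu>_def using X by (rule P.prob_space_distr)
  have sets_\<mu> [measurable_cong]: "sets \<mu> = sets borel" by (simp add: \<mu>_def)
  define E where "E b = Z -` {b} \<inter> space P" for b
  have E: "E b \<in> sets P" if "b \<in> F" for b
    unfolding E_def using that by (intro measurable_sets[OF Z]) auto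
  define N where "N b = distr (density P (indicator (E b))) borel X" for b
  have N: "emeasure (N b) A = emeasure P (E b \<inter> (X -` A \<inter> space P))" if "b \<in> F" "A \<in> sets borel" for b A
    using that E[OF that(1)] measurable_sets[OF X that(2)] X
    by (simp add: N_def emeasure_distr emeasure_density indicator_inter_arith[symmetric])
  have \<mu>A: "emeasure \<mu> A = emeasure P (X -` A \<inter> space P)" if "A \<in> sets borel" for A
    using that X by (simp add: \<mu>_def emeasure_distr)
  define h where "h b = RN_deriv \<mu> (N b)" for b
  have h [measurable]: "h b \<in> borel_measurable \<mu>" for b by (simp add: h_def)
  have dN: "density \<mu> (h b) = N b" if "b \<in> F" for b
    unfolding h_def
  proof (rule \<mu>.density_RN_deriv)
    show "absolutely_continuous \<mu> (N b)"
      unfolding absolutely_continuous_def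
    proof
      fix A assume "A \<in> null_sets \<mu>"
      then have A: "A \<in> sets borel" "emeasure P (X -` A \<inter> space P) = 0" by (auto simp: \<mu>A[symmetric] null_sets_def sets_\<mu>)
      have "emeasure P (E b \<inter> (X -` A \<inter> space P)) \<le> emeasure P (X -` A \<inter> space P)"
        using measurable_sets[OF X A(1)] by (intro emeasure_mono) auto
      then show "A \<in> null_sets (N b)" using A N[OF that A(1)] by (auto simp: null_sets_def N_def)
    qed
  qed (simp add: N_def \<mu>_def)
  \<comment> \<open>The events \<open>E b\<close> partition the probability space, so the
    derivatives add up to a density of \<mu> with respect to itself, which is one almost
    everywhere.\<close>
  have d1: "density \<mu> (\<lambda>x. \<Sum>b\<in>F. h b x) = density \<mu> (\<lambda>_. 1)"
  proof (rule measure_eqI)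
    fix A assume "A \<in> sets (density \<mu> (\<lambda>x. \<Sum>b\<in>F. h b x))"
    then have A: "A \<in> sets borel" by (simp add: \<mu>_def)
    have "emeasure (density \<mu> (\<lambda>x. \<Sum>b\<in>F. h b x)) A = (\<integral>\<^sup>+x. (\<Sum>b\<in>F. h b x * indicator A x) \<partial>\<mu>)"
      using A by (simp add: emeasure_density sum_distrib_right \<mu>_def)
    also have "\<dots> = (\<Sum>b\<in>F. \<integral>\<^sup>+x. h b x * indicator A x \<partial>\<mu>)"
      using A by (intro nn_integral_sum) (auto intro!: borel_measurable_times_ennreal simp: \<mu>_def h_def[unfolded \<mu>_def])
    also have "\<dots> = (\<Sum>b\<in>F. emeasure (N b) A)"
    proof (rule sum.cong[OF refl])
      fix b assume b: "b \<in> F"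
      have "A \<in> sets \<mu>" using A by (simp add: \<mu>_def)
      then have "emeasure (density \<mu> (h b)) A = (\<integral>\<^sup>+x. h b x * indicator A x \<partial>\<mu>)"
        by (rule emeasure_density[OF h])
      then show "(\<integral>\<^sup>+x. h b x * indicator A x \<partial>\<mu>) = emeasure (N b) A" by (simp only: dN[OF b])
    qed
    also have "\<dots> = (\<Sum>b\<in>F. emeasure P (E b \<inter> (X -` A \<inter> space P)))"
      using A by (intro sum.cong refl N)
    also have "\<dots> = emeasure P (\<Union>b\<in>F. E b \<inter> (X -` A \<inter> space P))"
      using F E measurable_sets[OF X A]
      by (intro sum_emeasure) (auto simp: disjoint_family_on_def E_def)
    also have "(\<Union>b\<in>F. E b \<inter> (X -` A \<inter> space P)) = X -` A \<inter> space P"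
      using measurable_space[OF Z] by (auto simp: E_def)
    finally show "emeasure (density \<mu> (\<lambda>x. \<Sum>b\<in>F. h b x)) A = emeasure (density \<mu> (\<lambda>_. 1)) A"
      using A by (simp add: \<mu>A density_1)
  qed simp
  have ae: "AE x in \<mu>. (\<Sum>b\<in>F. h b x) = 1"
    by (rule \<mu>.density_unique[OF _ _ d1]) simp_all
  obtain b0 where b0: "b0 \<in> F"
    using measurable_space[OF Z] P.not_empty by fastforce
  \<comment> \<open>The derivatives sum to one only \<mu>-almost everywhere. On the exceptional set
    a point mass at \<open>b0\<close> is used, so that the channel is normalised at every
    point.\<close>
  define p where "p b x = (if (\<Sum>b\<in>F. h b x) = 1 then enn2real (h b x) else if b = b0 then 1 else 0)" for b x
  have ph: "ennreal (p b x) = h b x" if "b \<in> F" "(\<Sum>b\<in>F. h b x) = 1" for b x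
  proof -
    have "h b x \<le> 1" using member_le_sum[of b F "\<lambda>b. h b x"] F that by simp
    then have "h b x < \<top>" using ennreal_one_less_top by (rule order_le_less_trans)
    then show ?thesis using that by (simp add: p_def)
  qed
  have p0: "0 \<le> p b x" for b x by (simp add: p_def)
  have "channel F p"
    unfolding channel_def
  proof (intro conjI ballI allI)
    show "p b \<in> borel_measurable borel" for b
    proof -
      have "p b \<in> borel_measurable \<mu>" unfolding p_def[abs_def] by measurable
      then show ?thesis by (simp add: \<mu>_def)
    qed
    show "(\<Sum>b\<in>F. p b x) = 1" for x
    proof (cases "(\<Sum>b\<in>F. h b x) = 1")
      case True
      have "ennreal (\<Sum>b\<in>F. p b x) = (\<Sum>b\<in>F. ennreal (p b x))" by (intro sum_ennreal[symmetric] p0)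
      also have "\<dots> = (\<Sum>b\<in>F. h b x)" by (intro sum.cong refl ph True)
      finally show ?thesis using True by (simp add: ennreal_eq_1)
    next
      case False
      then show ?thesis using b0 F by (simp add: p_def)
    qed
  qed (use F p0 in auto)
  moreover have "density \<mu> (\<lambda>x. ennreal (p b x)) = N b" if "b \<in> F" for b
  proof -
    have "AE x in \<mu>. ennreal (p b x) = h b x" using ae by eventually_elim (simp add: ph that)
    then have "density \<mu> (\<lambda>x. ennreal (p b x)) = density \<mu> (h b)"
      by (intro density_cong) (auto simp: p_def[abs_def])
    then show ?thesis using dN[OF that] by simp
  qed
  ultimately show thesis using that unfolding N_def E_def \<mu>_def by metis
qed

text \<open>\<open>F\<close> is the exact image, so no fibre is empty: the cells of a partition are
  nonempty, and distinct values must give distinct fibres.\<close>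

lemma fibres_partition:
  assumes f: "f \<in> S \<rightarrow>\<^sub>M count_space F" and F: "finite F" "F = f ` space S"
  shows "finite_measurable_partition S ((\<lambda>b. f -` {b} \<inter> space S) ` F)"
    and "inj_on (\<lambda>b. f -` {b} \<inter> space S) F"
proof -
  show "finite_measurable_partition S ((\<lambda>b. f -` {b} \<inter> space S) ` F)"
    unfolding finite_measurable_partition_def
  proof (intro conjI)
    show "(\<lambda>b. f -` {b} \<inter> space S) ` F \<subseteq> sets S" using f by (auto intro!: measurable_sets[OF f])
    show "partition_on (space S) ((\<lambda>b. f -` {b} \<inter> space S) ` F)"
      using F by (intro partition_onI) (auto simp: disjnt_def)
  qed (use F in simp)
  show "inj_on (\<lambda>b. f -` {b} \<inter> space S) F"
    using F(2) by (auto simp: inj_on_def)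
qed

text \<open>The left-hand side is the conditional entropy of the output given the cell of the input.
  A cell collects the inputs with equal rounded output probabilities; on it each \<open>p b\<close>
  is almost constant, and uniform continuity of \<open>ent\<close> makes it harmless to replace
  \<open>p b\<close> by its mean.\<close>

lemma (in borel_prob_space) exists_info_approximating_partition:
  assumes c: "channel F p" and \<eta>: "0 < \<eta>"
  obtains \<alpha> where "finite_measurable_partition borel \<alpha>"
    "(\<Sum>A\<in>\<alpha>. \<Sum>b\<in>F. ent (\<integral>x. indicator A x * p b x \<partial>\<nu>)) - (\<Sum>A\<in>\<alpha>. ent (measure \<nu> A))
       \<le> (\<Sum>b\<in>F. \<integral>x. ent (p b x) \<partial>\<nu>) + \<eta>"
proof -
  have F: "finite F" using c by (rule channel_finite)
  \<comment> \<open>One error is paid for each output, weighted by cell masses of total one; the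
    summand 1 keeps the denominator positive.\<close>
  define \<eta>' where "\<eta>' = \<eta> / (real (card F) + 1)"
  have \<eta>': "0 < \<eta>'" "real (card F) * \<eta>' \<le> \<eta>" using \<eta> by (auto simp: \<eta>'_def field_simps)
  obtain \<delta> where \<delta>: "0 < \<delta>" and ent_close: "\<And>s t. s \<in> {0..1} \<Longrightarrow> t \<in> {0..1} \<Longrightarrow> \<bar>t - s\<bar> < \<delta> \<Longrightarrow> \<bar>ent t - ent s\<bar> < \<eta>'"
    using compact_uniformly_continuous[OF continuous_on_ent compact_Icc] \<eta>'(1)
    unfolding uniformly_continuous_on_def dist_real_def by metis
  obtain n where n: "1 / real (Suc n) < \<delta>" using \<delta> nat_approx_posE by blast
  \<comment> \<open>The output probabilities rounded down to multiples of \<open>1 / Suc n\<close>.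
    The restriction to \<open>F\<close> places the keys in a finite product.\<close>
  define key where "key x = (\<lambda>b\<in>F. nat \<lfloor>real (Suc n) * p b x\<rfloor>)" for x
  have keyn: "nat \<lfloor>real (Suc n) * p b x\<rfloor> \<le> Suc n" if "b \<in> F" for b x
  proof -
    have "real (Suc n) * p b x \<le> real (Suc n) * 1"
      using channel_le_1[OF c that] by (intro mult_left_mono) auto
    then have "\<lfloor>real (Suc n) * p b x\<rfloor> \<le> \<lfloor>real (Suc n)\<rfloor>" by (intro floor_mono) simp
    also have "\<dots> = int (Suc n)" by (rule floor_of_nat)
    finally show ?thesis by (simp add: nat_le_iff del: of_nat_Suc)
  qed
  have key_sub: "range key \<subseteq> PiE F (\<lambda>_. {..Suc n})" using keyn by (auto simp: key_def)
  have fin_key: "finite (range key)"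
    using F by (intro finite_subset[OF key_sub] finite_PiE) auto
  have key_m: "key \<in> borel \<rightarrow>\<^sub>M count_space (range key)"
  proof (rule measurable_count_space_eq2[THEN iffD2, OF fin_key], intro conjI ballI)
    fix k assume "k \<in> range key"
    then have "k \<in> extensional F" by (auto simp: key_def)
    then have "key -` {k} \<inter> space borel = {x\<in>space borel. \<forall>b\<in>F. nat \<lfloor>real (Suc n) * p b x\<rfloor> = k b}"
      by (auto simp: key_def fun_eq_iff restrict_def extensional_def)
    also have "\<dots> \<in> sets borel"
    proof (rule sets.sets_Collect_finite_All[OF _ F])
      fix b assume "b \<in> F"
      then have [measurable]: "p b \<in> borel_measurable borel" by (rule channel_measurable[OF c])
      show "{x \<in> space borel. nat \<lfloor>real (Suc n) * p b x\<rfloor> = k b} \<in> sets borel" by measurable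
    qed
    finally show "key -` {k} \<inter> space borel \<in> sets borel" .
  qed auto
  define \<alpha> where "\<alpha> = (\<lambda>k. key -` {k} \<inter> space borel) ` range key"
  have \<alpha>: "finite_measurable_partition borel \<alpha>"
    unfolding \<alpha>_def by (rule fibres_partition(1)[OF key_m fin_key]) simp
  then have \<alpha>': "finite \<alpha>" "\<alpha> \<subseteq> sets borel" "partition_on UNIV \<alpha>"
    by (auto simp: finite_measurable_partition_def)
  have close: "\<bar>p b x - p b x'\<bar> \<le> 1 / real (Suc n)" if "A \<in> \<alpha>" "x \<in> A" "x' \<in> A" "b \<in> F" for A x x' b
  proof -
    have "key x b = key x' b" using that by (auto simp: \<alpha>_def)
    then have "\<lfloor>real (Suc n) * p b x\<rfloor> = \<lfloor>real (Suc n) * p b x'\<rfloor>"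
      using that channel_nonneg[OF c, of b] by (simp add: key_def eq_nat_nat_iff del: of_nat_Suc)
    then have "\<bar>real (Suc n) * p b x - real (Suc n) * p b x'\<bar> \<le> 1" by linarith
    then have "real (Suc n) * \<bar>p b x - p b x'\<bar> \<le> 1"
      by (simp add: right_diff_distrib[symmetric] abs_mult del: of_nat_Suc)
    then show ?thesis by (simp add: field_simps del: of_nat_Suc)
  qed
  define w where "w A b = (\<integral>x. indicator A x * p b x \<partial>\<nu>)" for A b
  have intp: "integrable \<nu> (\<lambda>x. indicator A x * p b x)" if "A \<in> \<alpha>" "b \<in> F" for A b
    using integrable_channel[OF c that(2)] \<alpha>'(2) that by (intro integrable_mult_indicator[where 'b=real, simplified]) auto
  have inte: "integrable \<nu> (\<lambda>x. indicator A x * ent (p b x))" if "A \<in> \<alpha>" "b \<in> F" for A b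
    using integrable_ent_channel[OF c that(2)] \<alpha>'(2) that by (intro integrable_mult_indicator[where 'b=real, simplified]) auto
  have w_sum: "(\<Sum>b\<in>F. w A b) = measure \<nu> A" if "A \<in> \<alpha>" for A
  proof -
    have "(\<Sum>b\<in>F. w A b) = (\<integral>x. (\<Sum>b\<in>F. indicator A x * p b x) \<partial>\<nu>)"
      unfolding w_def using intp that by (subst Bochner_Integration.integral_sum) auto
    then show ?thesis
      using that \<alpha>'(2) by (auto simp: sum_distrib_left[symmetric] channel_sum[OF c])
  qed
  have w0: "0 \<le> w A b" if "b \<in> F" for A b
    unfolding w_def using channel_nonneg[OF c that] by (intro integral_nonneg_AE) auto
  have key_est: "ent (w A b) + w A b * log 2 (measure \<nu> A)
      \<le> (\<integral>x. indicator A x * ent (p b x) \<partial>\<nu>) + measure \<nu> A * \<eta>'" if A: "A \<in> \<alpha>" and b: "b \<in> F" for A b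
  proof (cases "measure \<nu> A = 0")
    case True
    then have "w A b = 0" using w_sum[OF A] w0 b F by (simp add: sum_nonneg_eq_0_iff)
    moreover have "(\<integral>x. indicator A x * ent (p b x) \<partial>\<nu>) = 0"
    proof (rule integral_eq_zero_AE)
      have "A \<in> null_sets \<nu>" using True A \<alpha>'(2) by (auto simp: null_sets_def emeasure_eq_measure)
      then have "AE x in \<nu>. x \<notin> A" by (rule AE_not_in)
      then show "AE x in \<nu>. indicator A x * ent (p b x) = 0" by eventually_elim simp
    qed
    ultimately show ?thesis using True by simp
  next
    case False
    then have mA: "0 < measure \<nu> A" by (simp add: zero_less_measure_iff)
    have sA: "A \<in> sets \<nu>" using A \<alpha>'(2) by auto
    have iA: "integrable \<nu> (indicator A :: 'a \<Rightarrow> real)"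
      using sA by (simp add: integrable_indicator_iff less_top[symmetric])
    \<comment> \<open>The conditional probability of output \<open>b\<close> given the cell
      \<open>A\<close>; \<open>measure \<nu> A * ent m\<close> is the left-hand side of the
      estimate.\<close>
    define m where "m = w A b / measure \<nu> A"
    have "w A b \<le> measure \<nu> A"
      unfolding w_sum[OF A, symmetric] using w0 b F by (intro member_le_sum) auto
    then have m01: "m \<in> {0..1}" using mA w0[OF b] by (simp add: m_def field_simps)
    have mp: "\<bar>m - p b x\<bar> \<le> 1 / real (Suc n)" if x: "x \<in> A" for x
    proof -
      have "(\<integral>x'. indicator A x' * (p b x - 1 / real (Suc n)) \<partial>\<nu>) \<le> w A b"
        unfolding w_def using close[OF A x _ b]
        by (intro integral_mono integrable_mult_left iA intp[OF A b])
          (auto simp: abs_le_iff algebra_simps split: split_indicator)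
      moreover have "w A b \<le> (\<integral>x'. indicator A x' * (p b x + 1 / real (Suc n)) \<partial>\<nu>)"
        unfolding w_def using close[OF A x _ b]
        by (intro integral_mono integrable_mult_left iA intp[OF A b])
          (auto simp: abs_le_iff algebra_simps split: split_indicator)
      ultimately have "measure \<nu> A * (p b x - 1 / real (Suc n)) \<le> w A b"
        "w A b \<le> measure \<nu> A * (p b x + 1 / real (Suc n))"
        using sA by simp_all
      then have "p b x - 1 / real (Suc n) \<le> m" "m \<le> p b x + 1 / real (Suc n)"
        using mA by (simp_all add: m_def pos_le_divide_eq pos_divide_le_eq mult.commute)
      then show ?thesis by (simp add: abs_le_iff)
    qed
    have "(\<integral>x. indicator A x * (ent m - \<eta>') \<partial>\<nu>) \<le> (\<integral>x. indicator A x * ent (p b x) \<partial>\<nu>)"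
    proof (rule integral_mono)
      show "indicator A x * (ent m - \<eta>') \<le> indicator A x * ent (p b x)" for x
      proof (cases "x \<in> A")
        case True
        have "\<bar>m - p b x\<bar> < \<delta>" using mp[OF True] n by simp
        then have "\<bar>ent m - ent (p b x)\<bar> < \<eta>'"
          using channel_nonneg[OF c b, of x] channel_le_1[OF c b, of x] m01 by (intro ent_close) auto
        then show ?thesis using True by simp
      qed simp
    qed (use inte[OF A b] iA in auto)
    then have "measure \<nu> A * (ent m - \<eta>') \<le> (\<integral>x. indicator A x * ent (p b x) \<partial>\<nu>)"
      using sA by simp
    moreover have "measure \<nu> A * ent m = ent (w A b) + w A b * log 2 (measure \<nu> A)"
    proof (cases "w A b = 0")
      case False
      then have "0 < w A b" using w0[OF b] by (simp add: less_le)
      then show ?thesis using mA by (simp add: m_def ent_def log_divide algebra_simps)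
    qed (simp add: m_def)
    ultimately show ?thesis by (simp add: algebra_simps)
  qed
  have "(\<Sum>b\<in>F. w A b * log 2 (measure \<nu> A)) = - ent (measure \<nu> A)" if "A \<in> \<alpha>" for A
    using w_sum[OF that] by (simp add: sum_distrib_right[symmetric] ent_def)
  then have "(\<Sum>A\<in>\<alpha>. \<Sum>b\<in>F. ent (w A b)) - (\<Sum>A\<in>\<alpha>. ent (measure \<nu> A))
      = (\<Sum>A\<in>\<alpha>. \<Sum>b\<in>F. ent (w A b) + w A b * log 2 (measure \<nu> A))"
    by (simp add: sum.distrib sum_subtractf)
  also have "\<dots> \<le> (\<Sum>A\<in>\<alpha>. \<Sum>b\<in>F. (\<integral>x. indicator A x * ent (p b x) \<partial>\<nu>) + measure \<nu> A * \<eta>')"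
    by (intro sum_mono key_est)
  also have "\<dots> = (\<Sum>b\<in>F. \<Sum>A\<in>\<alpha>. \<integral>x. indicator A x * ent (p b x) \<partial>\<nu>) + real (card F) * \<eta>' * (\<Sum>A\<in>\<alpha>. measure \<nu> A)"
    by (subst (2) sum.swap) (simp add: sum.distrib sum_distrib_left sum_distrib_right mult_ac)
  also have "(\<Sum>b\<in>F. \<Sum>A\<in>\<alpha>. \<integral>x. indicator A x * ent (p b x) \<partial>\<nu>) = (\<Sum>b\<in>F. \<integral>x. ent (p b x) \<partial>\<nu>)"
    by (intro sum.cong refl integral_partition \<alpha> integrable_ent_channel[OF c])
  also have "(\<Sum>A\<in>\<alpha>. measure \<nu> A) = 1"
    using integral_partition[OF \<alpha>, of "\<lambda>_. 1"] \<alpha>'(2) prob_space by (simp add: subset_eq)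
  finally show thesis using that[OF \<alpha>] \<eta>'(2) unfolding w_def by simp
qed

text \<open>Two maps that have, up to rounding, the same distance to the orbits of all points of a finite
  net of the state space have almost the same distance to every orbit. Hence a finite quantizer exists although no
  separability of the space of maps has been established.\<close>

lemma exists_quantizer:
  fixes T :: "real ^ 'n \<Rightarrow> 'a::compact_metric_space \<Rightarrow> 'a"
  assumes T: "continuous_action T" and L: "0 < L" and \<delta>: "0 < \<delta>"
  obtains f F where "finite F" "F \<subseteq> L1_space L" "F = f ` L1_space L" "f \<in> L1_borel L \<rightarrow>\<^sub>M count_space F"
    "\<And>x y. y \<in> L1_space L \<Longrightarrow> avg_dist T L x (f y) \<le> avg_dist T L x y + \<delta>"
proof -
  \<comment> \<open>There are three errors: moving from \<open>x\<close> to a point of the net,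
    rounding there, and moving back.\<close>
  obtain \<eta> where \<eta>: "0 < \<eta>"
    "\<And>x x' y. dist x x' < \<eta> \<Longrightarrow> y \<in> L1_space L \<Longrightarrow> avg_dist T L x y \<le> avg_dist T L x' y + \<delta> / 3"
    using avg_dist_equicontinuous[OF T _ L, of "\<delta> / 3"] \<delta> by (metis divide_pos_pos zero_less_numeral)
  obtain N :: "'a set" where N: "finite N" "UNIV \<subseteq> (\<Union>x\<in>N. ball x \<eta>)"
    using compact_UNIV[where 'a='a] \<eta>(1) unfolding compact_eq_totally_bounded by blast
  obtain D where D: "\<And>x y::'a. dist x y \<le> D" using ex_diameter_bound by blast
  define key where "key y = (\<lambda>x\<in>N. \<lfloor>avg_dist T L x y / (\<delta> / 3)\<rfloor>)" for y
  have "key ` L1_space L \<subseteq> PiE N (\<lambda>_. {0..\<lfloor>D / (\<delta> / 3)\<rfloor>})"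
    using \<delta> avg_dist_le[OF T _ L D] avg_dist_nonneg[OF L, of T]
    by (auto simp: key_def intro!: floor_mono divide_right_mono)
  then have fin: "finite (key ` L1_space L)"
    by (rule finite_subset) (use N(1) in \<open>auto intro!: finite_PiE\<close>)
  have key_m: "key \<in> L1_borel L \<rightarrow>\<^sub>M count_space (key ` L1_space L)"
  proof (rule measurable_count_space_eq2[THEN iffD2, OF fin], intro conjI ballI)
    fix k assume "k \<in> key ` L1_space L"
    then have "k \<in> extensional N" by (auto simp: key_def)
    then have "key -` {k} \<inter> space (L1_borel L)
        = {y\<in>space (L1_borel L). \<forall>x\<in>N. \<lfloor>avg_dist T L x y / (\<delta> / 3)\<rfloor> = k x}"
      by (auto simp: key_def fun_eq_iff restrict_def extensional_def)
    also have "\<dots> \<in> sets (L1_borel L)"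
    proof (rule sets.sets_Collect_finite_All[OF _ N(1)])
      fix x
      have [measurable]: "(\<lambda>y. avg_dist T L x y) \<in> borel_measurable (L1_borel L)"
        by (rule avg_dist_measurable[OF T])
      show "{y \<in> space (L1_borel L). \<lfloor>avg_dist T L x y / (\<delta> / 3)\<rfloor> = k x} \<in> sets (L1_borel L)" by measurable
    qed
    finally show "key -` {k} \<inter> space (L1_borel L) \<in> sets (L1_borel L)" .
  qed (auto simp: space_L1_borel)
  \<comment> \<open>One representative for each value of the key. The quantizer factors through the
    key, which makes it finite-valued and measurable although \<open>r\<close> is an arbitrary
    choice.\<close>
  define r where "r k = (SOME y. y \<in> L1_space L \<and> key y = k)" for k
  have r: "r (key y) \<in> L1_space L" "key (r (key y)) = key y" if "y \<in> L1_space L" for y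
    unfolding r_def using someI[of "\<lambda>z. z \<in> L1_space L \<and> key z = key y" y] that by auto
  define f where "f = (\<lambda>y. r (key y))"
  show thesis
  proof (rule that[of "f ` L1_space L" f])
    show "finite (f ` L1_space L)"
      using finite_imageI[OF fin, of r] by (simp add: f_def image_image)
    show "f ` L1_space L \<subseteq> L1_space L" using r by (auto simp: f_def)
    show "f \<in> L1_borel L \<rightarrow>\<^sub>M count_space (f ` L1_space L)"
      unfolding f_def by (rule measurable_compose[OF key_m]) auto
    fix x :: 'a and y :: "(real ^ 'n \<Rightarrow> 'a) set" assume y: "y \<in> L1_space L"
    obtain x' where x': "x' \<in> N" "dist x' x < \<eta>" using N(2) by fastforce
    have "key (f y) x' = key y x'" using r y by (simp add: f_def)
    then have "\<lfloor>avg_dist T L x' (f y) / (\<delta> / 3)\<rfloor> = \<lfloor>avg_dist T L x' y / (\<delta> / 3)\<rfloor>"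
      using x' by (simp add: key_def)
    then have "avg_dist T L x' (f y) / (\<delta> / 3) \<le> avg_dist T L x' y / (\<delta> / 3) + 1" by linarith
    then have "avg_dist T L x' (f y) \<le> avg_dist T L x' y + \<delta> / 3" using \<delta> by (simp add: field_simps)
    moreover have "avg_dist T L x (f y) \<le> avg_dist T L x' (f y) + \<delta> / 3"
      using x' r(1)[OF y] by (intro \<eta>(2)) (auto simp: f_def dist_commute)
    moreover have "avg_dist T L x' y \<le> avg_dist T L x y + \<delta> / 3"
      using x' y by (intro \<eta>(2)) auto
    ultimately show "avg_dist T L x (f y) \<le> avg_dist T L x y + \<delta>" by simp
  qed simp
qed

text \<open>The distortion is a lower integral of a function that is not known to be measurable, so the
  estimate subtracts the quantization error from the measurable side.\<close>

lemma exists_channel_of_coupling: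
  fixes T :: "real ^ 'n \<Rightarrow> 'a::compact_metric_space \<Rightarrow> 'a"
  assumes \<mu>: "borel_prob_space \<mu>" and T: "continuous_action T" and L: "0 < L"
    and P: "prob_space P" and X: "X \<in> P \<rightarrow>\<^sub>M borel" and law: "distr P borel X = \<mu>"
    and Y: "Y \<in> P \<rightarrow>\<^sub>M L1_borel L" and d: "distortion T L P X Y < ennreal \<epsilon>"
  obtains F p where "F \<subseteq> L1_space L" "channel F p"
    "(\<integral>x. channel_distortion T L F (\<lambda>b. b) p x \<partial>\<mu>) < \<epsilon>"
    "ennreal (channel_info \<mu> F p) \<le> mutual_info P borel (L1_borel L) X Y"
proof -
  interpret \<mu>: borel_prob_space \<mu> by (rule \<mu>)
  interpret P: prob_space P by (rule P)
  have YL: "Y \<omega> \<in> L1_space L" if "\<omega> \<in> space P" for \<omega>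
    using measurable_space[OF Y that] by (simp add: space_L1_borel)
  obtain d0 where d0: "0 \<le> d0" "distortion T L P X Y = ennreal d0" "d0 < \<epsilon>"
    using d by (cases "distortion T L P X Y") (auto simp: ennreal_less_iff)
  \<comment> \<open>Half of the slack in the strict distortion bound pays for the
    quantization.\<close>
  define \<delta> where "\<delta> = (\<epsilon> - d0) / 2"
  have \<delta>: "0 < \<delta>" "d0 + \<delta> < \<epsilon>" using d0 by (auto simp: \<delta>_def field_simps)
  obtain f F where F: "finite F" "F \<subseteq> L1_space L" "F = f ` L1_space L"
    and f: "f \<in> L1_borel L \<rightarrow>\<^sub>M count_space F"
    and fd: "\<And>x y. y \<in> L1_space L \<Longrightarrow> avg_dist T L x (f y) \<le> avg_dist T L x y + \<delta>"
    using exists_quantizer[OF T L \<delta>(1)] by metis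
  have Z: "(\<lambda>\<omega>. f (Y \<omega>)) \<in> P \<rightarrow>\<^sub>M count_space F" by (rule measurable_compose[OF Y f])
  define E where "E b = (\<lambda>\<omega>. f (Y \<omega>)) -` {b} \<inter> space P" for b
  have E: "E b \<in> sets P" if "b \<in> F" for b
    unfolding E_def using that by (intro measurable_sets[OF Z]) auto
  obtain p where c: "channel F p"
    and p: "\<And>b. b \<in> F \<Longrightarrow> distr (density P (indicator (E b))) borel X = density \<mu> (\<lambda>x. ennreal (p b x))"
    using exists_conditional_law[OF P X F(1) Z] unfolding law E_def by metis
  have pm: "p b \<in> borel_measurable \<mu>" if "b \<in> F" for b
    using c that by (intro \<mu>.borel_measurable_eq channel_measurable)
  have joint: "(\<integral>\<^sup>+\<omega>. g (X \<omega>) * indicator (E b) \<omega> \<partial>P) = (\<integral>\<^sup>+x. ennreal (p b x) * g x \<partial>\<mu>)"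
    if "b \<in> F" "g \<in> borel_measurable borel" for b g
  proof -
    have "(\<integral>\<^sup>+\<omega>. g (X \<omega>) * indicator (E b) \<omega> \<partial>P) = (\<integral>\<^sup>+x. g x \<partial>distr (density P (indicator (E b))) borel X)"
      using that E[OF that(1)] X measurable_compose[OF X that(2)]
      by (simp add: nn_integral_distr nn_integral_density mult.commute)
    also have "\<dots> = (\<integral>\<^sup>+x. ennreal (p b x) * g x \<partial>\<mu>)"
      unfolding p[OF that(1)] using that pm[OF that(1)]
      by (intro nn_integral_density measurable_compose[OF _ measurable_ennreal])
        (simp_all cong: measurable_cong_sets)
    finally show ?thesis .
  qed
  define w where "w A b = (\<integral>x. indicator A x * p b x \<partial>\<mu>)" for A b
  have w: "measure P ((X -` A \<inter> space P) \<inter> E b) = w A b" if "A \<in> sets borel" "b \<in> F" for A b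
  proof -
    have "emeasure P ((X -` A \<inter> space P) \<inter> E b) = (\<integral>\<^sup>+\<omega>. indicator ((X -` A \<inter> space P) \<inter> E b) \<omega> \<partial>P)"
      using measurable_sets[OF X that(1)] E[OF that(2)] by simp
    also have "\<dots> = (\<integral>\<^sup>+\<omega>. indicator A (X \<omega>) * indicator (E b) \<omega> \<partial>P)"
      by (intro nn_integral_cong) (simp split: split_indicator)
    also have "\<dots> = (\<integral>\<^sup>+x. ennreal (indicator A x * p b x) \<partial>\<mu>)"
      using that by (subst joint) (auto intro!: nn_integral_cong simp: indicator_def)
    also have "\<dots> = ennreal (w A b)"
      unfolding w_def using that \<mu>.integrable_channel[OF c that(2)] c
      by (intro nn_integral_eq_integral integrable_mult_indicator[where 'b=real, simplified])
        (auto simp: channel_nonneg)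
    finally show ?thesis
      using c that unfolding w_def by (simp add: measure_def channel_nonneg integral_nonneg_AE)
  qed
  have "(\<integral>\<^sup>+x. ennreal (channel_distortion T L F (\<lambda>b. b) p x) \<partial>\<mu>)
      = (\<integral>\<^sup>+x. (\<Sum>b\<in>F. ennreal (p b x) * ennreal (avg_dist T L x b)) \<partial>\<mu>)"
    unfolding channel_distortion_def using L
    by (intro nn_integral_cong)
      (simp add: ennreal_mult[symmetric] avg_dist_nonneg channel_nonneg[OF c] cong: sum.cong_simp)
  also have "\<dots> = (\<Sum>b\<in>F. \<integral>\<^sup>+x. ennreal (p b x) * ennreal (avg_dist T L x b) \<partial>\<mu>)"
    using pm T L F(2) by (intro nn_integral_sum borel_measurable_times_ennreal
        measurable_compose[OF _ measurable_ennreal] \<mu>.borel_measurable_eq[OF avg_dist_measurable_point]) auto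
  also have "\<dots> = (\<Sum>b\<in>F. \<integral>\<^sup>+\<omega>. ennreal (avg_dist T L (X \<omega>) b) * indicator (E b) \<omega> \<partial>P)"
    using T L F(2) by (intro sum.cong refl joint[symmetric] measurable_compose[OF avg_dist_measurable_point measurable_ennreal]) auto
  also have "\<dots> = (\<integral>\<^sup>+\<omega>. (\<Sum>b\<in>F. ennreal (avg_dist T L (X \<omega>) b) * indicator (E b) \<omega>) \<partial>P)"
    using T L F(2) E X by (intro nn_integral_sum[symmetric] borel_measurable_times_ennreal borel_measurable_indicator
        measurable_compose[OF measurable_compose[OF X avg_dist_measurable_point] measurable_ennreal]) auto
  also have "\<dots> \<le> (\<integral>\<^sup>+\<omega>. (\<Sum>b\<in>F. ennreal (avg_dist T L (X \<omega>) b - \<delta>) * indicator (E b) \<omega>) + ennreal \<delta> \<partial>P)"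
  proof (rule nn_integral_mono)
    fix \<omega> assume \<omega>: "\<omega> \<in> space P"
    then have fb: "f (Y \<omega>) \<in> F" using YL F by auto
    have *: "(\<Sum>b\<in>F. g b * indicator (E b) \<omega>) = g (f (Y \<omega>))" for g :: "_ \<Rightarrow> ennreal"
      using \<omega> fb F(1) by (subst sum.remove[OF F(1) fb]) (auto simp: E_def indicator_def intro!: sum.neutral)
    \<comment> \<open>For distances below \<delta> the first summand is zero and the second one
      suffices.\<close>
    have "ennreal (avg_dist T L (X \<omega>) (f (Y \<omega>))) \<le> ennreal (avg_dist T L (X \<omega>) (f (Y \<omega>)) - \<delta>) + ennreal \<delta>"
      using \<delta> by (simp add: ennreal_plus_if)
    then show "(\<Sum>b\<in>F. ennreal (avg_dist T L (X \<omega>) b) * indicator (E b) \<omega>)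
      \<le> (\<Sum>b\<in>F. ennreal (avg_dist T L (X \<omega>) b - \<delta>) * indicator (E b) \<omega>) + ennreal \<delta>"
      unfolding * .
  qed
  also have "\<dots> = (\<integral>\<^sup>+\<omega>. (\<Sum>b\<in>F. ennreal (avg_dist T L (X \<omega>) b - \<delta>) * indicator (E b) \<omega>) \<partial>P) + ennreal \<delta>"
    using T L F(2) E X P.emeasure_space_1
    by (subst nn_integral_add) (auto intro!: borel_measurable_sum borel_measurable_times_ennreal borel_measurable_indicator
        measurable_compose[OF borel_measurable_diff[OF measurable_compose[OF X avg_dist_measurable_point] borel_measurable_const] measurable_ennreal])
  also have "\<dots> \<le> distortion T L P X Y + ennreal \<delta>"
    unfolding distortion_def
  proof (intro add_right_mono nn_integral_mono)
    fix \<omega> assume \<omega>: "\<omega> \<in> space P"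
    then have fb: "f (Y \<omega>) \<in> F" using YL F by auto
    have *: "(\<Sum>b\<in>F. g b * indicator (E b) \<omega>) = g (f (Y \<omega>))" for g :: "_ \<Rightarrow> ennreal"
      using \<omega> fb F(1) by (subst sum.remove[OF F(1) fb]) (auto simp: E_def indicator_def intro!: sum.neutral)
    show "(\<Sum>b\<in>F. ennreal (avg_dist T L (X \<omega>) b - \<delta>) * indicator (E b) \<omega>)
      \<le> (\<integral>\<^sup>+ u. ennreal (dist (T u (X \<omega>)) (L1_rep (Y \<omega>) u)) \<partial>cube_measure L) / ennreal (L ^ CARD('n))"
      unfolding * nn_integral_avg_dist[OF T L YL[OF \<omega>]] using fd[OF YL[OF \<omega>]]
      by (intro ennreal_leI) (simp add: diff_le_eq)
  qed
  also have "\<dots> < ennreal \<epsilon>"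
    using d0 \<delta> by (simp add: ennreal_plus[symmetric] ennreal_less_iff del: ennreal_plus)
  finally have nn: "(\<integral>\<^sup>+x. ennreal (channel_distortion T L F (\<lambda>b. b) p x) \<partial>\<mu>) < ennreal \<epsilon>" .
  have id: "\<And>b. b \<in> F \<Longrightarrow> b \<in> L1_space L" using F(2) by auto
  have "(\<integral>x. channel_distortion T L F (\<lambda>b. b) p x \<partial>\<mu>)
      = enn2real (\<integral>\<^sup>+x. ennreal (channel_distortion T L F (\<lambda>b. b) p x) \<partial>\<mu>)"
    using channel_distortion_bounds(1)[OF T L c id]
    by (intro integral_eq_nn_integral \<mu>.borel_measurable_eq channel_distortion_measurable[OF T L c id]) auto
  also have "\<dots> < \<epsilon>"
    using nn by (cases "\<integral>\<^sup>+x. ennreal (channel_distortion T L F (\<lambda>b. b) p x) \<partial>\<mu>") (auto simp: ennreal_less_iff)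
  finally have dist: "(\<integral>x. channel_distortion T L F (\<lambda>b. b) p x \<partial>\<mu>) < \<epsilon>" .
  \<comment> \<open>\<open>Y\<close> lies in \<open>B b\<close> exactly on the event
    \<open>E b\<close>. Thus this partition of the space of maps recovers the quantized output, and
    together with a fine partition of the states it bounds \<open>mutual_info\<close> from
    below.\<close>
  define B where "B b = f -` {b} \<inter> space (L1_borel L)" for b
  have \<beta>: "finite_measurable_partition (L1_borel L) (B ` F)" "inj_on B F"
    unfolding B_def[abs_def] using fibres_partition[OF f F(1)] F(3) space_L1_borel by blast+
  have YB: "Y -` B b \<inter> space P = E b" for b using YL by (auto simp: B_def E_def space_L1_borel)
  have "ennreal (channel_info \<mu> F p) \<le> mutual_info P borel (L1_borel L) X Y"
  proof (rule ennreal_le_epsilon)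
    fix \<eta> :: real assume \<eta>: "0 < \<eta>"
    obtain \<alpha> where \<alpha>: "finite_measurable_partition borel \<alpha>"
      and *: "(\<Sum>A\<in>\<alpha>. \<Sum>b\<in>F. ent (w A b)) - (\<Sum>A\<in>\<alpha>. ent (measure \<mu> A)) \<le> (\<Sum>b\<in>F. \<integral>x. ent (p b x) \<partial>\<mu>) + \<eta>"
      unfolding w_def by (rule \<mu>.exists_info_approximating_partition[OF c \<eta>])
    have \<alpha>': "finite \<alpha>" "\<alpha> \<subseteq> sets borel" using \<alpha> by (auto simp: finite_measurable_partition_def)
    have "measure P (X -` A \<inter> space P) = measure \<mu> A" if "A \<in> \<alpha>" for A
      using that \<alpha>'(2) measure_distr[OF X, of A] by (simp add: law subset_eq)
    moreover have "measure P (E b) = (\<integral>x. p b x \<partial>\<mu>)" if "b \<in> F" for b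
      using w[of UNIV b] that sets.sets_into_space[OF E[OF that]] by (simp add: w_def Int_absorb1)
    ultimately have "finite_mutual_information P (cell \<alpha> \<circ> X) (cell (B ` F) \<circ> Y)
      = (\<Sum>A\<in>\<alpha>. ent (measure \<mu> A)) + (\<Sum>b\<in>F. ent (\<integral>x. p b x \<partial>\<mu>)) - (\<Sum>A\<in>\<alpha>. \<Sum>b\<in>F. ent (w A b))"
      unfolding P.finite_mutual_information_cells[OF \<alpha> X \<beta>(1) Y]
      using \<alpha>'(2) by (simp add: sum.reindex[OF \<beta>(2)] YB w subset_eq cong: sum.cong_simp)
    then have "channel_info \<mu> F p \<le> finite_mutual_information P (cell \<alpha> \<circ> X) (cell (B ` F) \<circ> Y) + \<eta>"
      using * by (simp add: channel_info_def sum_subtractf)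
    then have "ennreal (channel_info \<mu> F p) \<le> ennreal (finite_mutual_information P (cell \<alpha> \<circ> X) (cell (B ` F) \<circ> Y) + \<eta>)"
      by (rule ennreal_leI)
    also have "\<dots> \<le> ennreal (finite_mutual_information P (cell \<alpha> \<circ> X) (cell (B ` F) \<circ> Y)) + ennreal \<eta>"
      using \<eta> by (auto simp: ennreal_plus_if intro: ennreal_leI)
    also have "\<dots> \<le> mutual_info P borel (L1_borel L) X Y + ennreal \<eta>"
      unfolding mutual_info_def using \<alpha> \<beta>(1) by (intro add_right_mono Sup_upper) blast
    finally show "ennreal (channel_info \<mu> F p) \<le> mutual_info P borel (L1_borel L) X Y + ennreal \<eta>" .
  qed
  with F(2) c dist show thesis by (rule that)
qed

section \<open>Tiling of cubes and existence of the limit\<close>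

text \<open>The function \<open>b\<close> is absorbed into factor \<open>j\<close>, the sum of
  products becomes a product of sums, and the other factors are one. In probabilistic terms, this is
  a marginal of a product law.\<close>

lemma sum_PiE_marginal:
  fixes a :: "'k \<Rightarrow> 'i \<Rightarrow> real"
  assumes K: "finite K" "j \<in> K" and I: "finite I" and a: "\<And>k. k \<in> K \<Longrightarrow> (\<Sum>y\<in>I. a k y) = 1"
  shows "(\<Sum>t\<in>PiE K (\<lambda>_. I). (\<Prod>k\<in>K. a k (t k)) * b (t j)) = (\<Sum>y\<in>I. a j y * b y)"
proof -
  have "(\<Prod>k\<in>K. a k (t k)) * b (t j) = (\<Prod>k\<in>K. a k (t k) * (if k = j then b (t k) else 1))" for t
    using K by (simp add: prod.distrib)
  then have "(\<Sum>t\<in>PiE K (\<lambda>_. I). (\<Prod>k\<in>K. a k (t k)) * b (t j))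
      = (\<Sum>t\<in>PiE K (\<lambda>_. I). \<Prod>k\<in>K. a k (t k) * (if k = j then b (t k) else 1))" by simp
  also have "\<dots> = (\<Prod>k\<in>K. \<Sum>y\<in>I. a k y * (if k = j then b y else 1))"
    using K I by (intro prod_sum_PiE[symmetric]) auto
  also have "\<dots> = (\<Prod>k\<in>K. if k = j then \<Sum>y\<in>I. a j y * b y else 1)"
    by (intro prod.cong refl) (auto simp: a)
  also have "\<dots> = (\<Sum>y\<in>I. a j y * b y)" using K by simp
  finally show ?thesis .
qed

text \<open>The logarithm splits only over positive factors. The last assumption covers the rest:
  the weight vanishes where the product does.\<close>

lemma mult_log_prod:
  assumes K: "finite K" and c: "\<And>k. k \<in> K \<Longrightarrow> (0::real) \<le> c k" and m: "(\<Prod>k\<in>K. c k) = 0 \<Longrightarrow> m = 0"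
  shows "m * log 2 (\<Prod>k\<in>K. c k) = (\<Sum>k\<in>K. m * log 2 (c k))"
proof (cases "m = 0")
  case False
  then have "\<And>k. k \<in> K \<Longrightarrow> c k > 0" using m K c by (force simp: less_le)
  then have "ln (\<Prod>k\<in>K. c k) = (\<Sum>k\<in>K. ln (c k))"
    by (intro ln_prod) (force simp: K)+
  then have "log 2 (\<Prod>k\<in>K. c k) = (\<Sum>k\<in>K. log 2 (c k))"
    by (simp add: log_def sum_divide_distrib)
  then show ?thesis by (simp add: sum_distrib_left)
qed simp

text \<open>Entropy is additive over independent coordinates: the logarithm splits, and each
  resulting term depends on one coordinate only.\<close>

lemma sum_ent_PiE:
  assumes K: "finite K" and I: "finite I" and a: "\<And>k. k \<in> K \<Longrightarrow> (\<Sum>y\<in>I. a k y) = 1"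
    and a0: "\<And>k y. k \<in> K \<Longrightarrow> y \<in> I \<Longrightarrow> 0 \<le> a k y"
  shows "(\<Sum>t\<in>PiE K (\<lambda>_. I). ent (\<Prod>k\<in>K. a k (t k))) = (\<Sum>k\<in>K. \<Sum>y\<in>I. ent (a k y))"
proof -
  have "(\<Sum>t\<in>PiE K (\<lambda>_. I). ent (\<Prod>k\<in>K. a k (t k)))
      = (\<Sum>t\<in>PiE K (\<lambda>_. I). \<Sum>j\<in>K. (\<Prod>k\<in>K. a k (t k)) * - log 2 (a j (t j)))"
  proof (rule sum.cong[OF refl])
    fix t assume t: "t \<in> PiE K (\<lambda>_. I)"
    have "(\<Prod>k\<in>K. a k (t k)) * log 2 (\<Prod>k\<in>K. a k (t k)) = (\<Sum>j\<in>K. (\<Prod>k\<in>K. a k (t k)) * log 2 (a j (t j)))"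
      using t by (intro mult_log_prod K a0) auto
    then show "ent (\<Prod>k\<in>K. a k (t k)) = (\<Sum>j\<in>K. (\<Prod>k\<in>K. a k (t k)) * - log 2 (a j (t j)))"
      by (simp add: ent_def sum_negf)
  qed
  also have "\<dots> = (\<Sum>j\<in>K. \<Sum>t\<in>PiE K (\<lambda>_. I). (\<Prod>k\<in>K. a k (t k)) * - log 2 (a j (t j)))"
    by (rule sum.swap)
  also have "\<dots> = (\<Sum>j\<in>K. \<Sum>y\<in>I. a j y * - log 2 (a j y))"
    by (intro sum.cong refl sum_PiE_marginal K I a)
  finally show ?thesis by (simp add: ent_def)
qed

text \<open>Given \<open>x\<close> the outputs are independent, output \<open>k\<close> being
  produced from the translate \<open>T (v k) x\<close>. Independence makes the conditional entropy
  additive.\<close>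

definition product_channel ::
    "(real ^ 'n \<Rightarrow> 'a \<Rightarrow> 'a) \<Rightarrow> 'k set \<Rightarrow> ('k \<Rightarrow> real ^ 'n) \<Rightarrow> ('i \<Rightarrow> 'a \<Rightarrow> real) \<Rightarrow> ('k \<Rightarrow> 'i) \<Rightarrow> 'a \<Rightarrow> real" where
  "product_channel T K v p t x = (\<Prod>k\<in>K. p (t k) (T (v k) x))"

lemma channel_product:
  assumes T: "continuous_action T" and K: "finite K" and c: "channel I p"
  shows "channel (PiE K (\<lambda>_. I)) (product_channel T K v p)"
  unfolding channel_def
proof (intro conjI ballI allI)
  show "finite (PiE K (\<lambda>_. I))" using K channel_finite[OF c] by (intro finite_PiE)
  fix t assume t: "t \<in> PiE K (\<lambda>_. I)"
  show "product_channel T K v p t \<in> borel_measurable borel"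
    unfolding product_channel_def[abs_def] using t T
    by (intro borel_measurable_prod measurable_compose[OF action_measurable channel_measurable[OF c]]) auto
  show "0 \<le> product_channel T K v p t x" for x
    unfolding product_channel_def using t by (intro prod_nonneg) (auto intro: channel_nonneg[OF c])
next
  show "(\<Sum>t\<in>PiE K (\<lambda>_. I). product_channel T K v p t x) = 1" for x
    unfolding product_channel_def using K channel_finite[OF c]
    by (subst prod_sum_PiE[symmetric, where f="\<lambda>k y. p y (T (v k) x)"]) (auto simp: channel_sum[OF c])
qed

lemma invariant_integral:
  fixes f :: "'a::compact_metric_space \<Rightarrow> real"
  assumes "\<nu> \<in> invariant_measures T" "continuous_action T" "f \<in> borel_measurable borel"
  shows "(\<integral>x. f (T u x) \<partial>\<nu>) = (\<integral>x. f x \<partial>\<nu>)"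
proof -
  interpret borel_prob_space \<nu> using assms(1) by (rule invariant_measuresD)
  have "T u \<in> \<nu> \<rightarrow>\<^sub>M borel" using action_measurable[OF assms(2)] by (simp cong: measurable_cong_sets)
  then have "(\<integral>x. f (T u x) \<partial>\<nu>) = (\<integral>x. f x \<partial>distr \<nu> borel (T u))"
    using assms(3) by (subst integral_distr) auto
  then show ?thesis using invariant_measuresD(2)[OF assms(1)] by simp
qed

text \<open>The conditional entropies add up exactly, while the output entropy is at most the sum of
  the marginal entropies, by Gibbs' inequality against the product of the marginals. Invariance
  makes each marginal equal to the output law of \<open>p\<close> under \<nu>.\<close>

lemma channel_info_product_le:
  assumes T: "continuous_action T" and \<nu>: "\<nu> \<in> invariant_measures T" and K: "finite K" and c: "channel I p"
  shows "channel_info \<nu> (PiE K (\<lambda>_. I)) (product_channel T K v p) \<le> real (card K) * channel_info \<nu> I p"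
proof -
  interpret borel_prob_space \<nu> using \<nu> by (rule invariant_measuresD)
  let ?T = "PiE K (\<lambda>_. I)" and ?P = "product_channel T K v p"
  have I: "finite I" using c by (rule channel_finite)
  have cP: "channel ?T ?P" by (rule channel_product[OF T K c])
  have fT: "finite ?T" using cP by (rule channel_finite)
  define q where "q y = (\<integral>x. p y x \<partial>\<nu>)" for y
  define Q where "Q t = (\<integral>x. ?P t x \<partial>\<nu>)" for t
  have q0: "0 \<le> q y" if "y \<in> I" for y unfolding q_def by (rule integral_channel_nonneg[OF c that])
  have sq: "(\<Sum>y\<in>I. q y) = 1" unfolding q_def by (rule sum_integral_channel[OF c])
  have pT: "(\<integral>x. p y (T (v k) x) \<partial>\<nu>) = q y" if "y \<in> I" for y k
    unfolding q_def by (rule invariant_integral[OF \<nu> T channel_measurable[OF c that]])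
  have intpT: "integrable \<nu> (\<lambda>x. p y (T (v k) x))" if "y \<in> I" for y k
    using borel_measurable_eq[OF measurable_compose[OF action_measurable[OF T] channel_measurable[OF c that]]]
    by (rule integrable_unit) (auto intro: channel_nonneg[OF c that] channel_le_1[OF c that])
  \<comment> \<open>Absolute continuity, needed for Gibbs' inequality and for splitting the
    logarithm: an output of marginal probability zero makes one factor of the product vanish almost
    everywhere.\<close>
  have Q_zero: "Q t = 0" if t: "t \<in> ?T" and z: "(\<Prod>k\<in>K. q (t k)) = 0" for t
  proof -
    obtain k where k: "k \<in> K" "q (t k) = 0" using z K by auto
    have tk: "t k \<in> I" using t k by auto
    have "AE x in \<nu>. p (t k) (T (v k) x) = 0"
      using pT[OF tk] k(2) integral_nonneg_eq_0_iff_AE[OF intpT[OF tk]] channel_nonneg[OF c tk] by simp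
    then have "AE x in \<nu>. ?P t x = 0"
      by eventually_elim (use K k in \<open>auto simp: product_channel_def intro!: prod_zero\<close>)
    then show "Q t = 0" unfolding Q_def by (rule integral_eq_zero_AE)
  qed
  have "(\<Sum>t\<in>?T. ent (Q t)) \<le> (\<Sum>t\<in>?T. - Q t * log 2 (\<Prod>k\<in>K. q (t k)))"
  proof (rule gibbs_inequality[OF fT])
    show "0 \<le> Q t" if "t \<in> ?T" for t unfolding Q_def by (rule integral_channel_nonneg[OF cP that])
    show "0 \<le> (\<Prod>k\<in>K. q (t k))" if "t \<in> ?T" for t using that q0 by (intro prod_nonneg) auto
    show "(\<Sum>t\<in>?T. Q t) = 1" unfolding Q_def by (rule sum_integral_channel[OF cP])
    show "(\<Sum>t\<in>?T. \<Prod>k\<in>K. q (t k)) = 1"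
      using K I by (subst prod_sum_PiE[symmetric]) (auto simp: sq)
  qed (rule Q_zero)
  also have "\<dots> = (\<Sum>t\<in>?T. \<Sum>j\<in>K. - (Q t * log 2 (q (t j))))"
  proof (rule sum.cong[OF refl])
    fix t assume t: "t \<in> ?T"
    have "Q t * log 2 (\<Prod>k\<in>K. q (t k)) = (\<Sum>j\<in>K. Q t * log 2 (q (t j)))"
      using t q0 Q_zero[OF t] by (intro mult_log_prod K) auto
    then show "- Q t * log 2 (\<Prod>k\<in>K. q (t k)) = (\<Sum>j\<in>K. - (Q t * log 2 (q (t j))))" by (simp add: sum_negf)
  qed
  also have "\<dots> = (\<Sum>j\<in>K. \<Sum>t\<in>?T. Q t * - log 2 (q (t j)))"
    by (subst sum.swap) simp
  also have "\<dots> = (\<Sum>j\<in>K. \<Sum>y\<in>I. ent (q y))"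
  proof (rule sum.cong[OF refl])
    fix j assume j: "j \<in> K"
    have "(\<Sum>t\<in>?T. Q t * - log 2 (q (t j))) = (\<integral>x. (\<Sum>t\<in>?T. ?P t x * - log 2 (q (t j))) \<partial>\<nu>)"
      unfolding Q_def using integrable_channel[OF cP] by (subst Bochner_Integration.integral_sum) auto
    also have "\<dots> = (\<integral>x. (\<Sum>y\<in>I. p y (T (v j) x) * - log 2 (q y)) \<partial>\<nu>)"
      unfolding product_channel_def
      by (intro Bochner_Integration.integral_cong refl
          sum_PiE_marginal[OF K j I, of "\<lambda>k y. p y (T (v k) x)" for x] channel_sum[OF c])
    also have "\<dots> = (\<Sum>y\<in>I. q y * - log 2 (q y))"
      using intpT by (subst Bochner_Integration.integral_sum) (auto simp: pT)
    finally show "(\<Sum>t\<in>?T. Q t * - log 2 (q (t j))) = (\<Sum>y\<in>I. ent (q y))" by (simp add: ent_def)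
  qed
  finally have 1: "(\<Sum>t\<in>?T. ent (Q t)) \<le> real (card K) * (\<Sum>y\<in>I. ent (q y))" by simp
  have "(\<Sum>t\<in>?T. \<integral>x. ent (?P t x) \<partial>\<nu>) = (\<integral>x. (\<Sum>t\<in>?T. ent (?P t x)) \<partial>\<nu>)"
    using integrable_ent_channel[OF cP] by (intro Bochner_Integration.integral_sum[symmetric])
  also have "\<dots> = (\<integral>x. (\<Sum>k\<in>K. \<Sum>y\<in>I. ent (p y (T (v k) x))) \<partial>\<nu>)"
    unfolding product_channel_def
    by (intro Bochner_Integration.integral_cong refl sum_ent_PiE[OF K I, of "\<lambda>k y. p y (T (v k) x)" for x]
        channel_sum[OF c] channel_nonneg[OF c])
  also have "\<dots> = (\<Sum>k\<in>K. \<Sum>y\<in>I. \<integral>x. ent (p y (T (v k) x)) \<partial>\<nu>)"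
  proof -
    have "integrable \<nu> (\<lambda>x. ent (p y (T (v k) x)))" if "y \<in> I" for y k
      using borel_measurable_eq[OF measurable_compose[OF action_measurable[OF T] channel_measurable[OF c that]]]
      by (rule integrable_ent) (auto intro: channel_nonneg[OF c that] channel_le_1[OF c that])
    then show ?thesis by (simp add: Bochner_Integration.integral_sum)
  qed
  also have "\<dots> = (\<Sum>k\<in>K. \<Sum>y\<in>I. \<integral>x. ent (p y x) \<partial>\<nu>)"
    by (intro sum.cong refl invariant_integral[OF \<nu> T] measurable_compose[OF channel_measurable[OF c] borel_measurable_ent])
  finally have 2: "(\<Sum>t\<in>?T. \<integral>x. ent (?P t x) \<partial>\<nu>) = real (card K) * (\<Sum>y\<in>I. \<integral>x. ent (p y x) \<partial>\<nu>)" by simp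
  show ?thesis
    using 1 2 unfolding channel_info_def Q_def q_def by (simp add: sum_subtractf right_diff_distrib)
qed

section \<open>Tiles of a cube and glued maps\<close>

definition tile_index :: "real \<Rightarrow> real ^ 'n \<Rightarrow> 'n \<Rightarrow> nat" where
  "tile_index l u = (\<lambda>i. nat \<lfloor>u $ i / l\<rfloor>)"

definition tile_origin :: "real \<Rightarrow> ('n \<Rightarrow> nat) \<Rightarrow> real ^ 'n" where
  "tile_origin l k = (\<chi> i. l * real (k i))"

text \<open>Outside the tiles with index in \<open>K\<close> the glued map has a junk value.\<close>

definition glue :: "real \<Rightarrow> ('n::finite \<Rightarrow> nat) set \<Rightarrow> (('n \<Rightarrow> nat) \<Rightarrow> (real ^ 'n \<Rightarrow> 'a::compact_metric_space) set)
    \<Rightarrow> real ^ 'n \<Rightarrow> 'a" where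
  "glue l K t u = (let k = tile_index l u; w = u - tile_origin l k in
     if k \<in> K \<and> w \<in> cube l then L1_rep (t k) w else undefined)"

lemma tile_index_in:
  assumes "0 < l" "u \<in> cube (real n * l)"
  shows "tile_index l u \<in> PiE UNIV (\<lambda>_. {..<n})" "u - tile_origin l (tile_index l u) \<in> cube l"
proof -
  have u: "0 \<le> u $ i" "u $ i < real n * l" for i using assms(2) by (auto simp: cube_def)
  have fl: "real (tile_index l u i) = of_int \<lfloor>u $ i / l\<rfloor>" for i
    using u(1)[of i] assms(1) by (simp add: tile_index_def)
  have "real (tile_index l u i) < real n" for i
  proof -
    have "of_int \<lfloor>u $ i / l\<rfloor> \<le> u $ i / l" by (rule of_int_floor_le)
    also have "\<dots> < real n" using u(2)[of i] assms(1) by (simp add: pos_divide_less_eq)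
    finally show ?thesis by (simp add: fl)
  qed
  then show "tile_index l u \<in> PiE UNIV (\<lambda>_. {..<n})" by (auto simp: PiE_def)
  have "l * of_int \<lfloor>u $ i / l\<rfloor> \<le> u $ i \<and> u $ i < l * of_int \<lfloor>u $ i / l\<rfloor> + l" for i
  proof -
    have "of_int \<lfloor>u $ i / l\<rfloor> \<le> u $ i / l" "u $ i / l < of_int \<lfloor>u $ i / l\<rfloor> + 1" by linarith+
    then have "of_int \<lfloor>u $ i / l\<rfloor> * l \<le> u $ i" "u $ i < (of_int \<lfloor>u $ i / l\<rfloor> + 1) * l"
      by (simp_all only: pos_le_divide_eq[OF assms(1)] pos_divide_less_eq[OF assms(1)])
    then show ?thesis by (simp add: algebra_simps)
  qed
  then show "u - tile_origin l (tile_index l u) \<in> cube l"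
    by (auto simp: cube_def tile_origin_def fl algebra_simps)
qed

lemma tile_index_measurable: "tile_index l \<in> borel \<rightarrow>\<^sub>M count_space (UNIV :: ('n::finite \<Rightarrow> nat) set)"
proof (rule measurable_count_space_eq_countable[THEN iffD2], safe)
  fix k :: "'n \<Rightarrow> nat"
  have "tile_index l -` {k} \<inter> space borel = {u\<in>space borel. \<forall>i\<in>UNIV. nat \<lfloor>u $ i / l\<rfloor> = k i}"
    by (auto simp: tile_index_def fun_eq_iff)
  also have "\<dots> \<in> sets borel"
  proof (rule sets.sets_Collect_finite_All)
    fix i
    have [measurable]: "(\<lambda>u :: real ^ 'n. u $ i) \<in> borel_measurable borel"
      by (intro borel_measurable_continuous_onI continuous_intros)
    show "{u\<in>space borel. nat \<lfloor>u $ i / l\<rfloor> = k i} \<in> sets borel" by measurable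
  qed simp
  finally show "tile_index l -` {k} \<inter> space borel \<in> sets borel" .
qed auto

text \<open>A representative is controlled on the cube only and may be arbitrary elsewhere. Cutting
  it off makes it measurable on the whole space, so that it can be translated to other
  tiles.\<close>

lemma L1_rep_extend_measurable:
  assumes "y \<in> L1_space l"
  shows "(\<lambda>u. if u \<in> cube l then L1_rep y u else undefined) \<in> borel \<rightarrow>\<^sub>M borel"
proof -
  have "L1_rep y \<in> restrict_space lborel (cube l) \<rightarrow>\<^sub>M borel"
    using L1_rep_measurable[OF assms] by (simp add: cube_measure_def)
  then show ?thesis
    by (subst (asm) measurable_restrict_space_iff[where c=undefined]) auto
qed

text \<open>The tile index is measurable with countably many values, and for a fixed index the glued
  map is a translate of a representative that has been cut off.\<close>

lemma glue_measurable:
  assumes t: "\<And>k. k \<in> K \<Longrightarrow> t k \<in> L1_space l"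
  shows "glue l K t \<in> borel \<rightarrow>\<^sub>M borel"
proof -
  define g where "g k u = (if k \<in> K \<and> u - tile_origin l k \<in> cube l then L1_rep (t k) (u - tile_origin l k) else undefined)" for k u
  have "g k \<in> borel \<rightarrow>\<^sub>M borel" for k
  proof (cases "k \<in> K")
    case True
    have "(\<lambda>u. u - tile_origin l k) \<in> borel \<rightarrow>\<^sub>M borel"
      by (intro borel_measurable_continuous_onI continuous_intros)
    from measurable_compose[OF this L1_rep_extend_measurable[OF t[OF True]]] True
    show ?thesis by (simp add: g_def[abs_def])
  qed (simp add: g_def[abs_def])
  then have "(\<lambda>u. g (tile_index l u) u) \<in> borel \<rightarrow>\<^sub>M borel"
    by (rule measurable_compose_countable'[where f=g and g="tile_index l", OF _ tile_index_measurable countableI_type])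
  then show ?thesis by (simp add: glue_def[abs_def] g_def Let_def)
qed

lemma lborel_integral_translate:
  fixes f :: "'e::euclidean_space \<Rightarrow> real"
  assumes "f \<in> borel_measurable borel"
  shows "(\<integral>u. f (u - v) \<partial>lborel) = (\<integral>u. f u \<partial>lborel)"
proof -
  have "(\<integral>u. f u \<partial>lborel) = (\<integral>u. f u \<partial>distr lborel borel ((+) (- v)))" by (simp add: lborel_distr_plus)
  also have "\<dots> = (\<integral>u. f (u - v) \<partial>lborel)" using assms by (subst integral_distr) auto
  finally show ?thesis by simp
qed

lemma lborel_integrable_translate:
  fixes f :: "'e::euclidean_space \<Rightarrow> real"
  assumes "integrable lborel f"
  shows "integrable lborel (\<lambda>u. f (u - v))"
proof -
  have "integrable (distr lborel borel ((+) (- v))) f" using assms by (simp add: lborel_distr_plus)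
  then show ?thesis
    using assms by (subst (asm) integrable_distr_eq) auto
qed

lemma integrable_indicator_cube: "integrable lborel (indicator (cube L :: (real ^ 'n) set) :: _ \<Rightarrow> real)"
proof -
  interpret finite_measure "cube_measure L :: (real ^ 'n) measure" by (rule finite_measure_cube)
  have "emeasure lborel (cube L :: (real ^ 'n) set) \<noteq> \<infinity>"
    using emeasure_finite[of "cube L"] by (simp add: cube_measure_def emeasure_restrict_space)
  then show ?thesis by (simp add: integrable_indicator_iff less_top)
qed

lemma integral_cube_measure:
  fixes f :: "real ^ 'n \<Rightarrow> real"
  shows "(\<integral>u. f u \<partial>cube_measure L) = (\<integral>u. indicator (cube L) u * f u \<partial>lborel)"
  unfolding cube_measure_def by (subst integral_restrict_space) auto

lemma measure_cube:
  "0 \<le> L \<Longrightarrow> measure lborel (cube L :: (real ^ 'n) set) = L ^ CARD('n)"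
  by (simp add: measure_def emeasure_cube)

text \<open>On tile \<open>k\<close> the action law gives
  \<open>T u x = T (u - tile_origin l k) (T (tile_origin l k) x)\<close>, so the error there is that
  of the translated point on the small cube, weighted by the volume fraction of one tile. Off the
  tiles the error is at most \<open>D\<close>, weighted by the remaining fraction.\<close>

lemma avg_dist_glue_le:
  fixes T :: "real ^ 'n \<Rightarrow> 'a::compact_metric_space \<Rightarrow> 'a"
  assumes T: "continuous_action T" and l: "0 < l" and L: "real n * l \<le> L" "0 < L"
    and t: "\<And>k. k \<in> K \<Longrightarrow> t k \<in> L1_space l" and K: "K = PiE UNIV (\<lambda>_. {..<n})"
    and D: "\<And>x y::'a. dist x y \<le> D"
  shows "avg_dist T L x (L1_class L (glue l K t))
    \<le> (\<Sum>k\<in>K. (l / L) ^ CARD('n) * avg_dist T l (T (tile_origin l k) x) (t k)) + D * (1 - (real n * l / L) ^ CARD('n))"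
proof -
  have fK: "finite K" unfolding K by (intro finite_PiE) auto
  have D0: "0 \<le> D" using D[of x x] by simp
  define e where "e k u = (if u \<in> cube l then L1_rep (t k) u else undefined)" for k u
  define h where "h k u = indicator (cube l) u * dist (T u (T (tile_origin l k) x)) (e k u)" for k u
  have em: "e k \<in> borel \<rightarrow>\<^sub>M borel" if "k \<in> K" for k
    unfolding e_def by (rule L1_rep_extend_measurable[OF t[OF that]])
  have om: "(\<lambda>u. T u y) \<in> borel \<rightarrow>\<^sub>M borel" for y
    by (intro borel_measurable_continuous_onI continuous_action_continuous T)
  have hm: "h k \<in> borel_measurable borel" if "k \<in> K" for k
    unfolding h_def[abs_def] using em[OF that] om
    by (intro borel_measurable_times borel_measurable_dist borel_measurable_indicator) auto
  have hb: "\<bar>h k u\<bar> \<le> D * indicator (cube l) u" for k u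
    using D by (auto simp: h_def split: split_indicator)
  have hi: "integrable lborel (h k)" if "k \<in> K" for k
    using hm[OF that] hb[of k] D0
    by (intro Bochner_Integration.integrable_bound[OF integrable_mult_right[OF integrable_indicator_cube[of l], of D]])
      (auto simp: abs_mult)
  have gm: "glue l K t \<in> borel \<rightarrow>\<^sub>M borel" by (rule glue_measurable[OF t])
  have sub: "cube (real n * l) \<subseteq> cube L"
    using L by (auto simp: cube_def intro: less_le_trans)
  have pt: "indicator (cube L) u * dist (T u x) (glue l K t u)
      \<le> (\<Sum>k\<in>K. h k (u - tile_origin l k)) + D * (indicator (cube L) u - indicator (cube (real n * l)) u)" for u
  proof (cases "u \<in> cube (real n * l)")
    case True
    let ?k = "tile_index l u"
    have k: "?k \<in> K" "u - tile_origin l ?k \<in> cube l" using tile_index_in[OF l True] by (auto simp: K)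
    have "T u x = T (u - tile_origin l ?k) (T (tile_origin l ?k) x)"
      using T unfolding continuous_action_def by (metis diff_add_cancel)
    then have "dist (T u x) (glue l K t u) = h ?k (u - tile_origin l ?k)"
      using k by (simp add: glue_def Let_def h_def e_def)
    also have "\<dots> \<le> (\<Sum>k\<in>K. h k (u - tile_origin l k))"
      using k fK by (intro member_le_sum) (auto simp: h_def)
    finally show ?thesis using True sub by (auto simp: indicator_def)
  next
    case False
    have "0 \<le> (\<Sum>k\<in>K. h k (u - tile_origin l k))" by (intro sum_nonneg) (auto simp: h_def)
    moreover have "indicator (cube L) u * dist (T u x) (glue l K t u) \<le> D * indicator (cube L) u"
      using D by (auto split: split_indicator)
    ultimately show ?thesis using False by (simp add: add_increasing)
  qed
  have "(\<integral>u. dist (T u x) (glue l K t u) \<partial>cube_measure L)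
      \<le> (\<integral>u. (\<Sum>k\<in>K. h k (u - tile_origin l k)) + D * (indicator (cube L) u - indicator (cube (real n * l)) u) \<partial>lborel)"
    unfolding integral_cube_measure
  proof (rule integral_mono)
    show "integrable lborel (\<lambda>u. indicator (cube L) u * dist (T u x) (glue l K t u))"
      using gm om D
      by (intro Bochner_Integration.integrable_bound[OF integrable_mult_right[OF integrable_indicator_cube[of L], of D]])
        (auto split: split_indicator intro!: AE_I2 borel_measurable_times borel_measurable_dist borel_measurable_indicator
          order_trans[OF D abs_ge_self])
    show "integrable lborel (\<lambda>u. (\<Sum>k\<in>K. h k (u - tile_origin l k)) + D * (indicator (cube L) u - indicator (cube (real n * l)) u))"
      using hi by (intro Bochner_Integration.integrable_add Bochner_Integration.integrable_sum lborel_integrable_translate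
          integrable_mult_right Bochner_Integration.integrable_diff integrable_indicator_cube)
  qed (rule pt)
  also have "\<dots> = (\<Sum>k\<in>K. \<integral>u. h k u \<partial>lborel) + D * (L ^ CARD('n) - (real n * l) ^ CARD('n))"
  proof -
    have "(\<integral>u. (\<Sum>k\<in>K. h k (u - tile_origin l k)) + D * (indicator (cube L) u - indicator (cube (real n * l)) u) \<partial>lborel)
      = (\<integral>u. (\<Sum>k\<in>K. h k (u - tile_origin l k)) \<partial>lborel)
        + D * ((\<integral>u. indicator (cube L :: (real ^ 'n) set) u \<partial>lborel)
          - (\<integral>u. indicator (cube (real n * l) :: (real ^ 'n) set) u \<partial>lborel))"
      using hi by (subst Bochner_Integration.integral_add)
        (auto intro!: Bochner_Integration.integrable_sum lborel_integrable_translate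
          integrable_mult_right Bochner_Integration.integrable_diff integrable_indicator_cube
          simp: Bochner_Integration.integral_diff[OF integrable_indicator_cube integrable_indicator_cube])
    also have "(\<integral>u. (\<Sum>k\<in>K. h k (u - tile_origin l k)) \<partial>lborel) = (\<Sum>k\<in>K. \<integral>u. h k u \<partial>lborel)"
      using hi hm by (subst Bochner_Integration.integral_sum) (auto intro!: lborel_integrable_translate sum.cong lborel_integral_translate)
    finally show ?thesis using L l by (simp add: measure_cube)
  qed
  also have "(\<Sum>k\<in>K. \<integral>u. h k u \<partial>lborel) = (\<Sum>k\<in>K. l ^ CARD('n) * avg_dist T l (T (tile_origin l k) x) (t k))"
  proof (rule sum.cong[OF refl])
    fix k
    have "(\<integral>u. h k u \<partial>lborel) = (\<integral>u. dist (T u (T (tile_origin l k) x)) (L1_rep (t k) u) \<partial>cube_measure l)"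
      unfolding integral_cube_measure
      by (intro Bochner_Integration.integral_cong refl) (auto simp: h_def e_def split: split_indicator)
    then show "(\<integral>u. h k u \<partial>lborel) = l ^ CARD('n) * avg_dist T l (T (tile_origin l k) x) (t k)"
      using l by (simp add: avg_dist_def)
  qed
  finally have "(\<integral>u. dist (T u x) (glue l K t u) \<partial>cube_measure L) / L ^ CARD('n)
      \<le> ((\<Sum>k\<in>K. l ^ CARD('n) * avg_dist T l (T (tile_origin l k) x) (t k)) + D * (L ^ CARD('n) - (real n * l) ^ CARD('n))) / L ^ CARD('n)"
    using L(2) by (intro divide_right_mono) auto
  also have "\<dots> = (\<Sum>k\<in>K. (l / L) ^ CARD('n) * avg_dist T l (T (tile_origin l k) x) (t k)) + D * (1 - (real n * l / L) ^ CARD('n))"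
    using L(2) by (simp add: add_divide_distrib sum_divide_distrib power_divide diff_divide_distrib right_diff_distrib)
  finally show ?thesis
    by (subst avg_dist_class[OF T measurable_cube_measureI[OF gm]])
qed

text \<open>Each of the \<open>n ^ CARD('n)\<close> tiles gets its own copy of the channel, applied
  to the translated point. Invariance gives every tile the same mean distortion, and
  \<open>channel_info_product_le\<close> bounds the information. The assumption on \<epsilon>
  concerns the resulting total, including the uncovered part of the cube.\<close>

lemma rate_distortion_on_tiling:
  fixes T :: "real ^ 'n \<Rightarrow> 'a::compact_metric_space \<Rightarrow> 'a"
  assumes T: "continuous_action T" and \<nu>: "\<nu> \<in> invariant_measures T"
    and l: "0 < l" and L: "real n * l \<le> L" "0 < L"
    and c: "channel I p" and \<phi>: "\<And>i. i \<in> I \<Longrightarrow> \<phi> i \<in> L1_space l"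
    and D: "\<And>x y::'a. dist x y \<le> D"
    and d: "(real n * l / L) ^ CARD('n) * (\<integral>x. channel_distortion T l I \<phi> p x \<partial>\<nu>)
              + D * (1 - (real n * l / L) ^ CARD('n)) < \<epsilon>"
  shows "rate_distortion_on T L \<nu> \<epsilon> \<le> ennreal (real n ^ CARD('n) * channel_info \<nu> I p)"
proof -
  interpret borel_prob_space \<nu> using \<nu> by (rule invariant_measuresD)
  define K where "K = (PiE UNIV (\<lambda>_. {..<n}) :: ('n \<Rightarrow> nat) set)"
  have fK: "finite K" unfolding K_def by (intro finite_PiE) auto
  have cK: "card K = n ^ CARD('n)" unfolding K_def by (subst card_PiE) auto
  have I: "finite I" using c by (rule channel_finite)
  let ?T = "PiE K (\<lambda>_. I)" and ?P = "product_channel T K (tile_origin l) p"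
  have cP: "channel ?T ?P" by (rule channel_product[OF T fK c])
  define \<psi> where "\<psi> t = L1_class L (glue l K (\<lambda>k. \<phi> (t k)))" for t
  have tm: "\<phi> (t k) \<in> L1_space l" if "t \<in> ?T" "k \<in> K" for t k using that \<phi> by auto
  have \<psi>: "\<psi> t \<in> L1_space L" if "t \<in> ?T" for t
    unfolding \<psi>_def using tm[OF that] by (intro L1_class_in_space measurable_cube_measureI glue_measurable)
  let ?cd = "channel_distortion T l I \<phi> p"
  have cdm: "?cd \<in> borel_measurable borel" by (rule channel_distortion_measurable[OF T l c \<phi>])
  have cdb: "0 \<le> ?cd x" "?cd x \<le> D" for x
    by (rule channel_distortion_bounds(1)[OF T l c \<phi>], assumption) (rule channel_distortion_bounds(2)[OF T l c \<phi> D])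
  have icd: "integrable \<nu> (\<lambda>x. ?cd (T v x))" for v
    using borel_measurable_eq[OF measurable_compose[OF action_measurable[OF T] cdm]] cdb
    by (intro integrable_const_bound[where B=D]) auto
  have swap: "(\<Sum>t\<in>S. w t * ((\<Sum>k\<in>K. a * b k t) + e)) = (\<Sum>k\<in>K. a * (\<Sum>t\<in>S. w t * b k t)) + (\<Sum>t\<in>S. w t) * e"
    for S and w :: "_ \<Rightarrow> real" and a b e
  proof -
    have "(\<Sum>t\<in>S. w t * (\<Sum>k\<in>K. a * b k t)) = (\<Sum>k\<in>K. a * (\<Sum>t\<in>S. w t * b k t))"
      unfolding sum_distrib_left by (subst sum.swap) (simp add: mult_ac)
    then show ?thesis by (simp add: distrib_left sum.distrib sum_distrib_right)
  qed
  have bound: "channel_distortion T L ?T \<psi> ?P x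
      \<le> (\<Sum>k\<in>K. (l / L) ^ CARD('n) * ?cd (T (tile_origin l k) x)) + D * (1 - (real n * l / L) ^ CARD('n))" for x
  proof -
    have "channel_distortion T L ?T \<psi> ?P x \<le> (\<Sum>t\<in>?T. ?P t x *
        ((\<Sum>k\<in>K. (l / L) ^ CARD('n) * avg_dist T l (T (tile_origin l k) x) (\<phi> (t k))) + D * (1 - (real n * l / L) ^ CARD('n))))"
      unfolding channel_distortion_def \<psi>_def using tm
      by (intro sum_mono mult_left_mono avg_dist_glue_le[OF T l L _ K_def D] channel_nonneg[OF cP]) auto
    also have "\<dots> = (\<Sum>k\<in>K. (l / L) ^ CARD('n) * (\<Sum>t\<in>?T. ?P t x * avg_dist T l (T (tile_origin l k) x) (\<phi> (t k))))
        + (\<Sum>t\<in>?T. ?P t x) * (D * (1 - (real n * l / L) ^ CARD('n)))"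
      by (rule swap)
    also have "(\<Sum>k\<in>K. (l / L) ^ CARD('n) * (\<Sum>t\<in>?T. ?P t x * avg_dist T l (T (tile_origin l k) x) (\<phi> (t k))))
      = (\<Sum>k\<in>K. (l / L) ^ CARD('n) * ?cd (T (tile_origin l k) x))"
      unfolding product_channel_def channel_distortion_def
      by (intro sum.cong refl arg_cong2[where f="(*)"]
          sum_PiE_marginal[OF fK _ I, of _ "\<lambda>k i. p i (T (tile_origin l k) x)"]) (auto simp: channel_sum[OF c])
    finally show ?thesis by (simp add: channel_sum[OF cP])
  qed
  have "(\<integral>x. channel_distortion T L ?T \<psi> ?P x \<partial>\<nu>)
      \<le> (\<integral>x. (\<Sum>k\<in>K. (l / L) ^ CARD('n) * ?cd (T (tile_origin l k) x)) + D * (1 - (real n * l / L) ^ CARD('n)) \<partial>\<nu>)"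
  proof (rule integral_mono)
    have "0 \<le> channel_distortion T L ?T \<psi> ?P x \<and> channel_distortion T L ?T \<psi> ?P x \<le> D" for x
      by (intro conjI channel_distortion_bounds(1)[OF T L(2) cP \<psi>] channel_distortion_bounds(2)[OF T L(2) cP \<psi> D])
    then show "integrable \<nu> (channel_distortion T L ?T \<psi> ?P)"
      using borel_measurable_eq[OF channel_distortion_measurable[OF T L(2) cP \<psi>]]
      by (intro integrable_const_bound[where B=D]) auto
    show "integrable \<nu> (\<lambda>x. (\<Sum>k\<in>K. (l / L) ^ CARD('n) * ?cd (T (tile_origin l k) x)) + D * (1 - (real n * l / L) ^ CARD('n)))"
      using icd by (intro Bochner_Integration.integrable_add Bochner_Integration.integrable_sum integrable_mult_right integrable_const)
  qed (rule bound)
  also have "\<dots> = (\<Sum>k\<in>K. (l / L) ^ CARD('n) * (\<integral>x. ?cd x \<partial>\<nu>)) + D * (1 - (real n * l / L) ^ CARD('n))"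
    using icd prob_space invariant_integral[OF \<nu> T cdm] by (simp add: Bochner_Integration.integral_sum)
  also have "(\<Sum>k\<in>K. (l / L) ^ CARD('n) * (\<integral>x. ?cd x \<partial>\<nu>)) = (real n * l / L) ^ CARD('n) * (\<integral>x. ?cd x \<partial>\<nu>)"
    by (simp add: cK power_mult_distrib power_divide)
  also have "\<dots> + D * (1 - (real n * l / L) ^ CARD('n)) < \<epsilon>" by (rule d)
  finally have "rate_distortion_on T L \<nu> \<epsilon> \<le> ennreal (channel_info \<nu> ?T ?P)"
    by (intro rate_distortion_on_le[OF borel_prob_space_axioms T L(2) cP \<psi>])
  also have "\<dots> \<le> ennreal (real n ^ CARD('n) * channel_info \<nu> I p)"
    using channel_info_product_le[OF T \<nu> fK c, of "tile_origin l"] by (intro ennreal_leI) (simp add: cK)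
  finally show ?thesis .
qed

lemma exists_channel_of_rate_less:
  fixes T :: "real ^ 'n \<Rightarrow> 'a::compact_metric_space \<Rightarrow> 'a"
  assumes T: "continuous_action T" and \<mu>: "borel_prob_space \<mu>" and L: "0 < L"
    and r: "rate_distortion_on T L \<mu> \<epsilon> < r"
  obtains F p where "F \<subseteq> L1_space L" "channel F p"
    "(\<integral>x. channel_distortion T L F (\<lambda>b. b) p x \<partial>\<mu>) < \<epsilon>" "ennreal (channel_info \<mu> F p) < r"
proof -
  obtain P :: "('a \<times> (real ^ 'n \<Rightarrow> 'a) set) measure" and X Y
    where P: "prob_space P" "X \<in> P \<rightarrow>\<^sub>M borel" "distr P borel X = \<mu>" "Y \<in> P \<rightarrow>\<^sub>M L1_borel L"
      "distortion T L P X Y < ennreal \<epsilon>" and m: "mutual_info P borel (L1_borel L) X Y < r"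
    using r unfolding rate_distortion_on_def Inf_less_iff by blast
  obtain F p where "F \<subseteq> L1_space L" "channel F p"
    "(\<integral>x. channel_distortion T L F (\<lambda>b. b) p x \<partial>\<mu>) < \<epsilon>"
    "ennreal (channel_info \<mu> F p) \<le> mutual_info P borel (L1_borel L) X Y"
    by (rule exists_channel_of_coupling[OF \<mu> T L P])
  then show thesis using m that by (metis le_less_trans)
qed

text \<open>The infimum is trivially a lower bound. Conversely, a channel that is almost optimal at
  one scale \<open>l\<close> is copied to the tiles of every large cube; the strict distortion bound
  leaves room for the uncovered part, whose fraction tends to zero.\<close>

lemma rate_distortion_tendsto:
  fixes T :: "real ^ 'n \<Rightarrow> 'a::compact_metric_space \<Rightarrow> 'a"
  assumes T: "continuous_action T" and \<nu>: "\<nu> \<in> invariant_measures T"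
  shows "((\<lambda>L. rate_distortion_on T L \<nu> \<epsilon> / ennreal (L ^ CARD('n))) \<longlongrightarrow>
    (INF L\<in>{0<..}. rate_distortion_on T L \<nu> \<epsilon> / ennreal (L ^ CARD('n)))) at_top"
proof (rule order_tendstoI)
  let ?r = "\<lambda>L. rate_distortion_on T L \<nu> \<epsilon> / ennreal (L ^ CARD('n))"
  fix a assume a: "a < (INF L\<in>{0<..}. ?r L)"
  show "eventually (\<lambda>L. a < ?r L) at_top"
    using eventually_gt_at_top[of 0] by eventually_elim (auto intro: less_le_trans[OF a] INF_lower)
next
  let ?r = "\<lambda>L. rate_distortion_on T L \<nu> \<epsilon> / ennreal (L ^ CARD('n))"
  fix a assume "(INF L\<in>{0<..}. ?r L) < a"
  then obtain l where l: "0 < l" and "?r l < a" by (auto simp: INF_less_iff)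
  then have "rate_distortion_on T l \<nu> \<epsilon> < a * ennreal (l ^ CARD('n))"
    by (subst (asm) divide_less_ennreal) auto
  then obtain F p where F: "F \<subseteq> L1_space l" and c: "channel F p"
    and d: "(\<integral>x. channel_distortion T l F (\<lambda>b. b) p x \<partial>\<nu>) < \<epsilon>"
    and J: "ennreal (channel_info \<nu> F p) < a * ennreal (l ^ CARD('n))"
    by (rule exists_channel_of_rate_less[OF T invariant_measuresD(1)[OF \<nu>] l])
  let ?J = "channel_info \<nu> F p" and ?d = "\<integral>x. channel_distortion T l F (\<lambda>b. b) p x \<partial>\<nu>"
  interpret borel_prob_space \<nu> using \<nu> by (rule invariant_measuresD)
  have J0: "0 \<le> ?J" by (rule channel_info_nonneg[OF c])
  obtain D where D: "\<And>x y::'a. dist x y \<le> D" using ex_diameter_bound by blast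
  \<comment> \<open>The fraction of a side covered by whole tiles; for positive \<open>L\<close> it
    lies between \<open>1 - l / L\<close> and 1.\<close>
  define s where "s L = real (nat \<lfloor>L / l\<rfloor>) * l / L" for L
  have s_le: "s L \<le> 1" and s_ge: "1 - l / L \<le> s L" and n_le: "real (nat \<lfloor>L / l\<rfloor>) * l \<le> L" if "0 < L" for L
  proof -
    have n: "real (nat \<lfloor>L / l\<rfloor>) = of_int \<lfloor>L / l\<rfloor>" using that l by simp
    have "of_int \<lfloor>L / l\<rfloor> \<le> L / l" "L / l \<le> of_int \<lfloor>L / l\<rfloor> + 1" by linarith+
    then have "of_int \<lfloor>L / l\<rfloor> * l \<le> L" "L \<le> (of_int \<lfloor>L / l\<rfloor> + 1) * l"
      by (simp_all only: pos_le_divide_eq[OF l] pos_divide_le_eq[OF l])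
    then have *: "real (nat \<lfloor>L / l\<rfloor>) * l \<le> L" "L - l \<le> real (nat \<lfloor>L / l\<rfloor>) * l"
      unfolding n by (simp_all add: distrib_right)
    show "real (nat \<lfloor>L / l\<rfloor>) * l \<le> L" by (rule *(1))
    show "s L \<le> 1" unfolding s_def using *(1) that by (simp only: pos_divide_le_eq mult_1)
    have "1 - l / L = (L - l) / L" using that by (simp add: diff_divide_distrib)
    also have "\<dots> \<le> s L" unfolding s_def using *(2) that by (intro divide_right_mono) auto
    finally show "1 - l / L \<le> s L" .
  qed
  have "(s \<longlongrightarrow> 1) at_top"
  proof (rule tendsto_sandwich)
    show "eventually (\<lambda>L. 1 - l / L \<le> s L) at_top" "eventually (\<lambda>L. s L \<le> 1) at_top"
      using eventually_gt_at_top[of 0] by (eventually_elim, simp add: s_ge s_le)+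
    show "((\<lambda>L. 1 - l / L) \<longlongrightarrow> 1) at_top" by real_asymp
  qed simp
  then have "((\<lambda>L. s L ^ CARD('n) * ?d + D * (1 - s L ^ CARD('n))) \<longlongrightarrow> 1 ^ CARD('n) * ?d + D * (1 - 1 ^ CARD('n))) at_top"
    by (intro tendsto_intros)
  then have "eventually (\<lambda>L. s L ^ CARD('n) * ?d + D * (1 - s L ^ CARD('n)) < \<epsilon>) at_top"
    using d by (intro order_tendstoD) auto
  then show "eventually (\<lambda>L. ?r L < a) at_top"
    using eventually_gt_at_top[of 0]
  proof eventually_elim
    case (elim L)
    let ?n = "nat \<lfloor>L / l\<rfloor>"
    have "rate_distortion_on T L \<nu> \<epsilon> \<le> ennreal (real ?n ^ CARD('n) * ?J)"
      using elim(1) F by (intro rate_distortion_on_tiling[OF T \<nu> l n_le[OF elim(2)] elim(2) c _ D]) (auto simp: s_def)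
    also have "real ?n ^ CARD('n) * ?J \<le> (L / l) ^ CARD('n) * ?J"
      using n_le[OF elim(2)] l J0 by (intro mult_right_mono power_mono) (auto simp: field_simps)
    finally have "rate_distortion_on T L \<nu> \<epsilon> \<le> ennreal ((L / l) ^ CARD('n) * ?J)" by (simp add: ennreal_leI)
    then have "?r L \<le> ennreal ((L / l) ^ CARD('n) * ?J) / ennreal (L ^ CARD('n))"
      by (rule divide_right_mono_ennreal)
    also have "\<dots> = ennreal ?J / ennreal (l ^ CARD('n))"
      using elim(2) l J0 by (simp add: divide_ennreal power_divide)
    also have "\<dots> < a" using J l by (subst divide_less_ennreal) auto
    finally show ?case .
  qed
qed

lemma rate_distortion_eq_INF:
  fixes T :: "real ^ 'n \<Rightarrow> 'a::compact_metric_space \<Rightarrow> 'a"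
  assumes "continuous_action T" "\<nu> \<in> invariant_measures T"
  shows "rate_distortion T \<nu> \<epsilon> = (INF L\<in>{0<..}. rate_distortion_on T L \<nu> \<epsilon> / ennreal (L ^ CARD('n)))"
  unfolding rate_distortion_def
  by (rule tendsto_Lim[OF trivial_limit_at_top_linorder rate_distortion_tendsto[OF assms]])

section \<open>Decompositions of invariant measures\<close>

lemma openin_weak_star_subset: "openin (weak_star_topology T) U \<Longrightarrow> U \<subseteq> invariant_measures T"
  unfolding weak_star_topology_def
  by (drule openin_subset) (auto simp: topology_generated_by_topspace)

lemma space_invariant_measures_borel: "space (invariant_measures_borel T) = invariant_measures T"
  unfolding invariant_measures_borel_def
  by (rule space_measure_of) (auto dest: openin_weak_star_subset)

lemma weak_star_integral_measurable:
  fixes f :: "'a::compact_metric_space \<Rightarrow> real"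
  assumes "continuous_on UNIV f"
  shows "(\<lambda>\<nu>. \<integral>x. f x \<partial>\<nu>) \<in> borel_measurable (invariant_measures_borel T)"
proof (rule borel_measurableI)
  fix S :: "real set" assume "open S"
  then have "openin (weak_star_topology T) {\<nu> \<in> invariant_measures T. (\<integral>x. f x \<partial>\<nu>) \<in> S}"
    unfolding weak_star_topology_def using assms by (intro topology_generated_by_Basis) blast
  then have "{\<nu> \<in> invariant_measures T. (\<integral>x. f x \<partial>\<nu>) \<in> S} \<in> sets (invariant_measures_borel T)"
    unfolding invariant_measures_borel_def
    by (subst sets_measure_of) (auto dest: openin_weak_star_subset)
  also have "{\<nu> \<in> invariant_measures T. (\<integral>x. f x \<partial>\<nu>) \<in> S}
      = (\<lambda>\<nu>. \<integral>x. f x \<partial>\<nu>) -` S \<inter> space (invariant_measures_borel T)"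
    by (auto simp: space_invariant_measures_borel)
  finally show "(\<lambda>\<nu>. \<integral>x. f x \<partial>\<nu>) -` S \<inter> space (invariant_measures_borel T) \<in> sets (invariant_measures_borel T)" .
qed

text \<open>The indicator of a closed set is a pointwise limit of bounded continuous functions,
  whose integrals are measurable in \<nu> by the choice of the topology.\<close>

lemma weak_star_measure_closed_measurable:
  fixes A :: "'a::compact_metric_space set"
  assumes "closed A"
  shows "(\<lambda>\<nu>. measure \<nu> A) \<in> borel_measurable (invariant_measures_borel T)"
proof (cases "A = {}")
  case False
  \<comment> \<open>The empty set is treated apart because \<open>infdist x {} = 0\<close> would
    make these functions constantly one.\<close>
  define f where "f k x = max 0 (1 - real k * infdist x A)" for k and x :: 'a
  have fc: "continuous_on UNIV (f k)" for k
    unfolding f_def by (intro continuous_intros)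
  have f01: "0 \<le> f k x" "f k x \<le> 1" for k x by (auto simp: f_def infdist_nonneg)
  show ?thesis
  proof (rule borel_measurable_LIMSEQ_real)
    show "(\<lambda>\<nu>. \<integral>x. f k x \<partial>\<nu>) \<in> borel_measurable (invariant_measures_borel T)" for k
      by (rule weak_star_integral_measurable[OF fc])
    fix \<nu> assume "\<nu> \<in> space (invariant_measures_borel T)"
    then interpret borel_prob_space \<nu>
      by (auto simp: space_invariant_measures_borel intro: invariant_measuresD)
    have "(\<lambda>k. \<integral>x. f k x \<partial>\<nu>) \<longlonglongrightarrow> (\<integral>x. indicator A x \<partial>\<nu>)"
    proof (rule integral_dominated_convergence[where w="\<lambda>_. 1"])
      show "f k \<in> borel_measurable \<nu>" for k
        by (intro borel_measurable_eq borel_measurable_continuous_onI fc)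
      show "(indicator A :: 'a \<Rightarrow> real) \<in> borel_measurable \<nu>"
        using assms by (intro borel_measurable_indicator) simp
      show "AE x in \<nu>. (\<lambda>k. f k x) \<longlonglongrightarrow> indicator A x"
      proof (rule AE_I2)
        fix x
        show "(\<lambda>k. f k x) \<longlonglongrightarrow> indicator A x"
        proof (cases "x \<in> A")
          case True then show ?thesis by (simp add: f_def)
        next
          case F: False
          then have d: "0 < infdist x A" using in_closed_iff_infdist_zero[OF assms False] infdist_nonneg[of x A] by (simp add: less_le)
          then obtain k0 :: nat where k0: "1 / infdist x A < real k0" using reals_Archimedean2 by blast
          have "f k x = 0" if "k0 \<le> k" for k
          proof -
            have "1 < real k0 * infdist x A" using k0 d by (simp add: pos_divide_less_eq)
            also have "\<dots> \<le> real k * infdist x A" using that d by (intro mult_right_mono) auto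
            finally show ?thesis by (simp add: f_def)
          qed
          then show ?thesis using F by (intro tendsto_eventually) (auto simp: eventually_sequentially)
        qed
      qed
      show "AE x in \<nu>. norm (f k x) \<le> 1" for k using f01 by auto
    qed simp
    then show "(\<lambda>k. \<integral>x. f k x \<partial>\<nu>) \<longlonglongrightarrow> measure \<nu> A" using assms by simp
  qed
qed simp

text \<open>Closed sets form an intersection-stable generator of the Borel sets, so it suffices to
  consider them. Once the identity is known to be a kernel, mixing over \<open>lam\<close> can be
  expressed by \<open>join\<close>.\<close>

lemma invariant_measures_kernel:
  "(\<lambda>\<nu>. \<nu>) \<in> invariant_measures_borel T \<rightarrow>\<^sub>M subprob_algebra borel"
proof (rule measurable_subprob_algebra_generated)
  show "sets borel = sigma_sets UNIV (Collect closed)" by (simp add: borel_eq_closed)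
  show "Int_stable (Collect closed)" by (auto simp: Int_stable_def)
  fix \<nu> assume "\<nu> \<in> space (invariant_measures_borel T)"
  then have "borel_prob_space \<nu>" by (auto simp: space_invariant_measures_borel intro: invariant_measuresD)
  then interpret borel_prob_space \<nu> .
  show "subprob_space \<nu>" by unfold_locales
  show "sets \<nu> = sets borel" by simp
next
  have *: "(\<lambda>\<nu>. emeasure \<nu> A) \<in> borel_measurable (invariant_measures_borel T)" if "closed A" for A
  proof -
    have "emeasure \<nu> A = ennreal (measure \<nu> A)" if "\<nu> \<in> space (invariant_measures_borel T)" for \<nu>
    proof -
      interpret borel_prob_space \<nu>
        using that by (auto simp: space_invariant_measures_borel intro: invariant_measuresD)
      show ?thesis by (rule emeasure_eq_measure)
    qed
    moreover have "(\<lambda>\<nu>. ennreal (measure \<nu> A)) \<in> borel_measurable (invariant_measures_borel T)"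
      using weak_star_measure_closed_measurable[OF that] by simp
    ultimately show ?thesis by (subst measurable_cong)
  qed
  then show "\<And>A. A \<in> Collect closed \<Longrightarrow> (\<lambda>\<nu>. emeasure \<nu> A) \<in> borel_measurable (invariant_measures_borel T)"
    "(\<lambda>\<nu>. emeasure \<nu> UNIV) \<in> borel_measurable (invariant_measures_borel T)" by auto
qed auto

section \<open>Averages over the components of an invariant measure\<close>

locale measure_decomposition = prob_space lam
  for T :: "real ^ 'n \<Rightarrow> 'a::compact_metric_space \<Rightarrow> 'a" and lam :: "'a measure measure" and \<mu> :: "'a measure" +
  assumes T: "continuous_action T"
    and sets_lam: "sets lam = sets (invariant_measures_borel T)"
    and \<mu>: "\<mu> \<in> invariant_measures T"
    and emeasure_\<mu>: "\<And>A. A \<in> sets borel \<Longrightarrow> emeasure \<mu> A = (\<integral>\<^sup>+\<nu>. emeasure \<nu> A \<partial>lam)"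
begin

sublocale \<mu>: borel_prob_space \<mu> using \<mu> by (rule invariant_measuresD)

lemma space_lam: "space lam = invariant_measures T"
  using sets_eq_imp_space_eq[OF sets_lam] by (simp add: space_invariant_measures_borel)

lemma component_prob: "\<nu> \<in> space lam \<Longrightarrow> borel_prob_space \<nu>"
  by (auto simp: space_lam intro: invariant_measuresD)

lemma kernel: "(\<lambda>\<nu>. \<nu>) \<in> lam \<rightarrow>\<^sub>M subprob_algebra borel"
  using invariant_measures_kernel[of T] by (simp cong: measurable_cong_sets add: sets_lam)

text \<open>The decomposition is assumed for sets only. Recognising \<mu> as the \<open>join\<close>
  of a measure on subprobability measures extends it to bounded functions.\<close>

lemma
  fixes f :: "'a \<Rightarrow> real"
  assumes f: "f \<in> borel_measurable borel" and b: "\<And>x. \<bar>f x\<bar> \<le> B"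
  shows component_integral_measurable: "(\<lambda>\<nu>. \<integral>x. f x \<partial>\<nu>) \<in> borel_measurable lam"
    and component_integral_integrable: "integrable lam (\<lambda>\<nu>. \<integral>x. f x \<partial>\<nu>)"
    and integral_decomposition: "(\<integral>x. f x \<partial>\<mu>) = (\<integral>\<nu>. (\<integral>x. f x \<partial>\<nu>) \<partial>lam)"
proof -
  show m: "(\<lambda>\<nu>. \<integral>x. f x \<partial>\<nu>) \<in> borel_measurable lam"
    by (rule measurable_compose[OF kernel integral_measurable_subprob_algebra[OF f]])
  have bd: "\<bar>\<integral>x. f x \<partial>\<nu>\<bar> \<le> B" if "\<nu> \<in> space lam" for \<nu>
  proof -
    interpret \<nu>: borel_prob_space \<nu> using that by (rule component_prob)
    have "integrable \<nu> f" using b by (intro \<nu>.integrable_const_bound[where B=B] \<nu>.borel_measurable_eq f) auto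
    then show ?thesis
      using b \<nu>.integral_le_const[of f B] \<nu>.integral_ge_const[of f "- B"] by (auto simp: abs_le_iff minus_le_iff)
  qed
  show "integrable lam (\<lambda>\<nu>. \<integral>x. f x \<partial>\<nu>)"
    using m bd by (intro integrable_const_bound[where B=B]) auto
  \<comment> \<open>\<open>lam\<close> carries the weak-star Borel sets, whereas \<open>join\<close>
    works with the sigma-algebra of \<open>subprob_algebra\<close>; the push-forward under the
    identity passes from one to the other.\<close>
  define N where "N = distr lam (subprob_algebra borel) (\<lambda>\<nu>. \<nu>)"
  have sN: "sets N = sets (subprob_algebra borel)" by (simp add: N_def)
  have \<mu>N: "\<mu> = join N"
  proof (rule measure_eqI)
    fix A assume "A \<in> sets \<mu>"
    then have A: "A \<in> sets borel" by simp
    have "emeasure (join N) A = (\<integral>\<^sup>+\<nu>. emeasure \<nu> A \<partial>N)" by (rule emeasure_join[OF sN A])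
    also have "\<dots> = (\<integral>\<^sup>+\<nu>. emeasure \<nu> A \<partial>lam)"
      unfolding N_def using A
      by (subst nn_integral_distr[OF kernel]) (simp_all add: measurable_emeasure_subprob_algebra)
    finally show "emeasure \<mu> A = emeasure (join N) A" by (simp add: emeasure_\<mu>[OF A])
  qed (simp add: sets_select_sets[OF sN])
  have "(\<integral>x. f x \<partial>join N) = (\<integral>\<nu>. (\<integral>x. f x \<partial>\<nu>) \<partial>N)"
  proof (rule integral_join[OF f _ sN, where B'=1])
    show "\<bar>f x\<bar> \<le> B" for x by (rule b)
    show "finite_measure N"
      unfolding N_def using kernel by (rule finite_measure_distr)
    show "AE \<nu> in N. emeasure \<nu> (space \<nu>) \<le> ennreal 1"
      using sets_eq_imp_space_eq[OF sN]
      by (intro AE_I2) (auto simp: space_subprob_algebra subprob_space.emeasure_space_le_1)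
  qed
  also have "\<dots> = (\<integral>\<nu>. (\<integral>x. f x \<partial>\<nu>) \<partial>lam)"
    unfolding N_def by (rule integral_distr[OF kernel integral_measurable_subprob_algebra[OF f]])
  finally show "(\<integral>x. f x \<partial>\<mu>) = (\<integral>\<nu>. (\<integral>x. f x \<partial>\<nu>) \<partial>lam)" by (simp add: \<mu>N)
qed

text \<open>Only the output entropy is nonlinear in \<nu>, and its mean is bounded by Jensen's
  inequality over \<open>lam\<close>; the conditional entropy is an integral against \<nu> and
  averages exactly.\<close>

lemma
  assumes c: "channel I p"
  shows channel_info_integrable: "integrable lam (\<lambda>\<nu>. channel_info \<nu> I p)"
    and integral_channel_info_le: "(\<integral>\<nu>. channel_info \<nu> I p \<partial>lam) \<le> channel_info \<mu> I p"
proof -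
  \<comment> \<open>The truncation changes nothing on \<open>space lam\<close>. It is there because
    \<open>jensen_ent\<close> and \<open>integrable_ent\<close> ask for bounds at every argument of
    the type, including measures that are not components.\<close>
  define q where "q i \<nu> = max 0 (min 1 (\<integral>x. p i x \<partial>\<nu>))" for i and \<nu> :: "'a measure"
  have pb: "\<bar>p i x\<bar> \<le> 1" if "i \<in> I" for i x
    using channel_nonneg[OF c that, of x] channel_le_1[OF c that, of x] by simp
  note pm = channel_measurable[OF c]
  obtain B where B: "\<And>t. t \<in> {0..1} \<Longrightarrow> \<bar>ent t\<bar> \<le> B" using ent_bounded by blast
  have eb: "\<bar>ent (p i x)\<bar> \<le> B" if "i \<in> I" for i x
    using channel_nonneg[OF c that, of x] channel_le_1[OF c that, of x] by (intro B) simp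
  have em: "(\<lambda>x. ent (p i x)) \<in> borel_measurable borel" if "i \<in> I" for i
    by (rule measurable_compose[OF pm[OF that] borel_measurable_ent])
  have q: "q i \<nu> = (\<integral>x. p i x \<partial>\<nu>)" if "\<nu> \<in> space lam" "i \<in> I" for i \<nu>
  proof -
    interpret \<nu>: borel_prob_space \<nu> using that(1) by (rule component_prob)
    show ?thesis
      using \<nu>.integral_channel_nonneg[OF c that(2)] \<nu>.integral_channel_le_1[OF c that(2)] by (simp add: q_def)
  qed
  have qm: "q i \<in> borel_measurable lam" if "i \<in> I" for i
    unfolding q_def[abs_def]
    using component_integral_measurable[OF pm[OF that] pb[OF that]] by simp
  have q01: "0 \<le> q i \<nu>" "q i \<nu> \<le> 1" for i \<nu> by (auto simp: q_def)
  have eq: "channel_info \<nu> I p = (\<Sum>i\<in>I. ent (q i \<nu>) - (\<integral>x. ent (p i x) \<partial>\<nu>))" if "\<nu> \<in> space lam" for \<nu>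
    unfolding channel_info_def by (intro sum.cong refl) (simp add: q[OF that])
  have int1: "integrable lam (\<lambda>\<nu>. ent (q i \<nu>))" if "i \<in> I" for i
    using qm[OF that] q01 by (rule integrable_ent)
  have int2: "integrable lam (\<lambda>\<nu>. \<integral>x. ent (p i x) \<partial>\<nu>)" if "i \<in> I" for i
    by (rule component_integral_integrable[OF em[OF that] eb[OF that]])
  show "integrable lam (\<lambda>\<nu>. channel_info \<nu> I p)"
    using int1 int2 by (subst Bochner_Integration.integrable_cong[OF refl eq]) auto
  have "(\<integral>\<nu>. channel_info \<nu> I p \<partial>lam) = (\<integral>\<nu>. (\<Sum>i\<in>I. ent (q i \<nu>) - (\<integral>x. ent (p i x) \<partial>\<nu>)) \<partial>lam)"
    by (intro Bochner_Integration.integral_cong refl eq)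
  also have "\<dots> = (\<Sum>i\<in>I. (\<integral>\<nu>. ent (q i \<nu>) \<partial>lam) - (\<integral>\<nu>. (\<integral>x. ent (p i x) \<partial>\<nu>) \<partial>lam))"
    using int1 int2 by (simp add: Bochner_Integration.integral_sum)
  also have "\<dots> \<le> (\<Sum>i\<in>I. ent (\<integral>x. p i x \<partial>\<mu>) - (\<integral>x. ent (p i x) \<partial>\<mu>))"
  proof (rule sum_mono)
    fix i assume i: "i \<in> I"
    have "(\<integral>\<nu>. ent (q i \<nu>) \<partial>lam) \<le> ent (\<integral>\<nu>. q i \<nu> \<partial>lam)" using qm[OF i] q01 by (rule jensen_ent)
    also have "(\<integral>\<nu>. q i \<nu> \<partial>lam) = (\<integral>x. p i x \<partial>\<mu>)"
      unfolding integral_decomposition[OF pm[OF i] pb[OF i]]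
      by (intro Bochner_Integration.integral_cong refl q i)
    finally show "(\<integral>\<nu>. ent (q i \<nu>) \<partial>lam) - (\<integral>\<nu>. (\<integral>x. ent (p i x) \<partial>\<nu>) \<partial>lam)
        \<le> ent (\<integral>x. p i x \<partial>\<mu>) - (\<integral>x. ent (p i x) \<partial>\<mu>)"
      using integral_decomposition[OF em[OF i] eb[OF i]] by simp
  qed
  finally show "(\<integral>\<nu>. channel_info \<nu> I p \<partial>lam) \<le> channel_info \<mu> I p" by (simp add: channel_info_def)
qed

text \<open>The function \<open>j\<close> is a measurable substitute for \<open>\<nu> \<mapsto> rate_distortion T \<nu> (C * \<epsilon>)\<close>, whose
  measurability is not known.\<close>

lemma exists_rate_bound:
  assumes r: "rate_distortion T \<mu> \<epsilon> < r" and \<epsilon>: "0 < \<epsilon>" and C: "0 < C"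
  obtains j A where "j \<in> borel_measurable lam" "(\<integral>\<^sup>+\<nu>. j \<nu> \<partial>lam) \<le> r" "A \<in> sets lam"
    "measure lam (space lam - A) \<le> 1 / C" "\<And>\<nu>. \<nu> \<in> A \<Longrightarrow> rate_distortion T \<nu> (C * \<epsilon>) \<le> j \<nu>"
proof -
  obtain L where L: "0 < L" and "rate_distortion_on T L \<mu> \<epsilon> / ennreal (L ^ CARD('n)) < r"
    using r by (auto simp: rate_distortion_eq_INF[OF T \<mu>] INF_less_iff)
  then have "rate_distortion_on T L \<mu> \<epsilon> < r * ennreal (L ^ CARD('n))"
    by (subst (asm) divide_less_ennreal) auto
  then obtain F p where F: "F \<subseteq> L1_space L" and c: "channel F p"
    and d: "(\<integral>x. channel_distortion T L F (\<lambda>b. b) p x \<partial>\<mu>) < \<epsilon>"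
    and J: "ennreal (channel_info \<mu> F p) < r * ennreal (L ^ CARD('n))"
    by (rule exists_channel_of_rate_less[OF T \<mu>.borel_prob_space_axioms L])
  let ?cd = "channel_distortion T L F (\<lambda>b. b) p"
  have F': "\<And>b. b \<in> F \<Longrightarrow> b \<in> L1_space L" using F by auto
  obtain D where D: "\<And>x y::'a. dist x y \<le> D" using ex_diameter_bound by blast
  have cdm: "?cd \<in> borel_measurable borel" by (rule channel_distortion_measurable[OF T L c F'])
  have cd0: "0 \<le> ?cd x" for x by (rule channel_distortion_bounds(1)[OF T L c F'])
  have cdb: "\<bar>?cd x\<bar> \<le> D" for x
    using cd0 channel_distortion_bounds(2)[OF T L c F' D] by simp
  note cd = component_integral_measurable[OF cdm cdb] component_integral_integrable[OF cdm cdb]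
    integral_decomposition[OF cdm cdb]
  define j where "j \<nu> = ennreal (channel_info \<nu> F p) / ennreal (L ^ CARD('n))" for \<nu>
  \<comment> \<open>Markov's inequality controls the complement: the mean of these integrals over
    \<open>lam\<close> is the distortion under \<mu>, which is below \<epsilon>.\<close>
  define A where "A = {\<nu>\<in>space lam. (\<integral>x. ?cd x \<partial>\<nu>) < C * \<epsilon>}"
  have cim: "(\<lambda>\<nu>. channel_info \<nu> F p) \<in> borel_measurable lam"
    using channel_info_integrable[OF c] by auto
  show thesis
  proof
    show "j \<in> borel_measurable lam" unfolding j_def[abs_def] using cim by simp
    have "(\<integral>\<^sup>+\<nu>. j \<nu> \<partial>lam) = (\<integral>\<^sup>+\<nu>. ennreal (channel_info \<nu> F p) \<partial>lam) / ennreal (L ^ CARD('n))"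
      unfolding j_def using cim by (intro nn_integral_divide) simp
    also have "(\<integral>\<^sup>+\<nu>. ennreal (channel_info \<nu> F p) \<partial>lam) = ennreal (\<integral>\<nu>. channel_info \<nu> F p \<partial>lam)"
      using channel_info_integrable[OF c] borel_prob_space.channel_info_nonneg[OF component_prob c]
      by (intro nn_integral_eq_integral) auto
    also have "\<dots> \<le> ennreal (channel_info \<mu> F p)"
      by (intro ennreal_leI integral_channel_info_le[OF c])
    also have "ennreal (channel_info \<mu> F p) / ennreal (L ^ CARD('n)) < r"
      using J L by (subst divide_less_ennreal) auto
    finally show "(\<integral>\<^sup>+\<nu>. j \<nu> \<partial>lam) \<le> r" by (simp add: divide_right_mono_ennreal)
    show A: "A \<in> sets lam" unfolding A_def using cd(1) by simp
    have "measure lam (space lam - A) = measure lam {\<nu>\<in>space lam. C * \<epsilon> \<le> (\<integral>x. ?cd x \<partial>\<nu>)}"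
      by (intro arg_cong[where f="measure lam"]) (auto simp: A_def)
    also have "\<dots> \<le> (\<integral>\<nu>. (\<integral>x. ?cd x \<partial>\<nu>) \<partial>lam) / (C * \<epsilon>)"
      using cd(2) cd0 \<epsilon> C by (intro integral_Markov_inequality_measure[where A="{}"]) (auto intro!: integral_nonneg_AE)
    also have "\<dots> \<le> \<epsilon> / (C * \<epsilon>)"
      using d \<epsilon> C by (intro divide_right_mono) (auto simp: cd(3)[symmetric])
    also have "\<dots> = 1 / C" using \<epsilon> by simp
    finally show "measure lam (space lam - A) \<le> 1 / C" .
    fix \<nu> assume \<nu>: "\<nu> \<in> A"
    then have \<nu>T: "\<nu> \<in> invariant_measures T" by (simp add: A_def space_lam)
    have "rate_distortion T \<nu> (C * \<epsilon>) \<le> rate_distortion_on T L \<nu> (C * \<epsilon>) / ennreal (L ^ CARD('n))"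
      unfolding rate_distortion_eq_INF[OF T \<nu>T] using L by (intro INF_lower) simp
    also have "\<dots> \<le> j \<nu>"
      unfolding j_def using \<nu> F'
      by (intro divide_right_mono_ennreal rate_distortion_on_le[OF invariant_measuresD(1)[OF \<nu>T] T L c]) (auto simp: A_def)
    finally show "rate_distortion T \<nu> (C * \<epsilon>) \<le> j \<nu>" .
  qed
qed

end

section \<open>Passage to vanishing distortion\<close>

lemma Liminf_le_compose:
  fixes g :: "'b \<Rightarrow> 'c::complete_linorder"
  assumes "filterlim h F G"
  shows "Liminf F g \<le> Liminf G (\<lambda>x. g (h x))"
  unfolding le_Liminf_iff using less_LiminfD[of _ F g] assms by (auto simp: filterlim_iff)

lemma (in measure_decomposition) lower_rdim_decomposition:
  "(\<integral>\<^sup>+\<nu>. lower_rdim T \<nu> \<partial>lam) \<le> lower_rdim T \<mu>"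
proof (rule dense_ge)
  fix c' assume "lower_rdim T \<mu> < c'"
  then obtain c1 where c1: "lower_rdim T \<mu> < c1" "c1 < c'" using dense by blast
  \<comment> \<open>Two thresholds below \<open>c'\<close>, hence finite. The gap between
    \<open>c\<close> and \<open>c1\<close> pays for the change from \<epsilon> to the larger
    distortion \<open>2 ^ n * \<epsilon>\<close>.\<close>
  obtain c where c: "lower_rdim T \<mu> < c" "c < c1" using dense[OF c1(1)] by blast
  obtain \<gamma>1 where \<gamma>1: "0 \<le> \<gamma>1" "c1 = ennreal \<gamma>1" using c1(2) by (cases c1) auto
  obtain \<gamma> where \<gamma>: "0 \<le> \<gamma>" "c = ennreal \<gamma>" using c(2) \<gamma>1 by (cases c) auto
  have \<gamma>\<gamma>1: "\<gamma> < \<gamma>1" using c(2) \<gamma> \<gamma>1 by (simp add: ennreal_less_iff)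
  let ?f = "\<lambda>\<epsilon>. rate_distortion T \<mu> \<epsilon> / ennreal (log 2 (1 / \<epsilon>))"
  \<comment> \<open>A lower limit below \<open>c\<close> gives arbitrarily small \<epsilon> with
    this property, not all small ones. This is enough, as one \<epsilon> is picked for each
    \<open>n\<close>.\<close>
  have freq: "\<exists>\<^sub>F \<epsilon> in at_right 0. ?f \<epsilon> < c"
  proof (rule ccontr)
    assume "\<not> (\<exists>\<^sub>F \<epsilon> in at_right 0. ?f \<epsilon> < c)"
    then have "eventually (\<lambda>\<epsilon>. c \<le> ?f \<epsilon>) (at_right 0)" by (simp add: not_frequently not_less)
    then have "c \<le> lower_rdim T \<mu>" unfolding lower_rdim_def by (rule Liminf_bounded)
    then show False using c(1) by simp
  qed
  have "\<exists>\<delta> j A. 0 < \<delta> \<and> \<delta> < (1 / 2) ^ n \<and> j \<in> borel_measurable lam \<and>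
      (\<integral>\<^sup>+\<nu>. j \<nu> \<partial>lam) \<le> ennreal (\<gamma>1 * log 2 (1 / \<delta>)) \<and> A \<in> sets lam \<and>
      measure lam (space lam - A) \<le> (1 / 2) ^ n \<and> (\<forall>\<nu>\<in>A. rate_distortion T \<nu> \<delta> \<le> j \<nu>)" for n :: nat
  proof -
    \<comment> \<open>The bound \<open>(1 / 4) ^ n\<close> gives
      \<open>2 ^ n * \<epsilon> < (1 / 2) ^ n\<close>, so that the enlarged distortions still tend
      to zero.\<close>
    have "eventually (\<lambda>\<epsilon>::real. \<epsilon> \<in> {0<..<(1 / 4) ^ n}) (at_right 0)"
      by (rule eventually_at_right_real) simp
    moreover have "filterlim (\<lambda>\<epsilon>::real. log 2 (1 / \<epsilon>)) at_top (at_right 0)" by real_asymp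
    \<comment> \<open>Rearranged, this says \<open>\<gamma> * log 2 (1 / \<epsilon>) \<le> \<gamma>1
      * (log 2 (1 / \<epsilon>) - real n)\<close>, where \<open>n\<close> is the logarithm of the
      factor \<open>2 ^ n\<close>.\<close>
    then have "eventually (\<lambda>\<epsilon>. \<gamma>1 * real n / (\<gamma>1 - \<gamma>) \<le> log 2 (1 / \<epsilon>)) (at_right 0)"
      unfolding filterlim_at_top by blast
    ultimately have "eventually (\<lambda>\<epsilon>. \<epsilon> \<in> {0<..<(1 / 4) ^ n} \<and> \<gamma>1 * real n / (\<gamma>1 - \<gamma>) \<le> log 2 (1 / \<epsilon>)) (at_right 0)"
      by (rule eventually_conj)
    note frequently_ex[OF frequently_eventually_frequently[OF freq this]]
    then obtain \<epsilon> where \<epsilon>: "?f \<epsilon> < c" "0 < \<epsilon>" "\<epsilon> < (1 / 4) ^ n" "\<gamma>1 * real n / (\<gamma>1 - \<gamma>) \<le> log 2 (1 / \<epsilon>)"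
      by auto
    define \<delta> where "\<delta> = 2 ^ n * \<epsilon>"
    have "\<epsilon> < 1" using \<epsilon>(3) power_le_one[of "1/4::real" n] by simp
    then have l0: "0 < log 2 (1 / \<epsilon>)" using \<epsilon>(2) by (simp add: log_divide)
    have "\<delta> < 2 ^ n * (1 / 4) ^ n" unfolding \<delta>_def using \<epsilon>(3) by simp
    also have "\<dots> = (1 / 2) ^ n" by (simp add: power_mult_distrib[symmetric])
    finally have \<delta>: "0 < \<delta>" "\<delta> < (1 / 2) ^ n" using \<epsilon>(2) by (auto simp: \<delta>_def)
    have log\<delta>: "log 2 (1 / \<delta>) = log 2 (1 / \<epsilon>) - real n"
      using \<epsilon>(2) by (simp add: \<delta>_def log_divide log_mult log_nat_power)
    have "\<gamma>1 * real n \<le> log 2 (1 / \<epsilon>) * (\<gamma>1 - \<gamma>)"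
      using \<epsilon>(4) \<gamma>\<gamma>1 by (simp add: pos_divide_le_eq)
    then have le: "\<gamma> * log 2 (1 / \<epsilon>) \<le> \<gamma>1 * log 2 (1 / \<delta>)"
      unfolding log\<delta> by (simp add: algebra_simps)
    have "rate_distortion T \<mu> \<epsilon> < c * ennreal (log 2 (1 / \<epsilon>))"
      using \<epsilon>(1) l0 by (subst (asm) divide_less_ennreal) auto
    also have "\<dots> = ennreal (\<gamma> * log 2 (1 / \<epsilon>))" using \<gamma> l0 by (simp add: ennreal_mult)
    also have "\<dots> \<le> ennreal (\<gamma>1 * log 2 (1 / \<delta>))" using le by (rule ennreal_leI)
    finally obtain j A where "j \<in> borel_measurable lam" "(\<integral>\<^sup>+\<nu>. j \<nu> \<partial>lam) \<le> ennreal (\<gamma>1 * log 2 (1 / \<delta>))"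
      "A \<in> sets lam" "measure lam (space lam - A) \<le> 1 / 2 ^ n" "\<And>\<nu>. \<nu> \<in> A \<Longrightarrow> rate_distortion T \<nu> (2 ^ n * \<epsilon>) \<le> j \<nu>"
      by (rule exists_rate_bound[OF _ \<epsilon>(2), of _ "2 ^ n"]) auto
    then show ?thesis using \<delta> unfolding \<delta>_def[symmetric] power_one_over by blast
  qed
  then obtain \<delta> j A where \<delta>: "\<And>n. 0 < \<delta> n" "\<And>n. \<delta> n < (1 / 2) ^ n"
    and j: "\<And>n. j n \<in> borel_measurable lam" "\<And>n. (\<integral>\<^sup>+\<nu>. j n \<nu> \<partial>lam) \<le> ennreal (\<gamma>1 * log 2 (1 / \<delta> n))"
    and A: "\<And>n. A n \<in> sets lam" "\<And>n. measure lam (space lam - A n) \<le> (1 / 2) ^ n"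
    and jA: "\<And>n \<nu>. \<nu> \<in> A n \<Longrightarrow> rate_distortion T \<nu> (\<delta> n) \<le> j n \<nu>"
    by metis
  define u where "u n \<nu> = j n \<nu> / ennreal (log 2 (1 / \<delta> n))" for n \<nu>
  \<comment> \<open>The bound by \<open>(1 / 2) ^ n\<close> is strict, so
    \<open>\<delta> n < 1\<close> already for \<open>n = 0\<close> and every divisor is
    positive.\<close>
  have l0: "0 < log 2 (1 / \<delta> n)" for n
    using \<delta>[of n] power_le_one[of "1/2::real" n] by (simp add: log_divide)
  have \<delta>0: "filterlim \<delta> (at_right 0) sequentially"
  proof (rule tendsto_imp_filterlim_at_right)
    show "\<delta> \<longlonglongrightarrow> 0"
    proof (rule tendsto_sandwich[of "\<lambda>_. 0" _ _ "\<lambda>n. (1 / 2) ^ n"])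
      show "(\<lambda>n. (1 / 2) ^ n :: real) \<longlonglongrightarrow> 0" by (intro LIMSEQ_realpow_zero) auto
    qed (use \<delta> in \<open>auto intro!: always_eventually less_imp_le\<close>)
  qed (use \<delta> in auto)
  \<comment> \<open>The exceptional sets have summable measures, so almost every component lies in
    all but finitely many of the \<open>A n\<close>, where \<open>u n\<close> dominates the rate
    quotient at \<open>\<delta> n\<close>.\<close>
  have "AE \<nu> in lam. eventually (\<lambda>n. \<nu> \<in> space lam - (space lam - A n)) sequentially"
  proof (rule borel_cantelli_AE1)
    show "summable (\<lambda>n. measure lam (space lam - A n))"
      using A(2) by (intro summable_comparison_test'[OF summable_geometric[of "1/2::real"]]) auto
  qed (use A in \<open>auto simp: emeasure_eq_measure\<close>)
  then have "AE \<nu> in lam. lower_rdim T \<nu> \<le> liminf (\<lambda>n. u n \<nu>)"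
  proof eventually_elim
    case (elim \<nu>)
    have "lower_rdim T \<nu> \<le> liminf (\<lambda>n. rate_distortion T \<nu> (\<delta> n) / ennreal (log 2 (1 / \<delta> n)))"
      unfolding lower_rdim_def by (rule Liminf_le_compose[OF \<delta>0])
    also have "\<dots> \<le> liminf (\<lambda>n. u n \<nu>)"
      using elim by (intro Liminf_mono) (auto elim!: eventually_mono simp: u_def intro!: divide_right_mono_ennreal jA)
    finally show ?case .
  qed
  then have "(\<integral>\<^sup>+\<nu>. lower_rdim T \<nu> \<partial>lam) \<le> (\<integral>\<^sup>+\<nu>. liminf (\<lambda>n. u n \<nu>) \<partial>lam)"
    by (rule nn_integral_mono_AE)
  also have "\<dots> \<le> liminf (\<lambda>n. \<integral>\<^sup>+\<nu>. u n \<nu> \<partial>lam)"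
    using j(1) by (intro nn_integral_liminf) (simp add: u_def[abs_def])
  also have "\<dots> \<le> liminf (\<lambda>n::nat. c1)"
  proof (intro Liminf_mono always_eventually allI)
    fix n
    have "(\<integral>\<^sup>+\<nu>. u n \<nu> \<partial>lam) = (\<integral>\<^sup>+\<nu>. j n \<nu> \<partial>lam) / ennreal (log 2 (1 / \<delta> n))"
      unfolding u_def using j(1) by (rule nn_integral_divide)
    also have "\<dots> \<le> ennreal (\<gamma>1 * log 2 (1 / \<delta> n)) / ennreal (log 2 (1 / \<delta> n))"
      by (intro divide_right_mono_ennreal j(2))
    also have "\<dots> = c1" using l0[of n] \<gamma>1 by (simp add: divide_ennreal)
    finally show "(\<integral>\<^sup>+\<nu>. u n \<nu> \<partial>lam) \<le> c1" .
  qed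
  also have "\<dots> = c1" by (rule Liminf_const) simp
  finally show "(\<integral>\<^sup>+\<nu>. lower_rdim T \<nu> \<partial>lam) \<le> c'" using c1(2) by simp
qed

theorem theorem1p2:
  fixes T :: "real ^ 'n \<Rightarrow> 'a::compact_metric_space \<Rightarrow> 'a"
    and lam :: "'a measure measure"
    and \<mu> :: "'a measure"
  assumes "continuous_action T"
    and "prob_space lam"
    and "sets lam = sets (invariant_measures_borel T)"
    and "\<mu> \<in> invariant_measures T"
    and "\<And>A. A \<in> sets borel \<Longrightarrow> emeasure \<mu> A = (\<integral>\<^sup>+\<nu>. emeasure \<nu> A \<partial>lam)"
  shows "lower_rdim T \<mu> \<ge> (\<integral>\<^sup>+\<nu>. lower_rdim T \<nu> \<partial>lam)"
  using assms
  by (intro measure_decomposition.lower_rdim_decomposition measure_decomposition.intro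
      measure_decomposition_axioms.intro)

end
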